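(* Let $\{S_n\}$ be a sequence of distinct finite Galois-stable subsets of $\overline{\mathbb{Q}}$ with $\lim_n h_{\mathcal M}(S_n)=0$. Then for every place $v$ of $\mathbb{Q}$, $\{S_n\}$ is pseudo-equidistributed with respect to $(M_v,\lambda_v)$. In particular, $\{S_n\}$ (viewed in $\mathbb{C}$) is equidistributed with respect to the equilibrium measure $\mu_M$ of the Mandelbrot set $M=M_\infty$.
   Context: For $c\in\mathbb{C}_v$ let $\phi_c(z)=z^2+c$ and $\psi_n(c)=\phi_c^n(0)$. The Mandelbrot set is $M_\infty=\{c\in\mathbb{C}:\{\phi_c^n(0)\}\text{ bounded}\}$; for a prime $p$, $M_p=\{c\in\mathbb{C}_p:|c|_p\le1\}$ ($\mathbb{C}_p$ the completion of an algebraic closure of $\mathbb{Q}_p$). Set $\lambda_p(z)=\log^+|z|_p$ and $\lambda_\infty(z)=\lim_{n\to\infty}2^{-(n-1)}\log^+|\psi_n(z)/2|$, with $\log^+x=\log\max(x,1)$. Fix embeddings $\overline{\mathbb{Q}}\hookrightarrow\mathbb{C}_v$ for all $v$. For finite Galois-stable $S$, $h_{\mathcal M}(S)=\frac1{\#S}\sum_{\alpha\in S}\big(\lambda_\infty(\alpha)+\sum_p\lambda_p(\alpha)\big)$. Transfinite diameter $c(A)=\lim_n\sup_{x_i\in A}\prod_{i\ne j}|x_i-x_j|^{1/(n(n-1))}$ (here $c(M_v)=1$ for all $v$); for finite $T$, $N=\#T$, $\delta(T)=\prod_{x\ne y\in T}|x-y|_v^{1/(N(N-1))}$. $\{S_n\}$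 is pseudo-equidistributed w.r.t. $(M_v,\lambda_v)$ if $\frac1{\#S_n}\sum_{z\in S_n}\lambda_v(z)\to0$, $\#S_n\to\infty$, and $\lim_n\delta(S_n)=c(M_v)$. $\mu_M$ is the unique probability measure on $M$ minimizing $\iint-\log|x-y|\,d\mu d\mu$; equidistributed means $\frac1{\#S_n}\sum_{z\in S_n}\delta_z\to\mu_M$ weakly. *)

theory Defs
  imports "HOL-Probability.Probability" "HOL-Algebra.Algebraic_Closure_Type"
begin

hide_const (open) Divisibility.prime

section \<open>Absolute values, completions and the fields of p-adic complex numbers\<close>

definition is_absolute_value :: "'a ring \<Rightarrow> ('a \<Rightarrow> real) \<Rightarrow> bool" where
  "is_absolute_value F v \<longleftrightarrow>
     (\<forall>x\<in>carrier F. 0 \<le> v x \<and> (v x = 0 \<longleftrightarrow> x = \<zero>\<^bsub>F\<^esub>)) \<and>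
     (\<forall>x\<in>carrier F. \<forall>y\<in>carrier F.
        v (x \<otimes>\<^bsub>F\<^esub> y) = v x * v y \<and> v (x \<oplus>\<^bsub>F\<^esub> y) \<le> v x + v y)"

definition av_dist :: "'a ring \<Rightarrow> ('a \<Rightarrow> real) \<Rightarrow> 'a \<Rightarrow> 'a \<Rightarrow> real" where
  "av_dist F v x y = v (x \<ominus>\<^bsub>F\<^esub> y)"

definition is_completion ::
  "'a ring \<Rightarrow> ('a \<Rightarrow> real) \<Rightarrow> 'b ring \<Rightarrow> ('b \<Rightarrow> real) \<Rightarrow> ('a \<Rightarrow> 'b) \<Rightarrow> bool" where
  "is_completion F v K w i \<longleftrightarrow>
     field F \<and> is_absolute_value F v \<and> field K \<and> is_absolute_value K w \<and>
     i \<in> ring_hom F K \<and> (\<forall>x\<in>carrier F. w (i x) = v x) \<and>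
     Metric_space.mcomplete (carrier K) (av_dist K w) \<and>
     Metric_space.mtopology (carrier K) (av_dist K w) closure_of (i ` carrier F) = carrier K"

definition padic_abs :: "nat \<Rightarrow> rat \<Rightarrow> real" where
  "padic_abs p x = (if x = 0 then 0 else
     (case quotient_of x of (a, b) \<Rightarrow>
        real p powi (int (multiplicity (int p) b) - int (multiplicity (int p) a))))"

text \<open>
  There is no type depending on the prime \<open>p\<close>, so \<open>\<complex>\<^sub>p\<close> is any valued field \<open>(K, v)\<close> with a tower
  \<open>\<rat> \<subseteq> Qp \<subseteq> L \<subseteq> K\<close> in which \<open>Qp\<close> is a completion of \<open>\<rat>\<close> for the p-adic absolute value,
  \<open>L\<close> is an algebraic closure of \<open>Qp\<close> (with \<open>v\<close> extending the absolute value of \<open>Qp\<close>), and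
  \<open>K\<close> is a completion of \<open>L\<close>. This determines \<open>(K, v)\<close> up to isometric isomorphism.
\<close>

definition is_padic_complex_field :: "nat \<Rightarrow> 'k ring \<Rightarrow> ('k \<Rightarrow> real) \<Rightarrow> bool" where
  "is_padic_complex_field p K v \<longleftrightarrow>
     (\<exists>Qp L i.
        is_completion (ring_of_type_algebra :: rat ring) (padic_abs p) (K\<lparr>carrier := Qp\<rparr>) v i \<and>
        algebraic_closure (K\<lparr>carrier := L\<rparr>) Qp \<and>
        is_completion (K\<lparr>carrier := L\<rparr>) v K v id)"


section \<open>Algebraic numbers\<close>

type_synonym qbar = "rat alg_closure"

abbreviation Qbar :: "qbar ring" where
  "Qbar \<equiv> ring_of_type_algebra"

text \<open>Field automorphisms of \<open>Qbar\<close> fix the prime field \<open>\<rat>\<close>, so they form the absolute Galois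
  group of \<open>\<rat>\<close>.\<close>

definition galois_stable :: "qbar set \<Rightarrow> bool" where
  "galois_stable S \<longleftrightarrow> (\<forall>\<sigma> \<in> ring_iso Qbar Qbar. \<sigma> ` S = S)"


section \<open>The Mandelbrot sets and their local and global heights\<close>

definition psi :: "nat \<Rightarrow> complex \<Rightarrow> complex" where
  "psi n c = ((\<lambda>z. z\<^sup>2 + c) ^^ n) 0"

definition mandelbrot :: "complex set" where
  "mandelbrot = {c. bounded (range (\<lambda>n. psi n c))}"

definition padic_mandelbrot :: "'k ring \<Rightarrow> ('k \<Rightarrow> real) \<Rightarrow> 'k set" where
  "padic_mandelbrot K v = {c \<in> carrier K. v c \<le> 1}"

definition log_plus :: "real \<Rightarrow> real" where
  "log_plus x = ln (max x 1)"

definition lambda_inf :: "complex \<Rightarrow> real" where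
  "lambda_inf z = lim (\<lambda>n. 2 powr (- (real n - 1)) * log_plus (cmod (psi n z / 2)))"

definition lambda_padic :: "('k \<Rightarrow> real) \<Rightarrow> 'k \<Rightarrow> real" where
  "lambda_padic v z = log_plus (v z)"

definition mandelbrot_height ::
  "(qbar \<Rightarrow> complex) \<Rightarrow> (nat \<Rightarrow> 'k \<Rightarrow> real) \<Rightarrow> (nat \<Rightarrow> qbar \<Rightarrow> 'k) \<Rightarrow> qbar set \<Rightarrow> real" where
  "mandelbrot_height \<iota>inf av \<iota> S =
     1 / real (card S) *
       (\<Sum>\<alpha>\<in>S. lambda_inf (\<iota>inf \<alpha>) + (\<Sum>\<^sub>\<infinity>p\<in>{p. prime p}. lambda_padic (av p) (\<iota> p \<alpha>)))"


section \<open>Transfinite diameter and pseudo-equidistribution\<close>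

text \<open>Here \<open>d x y\<close> stands for \<open>\<bar>x - y\<bar>\<^sub>v\<close>.\<close>

definition transfinite_diameter :: "('a \<Rightarrow> 'a \<Rightarrow> real) \<Rightarrow> 'a set \<Rightarrow> real" where
  "transfinite_diameter d A = lim (\<lambda>n.
     SUP x \<in> {..<n} \<rightarrow> A.
       \<Prod>(i, j) \<in> {(i, j). i < n \<and> j < n \<and> i \<noteq> j}. d (x i) (x j) powr (1 / (real n * (real n - 1))))"

definition finite_diameter :: "('a \<Rightarrow> 'a \<Rightarrow> real) \<Rightarrow> 'a set \<Rightarrow> real" where
  "finite_diameter d T =
     (\<Prod>(x, y) \<in> {(x, y). x \<in> T \<and> y \<in> T \<and> x \<noteq> y}.
        d x y powr (1 / (real (card T) * (real (card T) - 1))))"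

definition pseudo_equidistributed ::
  "('a \<Rightarrow> 'a \<Rightarrow> real) \<Rightarrow> 'a set \<Rightarrow> ('a \<Rightarrow> real) \<Rightarrow> (nat \<Rightarrow> 'a set) \<Rightarrow> bool" where
  "pseudo_equidistributed d M lam T \<longleftrightarrow>
     (\<lambda>n. 1 / real (card (T n)) * (\<Sum>z\<in>T n. lam z)) \<longlonglongrightarrow> 0 \<and>
     filterlim (\<lambda>n. card (T n)) at_top sequentially \<and>
     (\<lambda>n. finite_diameter d (T n)) \<longlonglongrightarrow> transfinite_diameter d M"


section \<open>Equilibrium measure and equidistribution in the complex plane\<close>

text \<open>The diagonal needs its own case because \<open>ln 0 = 0\<close> in the library.\<close>

definition log_kernel :: "complex \<Rightarrow> complex \<Rightarrow> ereal" where
  "log_kernel x y = (if x = y then \<infinity> else ereal (- ln (cmod (x - y))))"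

text \<open>Integral of the positive part minus integral of the negative part (\<open>e2ennreal\<close> truncates at
  \<open>0\<close>). For a probability measure carried by a bounded set the second integral is finite, so the
  difference is meaningful in \<open>(-\<infinity>, \<infinity>]\<close>.\<close>

definition log_energy :: "complex measure \<Rightarrow> ereal" where
  "log_energy \<mu> =
     enn2ereal (\<integral>\<^sup>+x. (\<integral>\<^sup>+y. e2ennreal (log_kernel x y) \<partial>\<mu>) \<partial>\<mu>) -
     enn2ereal (\<integral>\<^sup>+x. (\<integral>\<^sup>+y. e2ennreal (- log_kernel x y) \<partial>\<mu>) \<partial>\<mu>)"

definition prob_measures_on :: "complex set \<Rightarrow> complex measure set" where
  "prob_measures_on A = {\<mu>. sets \<mu> = sets borel \<and> prob_space \<mu> \<and> emeasure \<mu> A = 1}"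

definition equilibrium_measure :: "complex set \<Rightarrow> complex measure" where
  "equilibrium_measure A =
     (THE \<mu>. \<mu> \<in> prob_measures_on A \<and> (\<forall>\<nu>\<in>prob_measures_on A. log_energy \<mu> \<le> log_energy \<nu>))"

definition weakly_converges :: "(nat \<Rightarrow> complex measure) \<Rightarrow> complex measure \<Rightarrow> bool" where
  "weakly_converges \<mu>s \<mu> \<longleftrightarrow>
     (\<forall>f :: complex \<Rightarrow> real. continuous_on UNIV f \<longrightarrow> bounded (range f) \<longrightarrow>
        (\<lambda>n. \<integral>z. f z \<partial>\<mu>s n) \<longlonglongrightarrow> (\<integral>z. f z \<partial>\<mu>))"

text \<open>The measure \<open>(1/#T) \<Sum>\<^bsub>z\<in>T\<^esub> \<delta>\<^sub>z\<close>, as a Borel measure on the plane.\<close>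

definition empirical_measure :: "complex set \<Rightarrow> complex measure" where
  "empirical_measure T = distr (uniform_count_measure T) borel (\<lambda>z. z)"

definition equidistributed :: "(nat \<Rightarrow> complex set) \<Rightarrow> complex measure \<Rightarrow> bool" where
  "equidistributed T \<mu> \<longleftrightarrow> weakly_converges (\<lambda>n. empirical_measure (T n)) \<mu>"

end

(* By the product formula, the discriminant of a finite Galois-stable set S satisfies
   sum_v log delta_v(S) = 0. At a prime p the ultrametric inequality bounds log delta_p(S) by the
   average of lambda_p. At infinity, Lagrange interpolation against monic products of the psi_n,
   which are of size exp(d * lambda_inf) up to a factor d + 1 in every degree d, bounds
   log delta_inf(S) by the average of lambda_inf plus O(log #S / #S). All upper bounds tend to 0,
   hence so does every log delta_v; #S tends to infinity by Northcott's argument. The lower bound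
   c(M) >= 1 is the product formula for the roots of psi_n.
   For equidistribution, stereographic projection turns the logarithmic kernel into a series of
   positive definite kernels with finitely many continuous features each. So the energy is
   lower semicontinuous and strictly convex, weak limits of the S_n have minimal energy, and the
   minimizer is unique. *)

theory Submission
  imports Defs "HOL-Real_Asymp.Real_Asymp"
begin

text \<open>Estimates only ever give upper bounds on discriminants; every lower bound comes from the
  local terms summing to zero. So the archimedean bound has to hold for finite sets anywhere in the
  plane and of any size, not just a power of 2; hence a small monic polynomial in every degree,
  built along the binary digits of the degree. The division by 2 in \<open>lambda_inf\<close> makes
  its defining sequence increase once the orbit has escaped, so that the limit dominates each term.
  For measures, -log|x - y| changes sign and is unbounded below on the plane, and points of the sets
  may run off to infinity. Adding the weights log(1 + |z|^2) makes the kernel nonnegative, and the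
  far points are paid for by their own \<open>lambda_inf\<close>. As the capacity of the Mandelbrot
  set is 1, the least energy is 0, so only the sign of an energy has to be known. Two standard facts
  are derived on the way: numbers fixed by all automorphisms are rational (homomorphisms are
  extended with Zorn's lemma), and the p-adic absolute values are ultrametric
  (\<open>is_absolute_value\<close> only demands the triangle inequality).\<close>

hide_const (open) UnivPoly.up_ring.coeff UnivPoly.up_ring.monom Polynomials.degree
  Polynomials.lead_coeff Module.module.smult

section \<open>The fixed field of the automorphisms of the algebraic numbers\<close>

text \<open>The type copies the carrier of a closure built as a record ring, where every element is
  a root of a coefficient list over the image of \<open>indexed_const\<close>. What remains is
  translation: such lists have the leading coefficient first, hence the \<open>rev\<close>.\<close>

lemma alg_closure_algebraic:
  fixes x :: "'a :: field alg_closure"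
  shows "\<exists>p. p \<noteq> 0 \<and> poly (map_poly to_ac p) x = 0"
proof -
  define K where "K \<equiv> (ring_of_type_algebra :: 'a ring)"
  define L where "L \<equiv> field.alg_closure K"
  interpret K: field K
    unfolding K_def by rule
  interpret algebraic_closure L "range K.indexed_const"
  proof -
    have *: "carrier K = UNIV"
      by (auto simp: K_def ring_of_type_algebra_def)
    show "algebraic_closure L (range K.indexed_const)"
      unfolding * [symmetric] L_def by (rule K.alg_closureE)
  qed
  have rep: "Rep_alg_closure y \<in> carrier L" for y :: "'a alg_closure"
    using Rep_alg_closure[of y] by (simp only: L_def K_def)
  have alg: "(algebraic over (range K.indexed_const)) (Rep_alg_closure x)"
    by (rule algebraic_extension[OF rep])
  have sr: "subring (range K.indexed_const) L"
    using subfield_axioms subfieldE(1) by blast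
  obtain p where p: "p \<in> carrier (univ_poly L (range K.indexed_const))" "p \<noteq> []"
      "eval p (Rep_alg_closure x) = \<zero>\<^bsub>L\<^esub>"
    using algebraicE[OF sr rep alg] by metis
  have "set p \<subseteq> range K.indexed_const" and hd: "hd p \<noteq> \<zero>\<^bsub>L\<^esub>"
    using p(1,2) by (auto simp: univ_poly_def polynomial_def)
  then have "\<forall>a\<in>set p. K.indexed_const (inv_into UNIV K.indexed_const a) = a"
    by (auto intro: f_inv_into_f)
  then have "p = map K.indexed_const (map (inv_into UNIV K.indexed_const) p)"
    by (simp add: map_idI)
  then obtain xs where xs: "p = map K.indexed_const xs" ..
  have to_ac: "Rep_alg_closure (to_ac a) = K.indexed_const a" for a :: 'a
    by (simp add: to_ac.rep_eq K_def)
  have rep0: "Rep_alg_closure (0 :: 'a alg_closure) = \<zero>\<^bsub>L\<^esub>"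
    by (simp add: zero_alg_closure.rep_eq L_def K_def)
  have "Rep_alg_closure (poly (Poly (rev (map to_ac xs))) x) = eval (map K.indexed_const xs) (Rep_alg_closure x)"
  proof (induction xs)
    case Nil
    then show ?case by (simp add: rep0)
  next
    case (Cons a xs)
    have pow: "Rep_alg_closure (x ^ n) = Rep_alg_closure x [^]\<^bsub>L\<^esub> n" for n
      by (induction n)
         (auto simp: one_alg_closure.rep_eq times_alg_closure.rep_eq m_comm rep
            simp flip: L_def K_def)
    have "Rep_alg_closure (poly (Poly (rev (map to_ac (a # xs)))) x) =
        Rep_alg_closure (poly (Poly (rev (map to_ac xs))) x)
        \<oplus>\<^bsub>L\<^esub> Rep_alg_closure (to_ac a) \<otimes>\<^bsub>L\<^esub> Rep_alg_closure x [^]\<^bsub>L\<^esub> length xs"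
      by (simp add: Poly_append poly_monom plus_alg_closure.rep_eq times_alg_closure.rep_eq pow
            flip: L_def K_def)
    also have "\<dots> = Rep_alg_closure (to_ac a) \<otimes>\<^bsub>L\<^esub> Rep_alg_closure x [^]\<^bsub>L\<^esub> length xs
        \<oplus>\<^bsub>L\<^esub> Rep_alg_closure (poly (Poly (rev (map to_ac xs))) x)"
      by (rule a_comm) (simp_all add: rep)
    also have "\<dots> = eval (map K.indexed_const (a # xs)) (Rep_alg_closure x)"
      by (simp add: Cons to_ac)
    finally show ?case .
  qed
  also have "\<dots> = Rep_alg_closure 0"
    using p(3) xs by (simp add: rep0)
  finally have z: "poly (Poly (rev (map to_ac xs))) x = 0"
    by (simp add: Rep_alg_closure_inject)
  have eq: "Poly (rev (map to_ac xs)) = map_poly to_ac (Poly (rev xs))"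
    by (simp add: poly_eq_iff coeff_map_poly nth_default_def coeff_Poly_eq rev_map[symmetric] rev_nth)
  have "Poly (rev xs) \<noteq> 0"
  proof
    assume "Poly (rev xs) = 0"
    then have "poly.coeff (Poly (rev xs)) (length xs - 1) = 0" by simp
    moreover have ne: "xs \<noteq> []" using p(2) xs by auto
    ultimately have "hd xs = 0"
      by (simp add: coeff_Poly_eq nth_default_def rev_nth hd_conv_nth)
    with hd xs ne have "K.indexed_const 0 \<noteq> \<zero>\<^bsub>L\<^esub>" by (simp add: hd_map)
    then show False using to_ac[of 0] by (simp add: rep0)
  qed
  with z eq show ?thesis by metis
qed

lemma to_ac_eq_of_rat: "to_ac r = of_rat r"
proof (cases r)
  case (Fract a b)
  then show ?thesis by (simp add: Fract_of_int_quotient of_rat_divide)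
qed

definition ratpoly :: "'a :: field_char_0 poly \<Rightarrow> bool" where
  "ratpoly p \<longleftrightarrow> (\<forall>i. coeff p i \<in> \<rat>)"

lemma qbar_algebraic: "\<exists>p. p \<noteq> 0 \<and> ratpoly p \<and> poly p x = 0" for x :: qbar
proof -
  obtain p :: "rat poly" where p: "p \<noteq> 0" "poly (map_poly to_ac p) x = 0"
    using alg_closure_algebraic by blast
  have "map_poly to_ac p \<noteq> 0" using p(1) by (simp add: map_poly_eq_0_iff)
  moreover have "ratpoly (map_poly to_ac p :: qbar poly)"
    by (simp add: ratpoly_def coeff_map_poly to_ac_eq_of_rat)
  ultimately show ?thesis using p(2) by blast
qed

lemma ratpoly_pCons [simp]: "ratpoly (pCons c p) \<longleftrightarrow> c \<in> \<rat> \<and> ratpoly p"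
proof -
  have "(\<forall>i. coeff (pCons c p) i \<in> \<rat>) \<longleftrightarrow> c \<in> \<rat> \<and> (\<forall>i. coeff p i \<in> \<rat>)"
    by (metis coeff_pCons_0 coeff_pCons_Suc not0_implies_Suc)
  then show ?thesis by (simp add: ratpoly_def)
qed

lemma ratpoly_smult: "c \<in> \<rat> \<Longrightarrow> ratpoly p \<Longrightarrow> ratpoly (smult c p)"
  by (simp add: ratpoly_def)

text \<open>Divide out powers of the variable until the constant term \<open>c\<close> is nonzero;
  then x * p(x) = -c exhibits the inverse of x as a polynomial in x.\<close>

lemma poly_inverse:
  fixes x :: "'a :: field_char_0"
  assumes "p \<noteq> 0" "ratpoly p" "poly p x = 0" "x \<noteq> 0"
  shows "\<exists>q. ratpoly q \<and> x * poly q x = 1"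
  using assms
proof (induction p)
  case 0
  then show ?case by simp
next
  case (pCons c p)
  show ?case
  proof (cases "c = 0")
    case True
    then show ?thesis using pCons by auto
  next
    case False
    have "x * poly p x = - c" using pCons.prems by (simp add: eq_neg_iff_add_eq_0 add.commute)
    then have "x * poly (smult (- 1 / c) p) x = 1" using False by (simp add: field_simps)
    moreover have "ratpoly (smult (- 1 / c) p)"
      using pCons.prems by (intro ratpoly_smult) auto
    ultimately show ?thesis by blast
  qed
qed

text \<open>Graphs of ring homomorphisms from a subring of the field into the field. Over \<open>Qbar\<close> such a
  subring contains \<open>\<rat>\<close> and is therefore a subfield.\<close>

definition hom_graph :: "('a :: field_char_0 \<times> 'a) set \<Rightarrow> bool" where
  "hom_graph G \<longleftrightarrow> (\<forall>r. (of_rat r, of_rat r) \<in> G) \<and>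
     (\<forall>x y x' y'. (x, y) \<in> G \<longrightarrow> (x', y') \<in> G \<longrightarrow> (x + x', y + y') \<in> G \<and> (x * x', y * y') \<in> G) \<and>
     (\<forall>y. (0, y) \<in> G \<longrightarrow> y = 0)"

lemma degree_pos_if_root:
  assumes "m \<noteq> 0" "poly m a = 0"
  shows "degree m > 0"
proof (rule ccontr)
  assume "\<not> degree m > 0"
  then obtain c where "m = [:c:]" by (auto elim: degree_eq_zeroE)
  then show False using assms by simp
qed

section \<open>Extending partial homomorphisms of \<open>qbar\<close> to automorphisms\<close>

locale partial_hom =
  fixes G :: "(qbar \<times> qbar) set"
  assumes graph: "hom_graph G"
begin

lemma rat_in: "(of_rat r, of_rat r) \<in> G"
  using graph by (simp add: hom_graph_def)

lemma add_in: "(x, y) \<in> G \<Longrightarrow> (x', y') \<in> G \<Longrightarrow> (x + x', y + y') \<in> G"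
  and mult_in: "(x, y) \<in> G \<Longrightarrow> (x', y') \<in> G \<Longrightarrow> (x * x', y * y') \<in> G"
  and zero_in: "(0, y) \<in> G \<Longrightarrow> y = 0"
  using graph unfolding hom_graph_def by blast+

lemma diff_in: "(x, y) \<in> G \<Longrightarrow> (x', y') \<in> G \<Longrightarrow> (x - x', y - y') \<in> G"
  using add_in[of x y "- x'" "- y'"] mult_in[OF rat_in[of "-1"], of x' y'] by simp

lemma functional: "(x, y) \<in> G \<Longrightarrow> (x, y') \<in> G \<Longrightarrow> y = y'"
  using diff_in[of x y x y'] zero_in[of "y - y'"] by simp

definition hom :: "qbar \<Rightarrow> qbar" where
  "hom x = (THE y. (x, y) \<in> G)"

lemma homI: "(x, y) \<in> G \<Longrightarrow> hom x = y"
  unfolding hom_def using functional by blast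

lemma hom_in: "x \<in> Domain G \<Longrightarrow> (x, hom x) \<in> G"
  using homI by auto

lemma hom_rat [simp]: "hom (of_rat r) = of_rat r"
  by (rule homI[OF rat_in])

lemma hom_0 [simp]: "hom 0 = 0" and hom_1 [simp]: "hom 1 = 1"
  using hom_rat[of 0] hom_rat[of 1] by simp_all

lemma Domain_rat [simp]: "of_rat r \<in> Domain G"
  using rat_in by blast

lemma Domain_0 [simp]: "0 \<in> Domain G" and Domain_1 [simp]: "1 \<in> Domain G"
  using Domain_rat[of 0] Domain_rat[of 1] by simp_all

lemma Domain_add: "x \<in> Domain G \<Longrightarrow> y \<in> Domain G \<Longrightarrow> x + y \<in> Domain G"
  and Domain_diff: "x \<in> Domain G \<Longrightarrow> y \<in> Domain G \<Longrightarrow> x - y \<in> Domain G"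
  and Domain_mult: "x \<in> Domain G \<Longrightarrow> y \<in> Domain G \<Longrightarrow> x * y \<in> Domain G"
  using add_in diff_in mult_in by blast+

lemma hom_add: "x \<in> Domain G \<Longrightarrow> y \<in> Domain G \<Longrightarrow> hom (x + y) = hom x + hom y"
  and hom_mult: "x \<in> Domain G \<Longrightarrow> y \<in> Domain G \<Longrightarrow> hom (x * y) = hom x * hom y"
  by (meson homI hom_in add_in mult_in)+

lemma Domain_sum: "(\<And>i. i \<in> A \<Longrightarrow> g i \<in> Domain G) \<Longrightarrow> (\<Sum>i\<in>A. g i) \<in> Domain G"
  by (induction A rule: infinite_finite_induct) (auto intro!: Domain_add)

lemma hom_sum: "(\<And>i. i \<in> A \<Longrightarrow> g i \<in> Domain G) \<Longrightarrow> hom (\<Sum>i\<in>A. g i) = (\<Sum>i\<in>A. hom (g i))"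
proof (induction A rule: infinite_finite_induct)
  case (insert x F)
  have "hom (g x + sum g F) = hom (g x) + hom (sum g F)"
    by (rule hom_add) (use insert in \<open>auto intro!: Domain_sum\<close>)
  then show ?case using insert by simp
qed auto

lemma ratpoly_in:
  assumes "ratpoly p" "(x, y) \<in> G"
  shows "(poly p x, poly p y) \<in> G"
  using assms(1)
proof (induction p)
  case 0
  then show ?case using rat_in[of 0] by simp
next
  case (pCons c p)
  then obtain r where "c = of_rat r" by (auto elim: Rats_cases)
  then show ?case using pCons assms(2) by (auto intro!: add_in mult_in rat_in)
qed

text \<open>By algebraicity the inverse is a rational polynomial in \<open>x\<close>, so closure
  under addition and multiplication is enough.\<close>

lemma Domain_inverse: "x \<in> Domain G \<Longrightarrow> inverse x \<in> Domain G"
proof (cases "x = 0")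
  case False
  assume x: "x \<in> Domain G"
  obtain q where q: "ratpoly q" "x * poly q x = 1"
    using qbar_algebraic[of x] poly_inverse False by blast
  then have "inverse x = poly q x" by (simp add: inverse_unique)
  then show ?thesis using ratpoly_in[OF q(1) hom_in[OF x]] by auto
qed simp

lemma hom_eq_0: "x \<in> Domain G \<Longrightarrow> hom x = 0 \<Longrightarrow> x = 0"
  using hom_mult[of x "inverse x"] Domain_inverse[of x] by (cases "x = 0") auto

definition Dpoly :: "qbar poly \<Rightarrow> bool" where
  "Dpoly p \<longleftrightarrow> (\<forall>i. coeff p i \<in> Domain G)"

definition hpoly :: "qbar poly \<Rightarrow> qbar poly" where
  "hpoly p = map_poly hom p"

lemma coeff_hpoly: "coeff (hpoly p) i = hom (coeff p i)"
  by (simp add: hpoly_def coeff_map_poly)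

lemma Dpoly_add: "Dpoly p \<Longrightarrow> Dpoly q \<Longrightarrow> Dpoly (p + q)"
  and Dpoly_diff: "Dpoly p \<Longrightarrow> Dpoly q \<Longrightarrow> Dpoly (p - q)"
  and Dpoly_mult: "Dpoly p \<Longrightarrow> Dpoly q \<Longrightarrow> Dpoly (p * q)"
  by (auto simp: Dpoly_def coeff_mult intro!: Domain_add Domain_diff Domain_sum Domain_mult)

lemma hpoly_add: "Dpoly p \<Longrightarrow> Dpoly q \<Longrightarrow> hpoly (p + q) = hpoly p + hpoly q"
  by (auto simp: poly_eq_iff coeff_hpoly hom_add Dpoly_def)

lemma hpoly_mult: "Dpoly p \<Longrightarrow> Dpoly q \<Longrightarrow> hpoly (p * q) = hpoly p * hpoly q"
  by (subst poly_eq_iff)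
     (auto simp: coeff_hpoly coeff_mult Dpoly_def hom_sum hom_mult Domain_mult)

lemma Dpoly_const: "c \<in> Domain G \<Longrightarrow> Dpoly [:c:]"
  by (auto simp: Dpoly_def coeff_pCons split: nat.splits)

lemma hpoly_const: "hpoly [:c:] = [:hom c:]"
  by (auto simp: poly_eq_iff coeff_hpoly coeff_pCons split: nat.splits)

text \<open>This makes the assignment of h(p)(d) to p(c) well defined: the minimal polynomial
  \<open>m\<close> of \<open>c\<close> divides \<open>p\<close> over the domain, so
  \<open>hpoly m\<close> divides \<open>hpoly p\<close>. The division is carried out one leading
  term at a time, by induction on the degree.\<close>

lemma hpoly_root:
  assumes m: "m \<noteq> 0" "Dpoly m" "poly m c = 0"
    and min: "\<And>q. q \<noteq> 0 \<Longrightarrow> Dpoly q \<Longrightarrow> poly q c = 0 \<Longrightarrow> degree m \<le> degree q"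
    and d: "poly (hpoly m) d = 0"
    and p: "Dpoly p" "poly p c = 0"
  shows "poly (hpoly p) d = 0"
  using p
proof (induction "degree p" arbitrary: p rule: less_induct)
  case less
  show ?case
  proof (cases "p = 0")
    case True
    then show ?thesis by (simp add: hpoly_def)
  next
    case False
    then have deg: "degree m \<le> degree p" using min less.prems by blast
    define q where "q = monom (lead_coeff p / lead_coeff m) (degree p - degree m)"
    define p' where "p' = p - q * m"
    have q: "Dpoly q"
      using less.prems(1) m(2)
      by (auto simp: Dpoly_def q_def divide_inverse intro!: Domain_mult Domain_inverse)
    have p': "Dpoly p'" unfolding p'_def by (intro Dpoly_diff Dpoly_mult less.prems(1) q m(2))
    have root: "poly p' c = 0" using less.prems(2) m(3) by (simp add: p'_def)
    have van: "coeff p' k = 0" if "degree p \<le> k" for k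
    proof (cases "k = degree p")
      case True
      then show ?thesis using deg m(1) by (simp add: p'_def q_def coeff_monom_mult)
    next
      case False
      then have k: "degree p < k" using that by simp
      then have "degree m < k - (degree p - degree m)" using deg by linarith
      then show ?thesis using k by (simp add: p'_def q_def coeff_monom_mult coeff_eq_0)
    qed
    have "poly (hpoly p') d = 0"
    proof (cases "degree p' < degree p")
      case True
      then show ?thesis using less.hyps p' root by blast
    next
      case False
      then have "p' = 0" using van[of "degree p'"] by (metis leading_coeff_0_iff not_le)
      then show ?thesis by (simp add: hpoly_def)
    qed
    moreover have "hpoly p = hpoly p' + hpoly q * hpoly m"
      using hpoly_add[OF p' Dpoly_mult[OF q m(2)]] hpoly_mult[OF q m(2)] by (simp add: p'_def)
    ultimately show ?thesis using d by simp
  qed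
qed

text \<open>A simple extension: \<open>c\<close> may be sent to any root \<open>d\<close> of the
  conjugated minimal polynomial. The new graph consists of the values at \<open>c\<close> and
  \<open>d\<close> of corresponding polynomials, and \<open>hpoly_root\<close> says that its kernel
  is trivial.\<close>

lemma extend:
  assumes m: "m \<noteq> 0" "Dpoly m" "poly m c = 0"
    and min: "\<And>q. q \<noteq> 0 \<Longrightarrow> Dpoly q \<Longrightarrow> poly q c = 0 \<Longrightarrow> degree m \<le> degree q"
    and d: "poly (hpoly m) d = 0"
  shows "\<exists>G'. hom_graph G' \<and> G \<subseteq> G' \<and> (c, d) \<in> G'"
proof (intro exI conjI)
  let ?G = "{(poly p c, poly (hpoly p) d) | p. Dpoly p}"
  show sub: "G \<subseteq> ?G"
  proof clarify
    fix x y assume xy: "(x, y) \<in> G"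
    then have "x \<in> Domain G" "hom x = y" using homI by auto
    then have "x = poly [:x:] c" "y = poly (hpoly [:x:]) d" "Dpoly [:x:]"
      using Dpoly_const by (simp_all add: hpoly_const)
    then show "\<exists>p. (x, y) = (poly p c, poly (hpoly p) d) \<and> Dpoly p" by blast
  qed
  have X: "Dpoly [:0, 1:]" "hpoly [:0, 1:] = [:0, 1:]"
    by (auto simp: Dpoly_def poly_eq_iff coeff_hpoly coeff_pCons split: nat.splits)
  then have "c = poly [:0, 1:] c" "d = poly (hpoly [:0, 1:]) d" by simp_all
  with X show "(c, d) \<in> ?G" by blast
  show "hom_graph ?G"
    unfolding hom_graph_def
  proof (intro conjI allI impI)
    show "(of_rat r, of_rat r) \<in> ?G" for r using sub rat_in by blast
    fix x y x' y' assume "(x, y) \<in> ?G" "(x', y') \<in> ?G"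
    then obtain p q where *: "Dpoly p" "Dpoly q" "x = poly p c" "y = poly (hpoly p) d"
      "x' = poly q c" "y' = poly (hpoly q) d" by blast
    then have "x + x' = poly (p + q) c" "y + y' = poly (hpoly (p + q)) d"
      "x * x' = poly (p * q) c" "y * y' = poly (hpoly (p * q)) d"
      by (simp_all add: hpoly_add hpoly_mult)
    moreover have "Dpoly (p + q)" "Dpoly (p * q)" using * Dpoly_add Dpoly_mult by auto
    ultimately show "(x + x', y + y') \<in> ?G" "(x * x', y * y') \<in> ?G" by blast+
  next
    fix y assume "(0, y) \<in> ?G"
    then obtain p where "Dpoly p" "poly p c = 0" "y = poly (hpoly p) d" by auto
    then show "y = 0" using hpoly_root[OF m min d] by blast
  qed
qed

lemma minimal_Dpoly:
  obtains m where "m \<noteq> 0" "Dpoly m" "poly m c = 0"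
    "\<And>q. q \<noteq> 0 \<Longrightarrow> Dpoly q \<Longrightarrow> poly q c = 0 \<Longrightarrow> degree m \<le> degree q"
proof -
  obtain p where "p \<noteq> 0" "ratpoly p" "poly p c = 0" using qbar_algebraic by blast
  then have "p \<noteq> 0 \<and> Dpoly p \<and> poly p c = 0"
    unfolding Dpoly_def ratpoly_def by (metis Domain_rat Rats_cases)
  then obtain m where m: "m \<noteq> 0 \<and> Dpoly m \<and> poly m c = 0"
    "\<forall>q. q \<noteq> 0 \<and> Dpoly q \<and> poly q c = 0 \<longrightarrow> degree m \<le> degree q"
    using ex_has_least_nat[of "\<lambda>p. p \<noteq> 0 \<and> Dpoly p \<and> poly p c = 0" p degree] by blast
  then show ?thesis using that by blast
qed

lemma hpoly_has_root:
  assumes "m \<noteq> 0" "Dpoly m" "poly m c = 0"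
  shows "\<exists>d. poly (hpoly m) d = 0"
proof (rule alg_closed_imp_poly_has_root)
  have "degree m > 0" using assms(1,3) by (rule degree_pos_if_root)
  moreover have "coeff (hpoly m) (degree m) \<noteq> 0"
    using assms(1,2) hom_eq_0[of "lead_coeff m"] by (auto simp: coeff_hpoly Dpoly_def)
  ultimately show "0 < degree (hpoly m)" using le_degree by fastforce
qed

text \<open>Graphs ordered by inclusion have plain unions as upper bounds of chains, so Zorn's lemma
  gives a maximal one. It is defined everywhere, since a missing \<open>c\<close> could be adjoined:
  the conjugated minimal polynomial has a root because the field is algebraically closed.\<close>

lemma extends_to_automorphism:
  "\<exists>\<sigma>. \<sigma> \<in> ring_iso Qbar Qbar \<and> (\<forall>x y. (x, y) \<in> G \<longrightarrow> \<sigma> x = y)"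
proof -
  define A where "A = {G'. hom_graph G' \<and> G \<subseteq> G'}"
  have "\<exists>M\<in>A. \<forall>N\<in>A. M \<subseteq> N \<longrightarrow> N = M"
  proof (rule subset_Zorn_nonempty)
    show "A \<noteq> {}" using graph by (auto simp: A_def)
    fix \<C> assume ne: "\<C> \<noteq> {}" and chain: "subset.chain A \<C>"
    have sub: "\<C> \<subseteq> A" using chain by (simp add: subset.chain_def)
    have common: "\<exists>H\<in>\<C>. u \<in> H \<and> v \<in> H" if "u \<in> \<Union>\<C>" "v \<in> \<Union>\<C>" for u v
    proof -
      from that obtain H1 H2 where "H1 \<in> \<C>" "u \<in> H1" "H2 \<in> \<C>" "v \<in> H2" by blast
      moreover have "H1 \<subseteq> H2 \<or> H2 \<subseteq> H1" using chain calculation by (simp add: subset_chain_def)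
      ultimately show ?thesis by blast
    qed
    have "hom_graph (\<Union>\<C>)"
      unfolding hom_graph_def
    proof (intro conjI allI impI)
      show "(of_rat r, of_rat r) \<in> \<Union>\<C>" for r
        using ne sub by (fastforce simp: hom_graph_def A_def)
      show "y = 0" if "(0, y) \<in> \<Union>\<C>" for y
        using that sub by (fastforce simp: hom_graph_def A_def)
      fix x y x' y' assume "(x, y) \<in> \<Union>\<C>" "(x', y') \<in> \<Union>\<C>"
      then obtain H where H: "H \<in> \<C>" "(x, y) \<in> H" "(x', y') \<in> H" using common by blast
      then have "hom_graph H" using sub by (auto simp: A_def)
      with H have "(x + x', y + y') \<in> H" "(x * x', y * y') \<in> H"
        unfolding hom_graph_def by blast+
      with H show "(x + x', y + y') \<in> \<Union>\<C>" "(x * x', y * y') \<in> \<Union>\<C>" by blast+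
    qed
    then show "\<Union>\<C> \<in> A" using ne sub by (auto simp: A_def)
  qed
  then obtain M where M: "hom_graph M" "G \<subseteq> M"
    and max: "\<And>N. hom_graph N \<Longrightarrow> G \<subseteq> N \<Longrightarrow> M \<subseteq> N \<Longrightarrow> N = M"
    by (auto simp: A_def)
  interpret M: partial_hom M by unfold_locales (rule M(1))
  have dom: "c \<in> Domain M" for c
  proof -
    obtain m where m: "m \<noteq> 0" "M.Dpoly m" "poly m c = 0"
      "\<And>q. q \<noteq> 0 \<Longrightarrow> M.Dpoly q \<Longrightarrow> poly q c = 0 \<Longrightarrow> degree m \<le> degree q"
      using M.minimal_Dpoly by blast
    obtain d where "poly (M.hpoly m) d = 0" using M.hpoly_has_root[OF m(1-3)] by blast
    then obtain G' where "hom_graph G'" "M \<subseteq> G'" "(c, d) \<in> G'" using M.extend[OF m] by blast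
    then show ?thesis using max[of G'] M(2) by blast
  qed
  have add: "M.hom (x + y) = M.hom x + M.hom y" and mult: "M.hom (x * y) = M.hom x * M.hom y" for x y
    using M.hom_add M.hom_mult dom by blast+
  have inj: "inj M.hom"
  proof (rule injI)
    fix x y assume "M.hom x = M.hom y"
    moreover have "M.hom x = M.hom (x - y) + M.hom y" using add[of "x - y" y] by simp
    ultimately have "M.hom (x - y) = 0" by simp
    then show "x = y" using M.hom_eq_0[OF dom] by fastforce
  qed
  \<comment> \<open>Surjectivity: the map permutes the finitely many roots of any nonzero rational
    polynomial that vanishes at \<open>y\<close>.\<close>
  have "y \<in> range M.hom" for y
  proof -
    obtain p where p: "p \<noteq> 0" "ratpoly p" "poly p y = 0" using qbar_algebraic by blast
    have "poly p (M.hom x) = 0" if "poly p x = 0" for x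
      using M.ratpoly_in[OF p(2) M.hom_in[OF dom], of x] that M.zero_in by simp
    then have "M.hom ` {x. poly p x = 0} \<subseteq> {x. poly p x = 0}" by blast
    then have "M.hom ` {x. poly p x = 0} = {x. poly p x = 0}"
      using poly_roots_finite[OF p(1)] inj by (meson endo_inj_surj inj_on_subset subset_UNIV)
    then show ?thesis using p(3) by blast
  qed
  then have "M.hom \<in> ring_iso Qbar Qbar"
    using add mult inj
    by (auto simp: ring_iso_def ring_hom_def ring_of_type_algebra_def bij_betw_def)
  moreover have "M.hom x = y" if "(x, y) \<in> G" for x y using that M(2) M.homI by blast
  ultimately show ?thesis by blast
qed

end

text \<open>If the minimal polynomial over the rationals were not linear, it would have a root b
  different from \<open>a\<close>, and the homomorphism sending \<open>a\<close> to b would extend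
  to an automorphism that moves \<open>a\<close>.\<close>

lemma Rats_if_fixed:
  fixes a :: qbar
  assumes fixed: "\<And>\<sigma>. \<sigma> \<in> ring_iso Qbar Qbar \<Longrightarrow> \<sigma> a = a"
  shows "a \<in> \<rat>"
proof -
  let ?G = "range (\<lambda>r. (of_rat r, of_rat r)) :: (qbar \<times> qbar) set"
  have "hom_graph ?G"
    by (auto simp: hom_graph_def simp flip: of_rat_add of_rat_mult)
  then interpret Q: partial_hom ?G by unfold_locales
  have D: "Domain ?G = \<rat>" by (auto simp: Rats_def)
  have hom: "Q.hom x = x" if "x \<in> \<rat>" for x using that by (auto elim: Rats_cases)
  obtain m where m: "m \<noteq> 0" "Q.Dpoly m" "poly m a = 0"
    and min: "\<And>q. q \<noteq> 0 \<Longrightarrow> Q.Dpoly q \<Longrightarrow> poly q a = 0 \<Longrightarrow> degree m \<le> degree q"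
    using Q.minimal_Dpoly by blast
  have hm: "Q.hpoly m = m"
    using m(2) by (auto simp: poly_eq_iff Q.coeff_hpoly Q.Dpoly_def D hom)
  have deg: "degree m > 0"
    using m(1,3) by (rule degree_pos_if_root)
  \<comment> \<open>In characteristic 0 the derivative is nonzero and of smaller degree. By
    minimality it does not vanish at \<open>a\<close>, so \<open>a\<close> is a simple root and is
    not a root of the cofactor \<open>q\<close>.\<close>
  have "Q.Dpoly (pderiv m)"
    using m(2) unfolding Q.Dpoly_def D coeff_pderiv by (auto intro!: Rats_mult)
  moreover have "pderiv m \<noteq> 0" using deg by (auto simp: pderiv_eq_0_iff)
  moreover have "degree (pderiv m) < degree m" using deg by (simp add: degree_pderiv)
  ultimately have der: "poly (pderiv m) a \<noteq> 0" using min[of "pderiv m"] by auto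
  obtain q where q: "m = [:- a, 1:] * q" using m(3) by (metis dvdE poly_eq_0_iff_dvd)
  have qa: "poly q a \<noteq> 0" using der unfolding q pderiv_mult by (simp add: pderiv_pCons)
  have "degree q = 0"
  proof (rule ccontr)
    assume "degree q \<noteq> 0"
    then obtain b where b: "poly q b = 0" using alg_closed_imp_poly_has_root by blast
    then have "poly (Q.hpoly m) b = 0" unfolding hm by (simp add: q)
    then obtain G' where G': "hom_graph G'" "(a, b) \<in> G'"
      using Q.extend[OF m min] by blast
    interpret G': partial_hom G' by unfold_locales (rule G'(1))
    obtain \<sigma> where "\<sigma> \<in> ring_iso Qbar Qbar" "\<sigma> a = b"
      using G'.extends_to_automorphism G'(2) by blast
    then have "a = b" using fixed[of \<sigma>] by simp
    then show False using b qa by simp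
  qed
  then obtain c where c: "q = [:c:]" by (auto elim: degree_eq_zeroE)
  then have "c \<noteq> 0" using m(1) q by auto
  have "m = [:- a * c, c:]" using q c by simp
  then have "coeff m 0 = - a * c" "coeff m 1 = c" by simp_all
  then have "- a * c \<in> \<rat>" "c \<in> \<rat>" using m(2) unfolding Q.Dpoly_def D by metis+
  then have "- (- a * c / c) \<in> \<rat>" by (intro Rats_minus_iff[THEN iffD2] Rats_divide)
  then show ?thesis using \<open>c \<noteq> 0\<close> by simp
qed

section \<open>Green function and transfinite diameter of the Mandelbrot set\<close>

lemma prod_powr_distrib:
  fixes f :: "'a \<Rightarrow> real"
  assumes "\<And>x. x \<in> A \<Longrightarrow> 0 \<le> f x"
  shows "(\<Prod>x\<in>A. f x powr a) = (\<Prod>x\<in>A. f x) powr a"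
  using assms
proof (induction A rule: infinite_finite_induct)
  case (insert x F)
  then show ?case by (simp add: powr_mult prod_nonneg)
qed auto

text \<open>When \<open>d\<close> is the absolute value of the difference, this is the absolute
  value of the discriminant of the monic polynomial with simple roots \<open>T\<close>: every pair
  counts in both orders.\<close>

definition disc :: "('a \<Rightarrow> 'a \<Rightarrow> real) \<Rightarrow> 'a set \<Rightarrow> real" where
  "disc d T = (\<Prod>x\<in>T. \<Prod>y\<in>T - {x}. d x y)"

lemma disc_offdiag:
  assumes "finite T"
  shows "disc d T = (\<Prod>(x, y) \<in> {(x, y). x \<in> T \<and> y \<in> T \<and> x \<noteq> y}. d x y)"
proof -
  have "{(x, y). x \<in> T \<and> y \<in> T \<and> x \<noteq> y} = (SIGMA x:T. T - {x})" by auto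
  then show ?thesis using assms by (simp add: disc_def prod.Sigma)
qed

lemma finite_diameter_eq_disc:
  assumes "finite T" "\<And>x y. x \<in> T \<Longrightarrow> y \<in> T \<Longrightarrow> 0 \<le> d x y"
  shows "finite_diameter d T = disc d T powr (1 / (real (card T) * (real (card T) - 1)))"
  unfolding finite_diameter_def disc_offdiag[OF assms(1)] case_prod_unfold
  by (rule prod_powr_distrib) (use assms(2) in auto)

lemma disc_remove:
  assumes "finite T" "x \<in> T" "\<And>y. y \<in> T \<Longrightarrow> d y x = d x y"
  shows "disc d T = disc d (T - {x}) * (\<Prod>y\<in>T - {x}. d x y)\<^sup>2"
proof -
  let ?F = "T - {x}"
  have "disc d T = (\<Prod>y\<in>T - {x}. d x y) * (\<Prod>z\<in>?F. \<Prod>y\<in>T - {z}. d z y)"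
    unfolding disc_def using assms by (subst prod.remove[of _ x]) auto
  also have "(\<Prod>z\<in>?F. \<Prod>y\<in>T - {z}. d z y) = (\<Prod>z\<in>?F. d z x * (\<Prod>y\<in>?F - {z}. d z y))"
  proof (rule prod.cong[OF refl])
    fix z assume "z \<in> ?F"
    then have "T - {z} - {x} = ?F - {z}" "x \<in> T - {z}" using assms(2) by auto
    then show "(\<Prod>y\<in>T - {z}. d z y) = d z x * (\<Prod>y\<in>?F - {z}. d z y)"
      using assms(1) by (subst prod.remove[of _ x]) auto
  qed
  also have "\<dots> = (\<Prod>z\<in>?F. d x z) * disc d ?F"
    unfolding disc_def prod.distrib using prod.cong[OF refl, of ?F "\<lambda>z. d z x" "d x"] assms(3) by simp
  finally show ?thesis by (simp add: power2_eq_square)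
qed

text \<open>Drop the point whose product of distances \<open>D x\<close> to the others is least, and
  repeat. This is the finite form of the monotonicity of Fekete's diameters.\<close>

lemma disc_subset_ge_1:
  assumes "finite T" "disc d T \<ge> 1" "2 \<le> n" "n \<le> card T"
    and d: "\<And>x y. d x y = d y x" "\<And>x y. 0 \<le> d x y"
  shows "\<exists>T'\<subseteq>T. card T' = n \<and> disc d T' \<ge> 1"
  using assms(1,2,4)
proof (induction "card T - n" arbitrary: T)
  case 0
  then show ?case by auto
next
  case (Suc k)
  define D where "D x = (\<Prod>y\<in>T - {x}. d x y)" for x
  have card: "card T > n" using Suc.hyps by simp
  then have ne: "T \<noteq> {}" by auto
  have D0: "0 \<le> D x" for x by (simp add: D_def prod_nonneg d)
  obtain x where x: "x \<in> T" "\<And>y. y \<in> T \<Longrightarrow> D x \<le> D y"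
    using ex_is_arg_min_if_finite[OF Suc.prems(1) ne, of D] by (auto simp: is_arg_min_linorder)
  have step: "disc d T = disc d (T - {x}) * (D x)\<^sup>2"
    unfolding D_def by (rule disc_remove) (use Suc.prems x d in auto)
  \<comment> \<open>Removal divides \<open>disc\<close> by the square of \<open>D x\<close>, so that
    square must not exceed \<open>disc\<close>. If \<open>D x\<close> is at most 1 this follows from
    \<open>disc\<close> being at least 1; otherwise \<open>disc\<close> is a product of more than
    two factors, each at least \<open>D x\<close>.\<close>
  have "(D x)\<^sup>2 \<le> disc d T"
  proof (cases "D x \<le> 1")
    case True
    then have "(D x)\<^sup>2 \<le> 1" using D0 by (simp add: power_le_one)
    then show ?thesis using Suc.prems by simp
  next
    case False
    have "(D x)\<^sup>2 \<le> D x ^ card T" using False card assms(3) by (intro power_increasing) auto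
    also have "\<dots> = (\<Prod>y\<in>T. D x)" by simp
    also have "\<dots> \<le> (\<Prod>y\<in>T. D y)" by (intro prod_mono) (use D0 x in auto)
    finally show ?thesis by (simp add: disc_def D_def)
  qed
  moreover have "0 < (D x)\<^sup>2"
    using Suc.prems(2) step by (cases "D x = 0") auto
  ultimately have "1 \<le> disc d (T - {x})"
    using step by (metis mult_le_cancel_right1 not_less)
  moreover have "k = card (T - {x}) - n" "n \<le> card (T - {x})" "finite (T - {x})"
    using Suc.hyps(2) Suc.prems(1) x card by auto
  ultimately obtain T' where "T' \<subseteq> T - {x}" "card T' = n \<and> disc d T' \<ge> 1"
    using Suc.hyps(1) by metis
  then show ?case by blast
qed

text \<open>A sandwich criterion shared by the complex and the p-adic Mandelbrot sets. The upper
  bound may depend on the number of points, provided it tends to 1.\<close>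

lemma transfinite_diameter_eq_1:
  fixes d :: "'a \<Rightarrow> 'a \<Rightarrow> real"
  assumes d: "\<And>x y. x \<in> A \<Longrightarrow> y \<in> A \<Longrightarrow> 0 \<le> d x y" "\<And>x. x \<in> A \<Longrightarrow> d x x = 0"
    and lower: "\<And>n. 2 \<le> n \<Longrightarrow> \<exists>T\<subseteq>A. finite T \<and> card T = n \<and> 1 \<le> finite_diameter d T"
    and upper: "\<And>T. T \<subseteq> A \<Longrightarrow> finite T \<Longrightarrow> 2 \<le> card T \<Longrightarrow> finite_diameter d T \<le> u (card T)"
    and u: "u \<longlonglongrightarrow> 1"
  shows "transfinite_diameter d A = 1"
proof -
  define F where "F n x = (\<Prod>(i, j) \<in> {(i, j). i < n \<and> j < n \<and> i \<noteq> j}.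
      d (x i) (x j) powr (1 / (real n * (real n - 1))))" for n :: nat and x
  have inj: "F n x = finite_diameter d (x ` {..<n})" if "inj_on x {..<n}" for n x
  proof -
    have "{(z, y). z \<in> x ` {..<n} \<and> y \<in> x ` {..<n} \<and> z \<noteq> y}
        = (\<lambda>(i, j). (x i, x j)) ` {(i, j). i < n \<and> j < n \<and> i \<noteq> j}"
      using that by (fastforce simp: inj_on_def)
    moreover have "inj_on (\<lambda>(i, j). (x i, x j)) {(i, j). i < n \<and> j < n \<and> i \<noteq> j}"
      using that by (auto simp: inj_on_def)
    ultimately show ?thesis
      unfolding F_def finite_diameter_def by (simp add: prod.reindex card_image that case_prod_unfold)
  qed
  have fin: "finite {(i, j). i < n \<and> j < n \<and> i \<noteq> j}" for n :: nat
    by (rule finite_subset[of _ "{..<n} \<times> {..<n}"]) auto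
  have F_le: "F n x \<le> u n" if n: "2 \<le> n" and x: "x \<in> {..<n} \<rightarrow> A" for n x
  proof (cases "inj_on x {..<n}")
    case True
    then show ?thesis using upper[of "x ` {..<n}"] x n by (auto simp: inj card_image)
  next
    \<comment> \<open>A repeated point contributes a factor 0, since \<open>0 powr a\<close> is 0.
      The set provided by \<open>lower\<close> shows that \<open>u n\<close> is at least 1 and hence
      above 0.\<close>
    case False
    then obtain i j where "i < n" "j < n" "i \<noteq> j" "x i = x j" by (auto simp: inj_on_def)
    moreover have "d (x i) (x i) = 0" using d(2) x \<open>i < n\<close> by auto
    ultimately have "F n x = 0"
      unfolding F_def using fin by (intro prod_zero bexI[of _ "(i, j)"]) auto
    moreover obtain T where T: "T \<subseteq> A" "finite T" "card T = n" "1 \<le> finite_diameter d T"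
      using lower n by blast
    then have "1 \<le> u n" using upper[of T] n by simp
    ultimately show ?thesis by simp
  qed
  \<comment> \<open>The supremum is taken in the reals, where it is meaningful only for sets bounded
    above.\<close>
  have bdd: "bdd_above (F n ` ({..<n} \<rightarrow> A))" if "2 \<le> n" for n
    using F_le[OF that] by (auto intro!: bdd_aboveI[of _ "u n"])
  have le: "(SUP x \<in> {..<n} \<rightarrow> A. F n x) \<le> u n" if n: "2 \<le> n" for n
  proof (rule cSUP_least)
    obtain T where "T \<subseteq> A" "card T = n" using lower n by blast
    then have "A \<noteq> {}" using n by auto
    then show "{..<n} \<rightarrow> A \<noteq> {}" by auto
  qed (use F_le n in auto)
  have ge: "1 \<le> (SUP x \<in> {..<n} \<rightarrow> A. F n x)" if n: "2 \<le> n" for n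
  proof -
    obtain T where T: "T \<subseteq> A" "finite T" "card T = n" "1 \<le> finite_diameter d T"
      using lower n by blast
    obtain x where x: "bij_betw x {..<n} T"
      using T by (metis ex_bij_betw_nat_finite lessThan_atLeast0)
    then have "F n x = finite_diameter d T" "x \<in> {..<n} \<rightarrow> A"
      using inj[of x n] T(1) by (auto simp: bij_betw_def)
    then show ?thesis using T(4) cSUP_upper[OF _ bdd[OF n], of x] by simp
  qed
  have "(\<lambda>n. SUP x \<in> {..<n} \<rightarrow> A. F n x) \<longlonglongrightarrow> 1"
  proof (rule tendsto_sandwich[OF _ _ tendsto_const u])
    show "\<forall>\<^sub>F n in sequentially. 1 \<le> (SUP x \<in> {..<n} \<rightarrow> A. F n x)"
      using ge by (auto simp: eventually_sequentially)
    show "\<forall>\<^sub>F n in sequentially. (SUP x \<in> {..<n} \<rightarrow> A. F n x) \<le> u n"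
      using le by (auto simp: eventually_sequentially)
  qed
  then show ?thesis unfolding transfinite_diameter_def F_def by (rule limI)
qed

section \<open>The escape rate of the critical orbit\<close>

lemma psi_0 [simp]: "psi 0 c = 0" and psi_Suc: "psi (Suc n) c = (psi n c)\<^sup>2 + c"
  by (simp_all add: psi_def)

text \<open>For r = |psi_n| at least 2 and at least |c|, one has |c| <= r <= r^2/2, so the next
  iterate has absolute value between r^2/2 and 3r^2/2. Dividing by 2 turns the lower bound into
  exact squaring, which is why \<open>lambda_inf\<close> carries that normalization.\<close>

lemma escape_step:
  assumes "2 \<le> cmod (psi n c)" "cmod c \<le> cmod (psi n c)"
  shows "(cmod (psi n c) / 2)\<^sup>2 \<le> cmod (psi (Suc n) c) / 2"
    and "cmod (psi (Suc n) c) / 2 \<le> 3 * (cmod (psi n c) / 2)\<^sup>2"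
    and "cmod (psi n c) \<le> cmod (psi (Suc n) c)"
proof -
  let ?z = "psi n c"
  have sq: "2 * cmod ?z \<le> (cmod ?z)\<^sup>2"
    using assms(1) by (simp add: power2_eq_square mult_right_mono)
  have "(cmod ?z)\<^sup>2 - cmod c \<le> cmod (?z\<^sup>2 + c)"
    using norm_diff_ineq[of "?z\<^sup>2" c] by (simp add: norm_power)
  moreover have "cmod (?z\<^sup>2 + c) \<le> (cmod ?z)\<^sup>2 + cmod c"
    using norm_triangle_ineq[of "?z\<^sup>2" c] by (simp add: norm_power)
  ultimately show "(cmod ?z / 2)\<^sup>2 \<le> cmod (psi (Suc n) c) / 2"
    "cmod (psi (Suc n) c) / 2 \<le> 3 * (cmod ?z / 2)\<^sup>2"
    "cmod ?z \<le> cmod (psi (Suc n) c)"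
    using sq assms(2) by (simp_all add: psi_Suc power_divide)
qed

definition lambda_seq :: "complex \<Rightarrow> nat \<Rightarrow> real" where
  "lambda_seq c n = 2 powr (- (real n - 1)) * log_plus (cmod (psi n c / 2))"

lemma lambda_seq_Suc: "lambda_seq c (Suc n) = log_plus (cmod (psi (Suc n) c / 2)) / 2 ^ n"
  by (simp add: lambda_seq_def powr_minus powr_realpow field_simps)

lemma lambda_seq_nonneg: "0 \<le> lambda_seq c n"
  by (simp add: lambda_seq_def log_plus_def)

lemma lambda_seq_tendsto_0:
  assumes "\<And>n. cmod (psi n c) \<le> B"
  shows "lambda_seq c \<longlonglongrightarrow> 0"
proof -
  have "(\<lambda>n. lambda_seq c (Suc n)) \<longlonglongrightarrow> 0"
  proof (rule tendsto_sandwich[OF _ _ tendsto_const])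
    show "\<forall>\<^sub>F n in sequentially. 0 \<le> lambda_seq c (Suc n)" by (simp add: lambda_seq_nonneg)
    have "log_plus (cmod (psi (Suc n) c / 2)) \<le> log_plus B" for n
      using assms[of "Suc n"] norm_ge_zero[of "psi (Suc n) c"]
      unfolding log_plus_def by (subst ln_le_cancel_iff) (auto simp: norm_divide)
    then show "\<forall>\<^sub>F n in sequentially. lambda_seq c (Suc n) \<le> log_plus B * (1 / 2) ^ n"
      by (auto simp: lambda_seq_Suc power_divide divide_right_mono)
    show "(\<lambda>n. log_plus B * (1 / 2) ^ n) \<longlonglongrightarrow> 0"
      by (rule tendsto_mult_right_zero[OF LIMSEQ_power_zero]) simp
  qed
  then show ?thesis by (rule LIMSEQ_offset[where k = 1, simplified])
qed

text \<open>The lower half of \<open>escape_step\<close> makes the sequence increase from here on;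
  the upper half bounds its increments by a geometric series with ratio 1/2.\<close>

lemma lambda_seq_escaped:
  assumes n: "2 \<le> cmod (psi (Suc n) c)" "cmod c \<le> cmod (psi (Suc n) c)"
  shows "\<exists>l. lambda_seq c \<longlonglongrightarrow> l \<and> lambda_seq c (Suc n) \<le> l"
proof -
  define b where "b k = cmod (psi (Suc n + k) c) / 2" for k
  have esc: "2 \<le> cmod (psi (Suc n + k) c) \<and> cmod c \<le> cmod (psi (Suc n + k) c)" for k
  proof (induction k)
    case (Suc k)
    then show ?case using escape_step(3)[of "Suc n + k" c] by simp
  qed (use n in simp)
  have b1: "1 \<le> b k" for k using esc[of k] by (simp add: b_def)
  have up: "(b k)\<^sup>2 \<le> b (Suc k)" and down: "b (Suc k) \<le> 3 * (b k)\<^sup>2" for k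
    using escape_step[of "Suc n + k" c] esc[of k] by (simp_all add: b_def)
  have eq: "lambda_seq c (Suc n + k) = ln (b k) / 2 ^ (n + k)" for k
    using b1[of k] lambda_seq_Suc[of c "n + k"] by (simp add: log_plus_def norm_divide b_def)
  have ln_up: "2 * ln (b k) \<le> ln (b (Suc k))" for k
  proof -
    have "2 * ln (b k) = ln ((b k)\<^sup>2)" using b1[of k] by (simp add: ln_realpow)
    also have "\<dots> \<le> ln (b (Suc k))"
      using up[of k] b1[of k] b1[of "Suc k"] by (subst ln_le_cancel_iff) auto
    finally show ?thesis .
  qed
  have ln_down: "ln (b (Suc k)) \<le> ln 3 + 2 * ln (b k)" for k
  proof -
    have "ln (b (Suc k)) \<le> ln (3 * (b k)\<^sup>2)"
      using down[of k] b1[of "Suc k"] b1[of k] by (subst ln_le_cancel_iff) auto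
    also have "\<dots> = ln 3 + 2 * ln (b k)" using b1[of k] by (simp add: ln_mult ln_realpow)
    finally show ?thesis .
  qed
  let ?a = "\<lambda>k. lambda_seq c (Suc n + k)"
  have inc: "incseq ?a"
  proof (rule incseq_SucI)
    fix k
    have "?a k = (2 * ln (b k)) / 2 ^ (n + Suc k)" unfolding eq by simp
    also have "\<dots> \<le> ?a (Suc k)" unfolding eq using ln_up[of k] by (intro divide_right_mono) auto
    finally show "?a k \<le> ?a (Suc k)" .
  qed
  \<comment> \<open>Adding the remaining tail ln 3 / 2^(n + k) of that series gives a decreasing
    sequence, hence an upper bound.\<close>
  have "?a k + ln 3 / 2 ^ (n + k) \<le> ?a 0 + ln 3 / 2 ^ n" for k
  proof (induction k)
    case (Suc k)
    have "?a (Suc k) \<le> (ln 3 + 2 * ln (b k)) / 2 ^ (n + Suc k)"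
      unfolding eq using ln_down[of k] by (intro divide_right_mono) auto
    also have "\<dots> = ?a k + ln 3 / 2 ^ (n + Suc k)" unfolding eq by (simp add: add_divide_distrib)
    finally have "?a (Suc k) + ln 3 / 2 ^ (n + Suc k) \<le> ?a k + ln 3 / 2 ^ (n + k)" by simp
    then show ?case using Suc by simp
  qed simp
  moreover have "0 \<le> ln 3 / (2::real) ^ m" for m by simp
  ultimately have "?a k \<le> ?a 0 + ln 3 / 2 ^ n" for k by (meson add_increasing2 order_trans le_add_same_cancel1)
  then obtain l where l: "?a \<longlonglongrightarrow> l" "\<And>k. ?a k \<le> l"
    using incseq_convergent[OF inc] by blast
  have "lambda_seq c \<longlonglongrightarrow> l"
    using LIMSEQ_offset[of "lambda_seq c" "Suc n" l] l(1) by (simp add: add.commute)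
  with l(2)[of 0] show ?thesis by auto
qed

text \<open>Convergence has to be shown for every parameter, because \<open>lim\<close> carries no
  information for a divergent sequence. Either the orbit stays within \<open>max 2 (cmod c)\<close>,
  or some iterate has escaped.\<close>

lemma lambda_inf_tendsto: "lambda_seq c \<longlonglongrightarrow> lambda_inf c"
proof -
  have "convergent (lambda_seq c)"
  proof (cases "\<forall>n. cmod (psi n c) \<le> max 2 (cmod c)")
    case True
    then have "\<And>n. cmod (psi n c) \<le> max 2 (cmod c)" by blast
    from lambda_seq_tendsto_0[OF this] show ?thesis by (rule convergentI)
  next
    case False
    then obtain n where n: "max 2 (cmod c) < cmod (psi n c)" by (auto simp: not_le)
    then obtain m where "n = Suc m" by (cases n) auto
    with n show ?thesis using lambda_seq_escaped[of m c] by (auto simp: convergent_def)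
  qed
  then show ?thesis
    unfolding lambda_inf_def lambda_seq_def[symmetric] by (simp add: convergent_LIMSEQ_iff)
qed

lemma lambda_inf_nonneg: "0 \<le> lambda_inf c"
  by (rule LIMSEQ_le_const[OF lambda_inf_tendsto]) (auto simp: lambda_seq_nonneg)

lemma lambda_inf_mandelbrot:
  assumes "c \<in> mandelbrot"
  shows "lambda_inf c = 0"
proof -
  obtain B where "\<And>n. cmod (psi n c) \<le> B"
    using assms by (auto simp: mandelbrot_def bounded_iff)
  from lambda_seq_tendsto_0[OF this] lambda_inf_tendsto show ?thesis by (rule LIMSEQ_unique[symmetric])
qed

lemma lambda_inf_escaped:
  assumes "2 \<le> cmod (psi (Suc n) c)" "cmod c \<le> cmod (psi (Suc n) c)"
  shows "ln (cmod (psi (Suc n) c) / 2) \<le> 2 ^ n * lambda_inf c"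
proof -
  have "lambda_seq c (Suc n) \<le> lambda_inf c"
    using lambda_seq_escaped[OF assms] lambda_inf_tendsto LIMSEQ_unique by blast
  then show ?thesis
    using assms(1) by (simp add: lambda_seq_Suc log_plus_def norm_divide field_simps)
qed

lemma norm_psi_le: "cmod (psi (Suc n) c) \<le> 2 * exp (2 ^ n * lambda_inf c)"
proof -
  have esc: "cmod (psi (Suc m) c) \<le> 2 * exp (2 ^ m * lambda_inf c)"
    if "2 \<le> cmod (psi (Suc m) c)" "cmod c \<le> cmod (psi (Suc m) c)" for m
  proof -
    have "cmod (psi (Suc m) c) / 2 = exp (ln (cmod (psi (Suc m) c) / 2))"
      using that by (subst exp_ln) auto
    also have "\<dots> \<le> exp (2 ^ m * lambda_inf c)" using lambda_inf_escaped[OF that] by simp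
    finally show ?thesis by simp
  qed
  have "1 * lambda_inf c \<le> 2 ^ n * lambda_inf c"
    by (rule mult_right_mono) (auto simp: lambda_inf_nonneg)
  then have mono: "2 * exp (lambda_inf c) \<le> 2 * exp (2 ^ n * lambda_inf c)" by simp
  have two: "2 \<le> 2 * exp (lambda_inf c)" using lambda_inf_nonneg by simp
  consider "2 \<le> cmod (psi (Suc n) c)" "cmod c \<le> cmod (psi (Suc n) c)"
    | "cmod (psi (Suc n) c) < 2" | "2 \<le> cmod c" "cmod (psi (Suc n) c) < cmod c" by linarith
  then show ?thesis
  proof cases
    \<comment> \<open>\<open>c\<close> is the first iterate and here satisfies the escape condition
      itself, so \<open>esc\<close> at index 0 bounds \<open>cmod c\<close>, which in turn bounds
      the later iterate.\<close>
    case 3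
    then have "cmod c \<le> 2 * exp (lambda_inf c)" using esc[of 0] by (simp add: psi_Suc)
    then show ?thesis using 3 mono by linarith
  next
    case 1
    then show ?thesis by (rule esc)
  next
    case 2
    then show ?thesis using mono two by linarith
  qed
qed

lemma norm_le_lambda_inf: "cmod c \<le> 2 * exp (lambda_inf c)"
  using norm_psi_le[of 0 c] by (simp add: psi_Suc)

section \<open>Monic polynomials of small size in every degree\<close>

fun psi_poly :: "nat \<Rightarrow> 'a :: idom poly" where
  "psi_poly 0 = 0"
| "psi_poly (Suc n) = (psi_poly n)\<^sup>2 + [:0, 1:]"

lemma poly_psi_poly: "poly (psi_poly n) c = psi n c"
  by (induction n) (simp_all add: psi_Suc)

lemma degree_psi_poly:
  "degree (psi_poly (Suc n) :: 'a :: idom poly) = 2 ^ n \<and> lead_coeff (psi_poly (Suc n) :: 'a poly) = 1"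
proof (induction n)
  case 0
  then show ?case by simp
next
  case (Suc n)
  define p :: "'a poly" where "p = psi_poly (Suc n)"
  have p: "degree p = 2 ^ n" "lead_coeff p = 1" "p \<noteq> 0"
    using Suc.IH unfolding p_def by (metis leading_coeff_0_iff zero_neq_one)+
  have d: "degree (p\<^sup>2) = 2 ^ Suc n" using p by (simp add: degree_power_eq)
  have l: "lead_coeff (p\<^sup>2) = 1" unfolding lead_coeff_power p(2) by simp
  have "(1 :: nat) < 2 ^ Suc n" by (rule one_less_power) auto
  then have lt: "degree [:0, 1 :: 'a:] < degree (p\<^sup>2)" using d by (simp del: power_Suc)
  have "degree (p\<^sup>2 + [:0, 1:]) = 2 ^ Suc n" using degree_add_eq_left[OF lt] d by simp
  moreover have "coeff [:0, 1 :: 'a:] (2 ^ Suc n) = 0" using lt d by (intro coeff_eq_0) simp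
  moreover have "psi_poly (Suc (Suc n)) = p\<^sup>2 + [:0, 1:]" by (simp add: p_def)
  ultimately show ?case using l d by simp
qed

text \<open>Write d in binary and multiply the \<open>psi_poly (Suc m)\<close>, of degree 2^m, over
  its digits equal to 1. Each factor costs a constant 2 by \<open>norm_psi_le\<close>, and 2 to the
  number of these digits is at most d + 1.\<close>

lemma small_monic_poly:
  "\<exists>P :: complex poly. degree P = d \<and> lead_coeff P = 1 \<and>
     (\<forall>c. cmod (poly P c) \<le> (real d + 1) * exp (real d * lambda_inf c))"
proof (induction d rule: less_induct)
  case (less d)
  show ?case
  proof (cases "d = 0")
    case True
    then show ?thesis by (intro exI[of _ 1]) auto
  next
    case False
    then obtain m where m: "2 ^ m \<le> d" "d < 2 ^ (m + 1)"
      using ex_power_ivl1[of 2 d] by auto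
    define e where "e = d - 2 ^ m"
    have e: "e < d" "d = 2 ^ m + e" using m False by (auto simp: e_def)
    obtain P :: "complex poly" where P: "degree P = e" "lead_coeff P = 1"
      "\<And>c. cmod (poly P c) \<le> (real e + 1) * exp (real e * lambda_inf c)"
      using less[OF e(1)] by blast
    let ?Q = "psi_poly (Suc m) * P"
    have Q: "degree (psi_poly (Suc m) :: complex poly) = 2 ^ m"
      "lead_coeff (psi_poly (Suc m) :: complex poly) = 1"
      using degree_psi_poly[of m, where 'a = complex] by blast+
    have "psi_poly (Suc m) \<noteq> (0 :: complex poly)" "P \<noteq> 0" using Q(2) P(2) by (metis leading_coeff_0_iff zero_neq_one)+
    then have "degree ?Q = d" using Q P e by (simp add: degree_mult_eq del: psi_poly.simps)
    moreover have "lead_coeff ?Q = 1" unfolding lead_coeff_mult Q(2) P(2) by simp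
    moreover have "cmod (poly ?Q c) \<le> (real d + 1) * exp (real d * lambda_inf c)" for c
    proof -
      have "cmod (poly ?Q c) = cmod (psi (Suc m) c) * cmod (poly P c)"
        by (simp add: poly_psi_poly norm_mult del: psi_poly.simps)
      also have "\<dots> \<le> (2 * exp (2 ^ m * lambda_inf c)) * ((real e + 1) * exp (real e * lambda_inf c))"
        by (intro mult_mono norm_psi_le P) auto
      also have "\<dots> = (2 * (real e + 1)) * exp (real d * lambda_inf c)"
        by (simp add: e(2) exp_add algebra_simps)
      also have "\<dots> \<le> (real d + 1) * exp (real d * lambda_inf c)"
      proof (rule mult_right_mono)
        \<comment> \<open>Removing the top digit 2^m leaves e < 2^m, so d = 2^m + e is at least 2e +
          1; the factor 2 is thus absorbed.\<close>
        have "2 * (e + 1) \<le> d + 1" using m e by simp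
        then have "real (2 * (e + 1)) \<le> real (d + 1)" by (simp only: of_nat_le_iff)
        then show "2 * (real e + 1) \<le> real d + 1" by simp
      qed simp
      finally show ?thesis .
    qed
    ultimately show ?thesis by blast
  qed
qed

text \<open>Compare leading coefficients in Lagrange's interpolation formula, which reproduces
  \<open>P\<close> because its degree is below the number of nodes.\<close>

lemma lagrange_lead_coeff:
  fixes P :: "'a :: field poly"
  assumes T: "finite T" and P: "degree P + 1 = card T"
  shows "(\<Sum>x\<in>T. poly P x / (\<Prod>y\<in>T - {x}. x - y)) = lead_coeff P"
proof -
  define w where "w x = (\<Prod>y\<in>T - {x}. x - y)" for x
  define L where "L x = (\<Prod>y\<in>T - {x}. [:- y, 1:])" for x
  define Q where "Q = (\<Sum>x\<in>T. smult (poly P x / w x) (L x))"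
  have w: "w x \<noteq> 0" for x using T by (auto simp: w_def)
  have L: "degree (L x) = degree P \<and> coeff (L x) (degree P) = 1" if "x \<in> T" for x
  proof -
    have deg: "degree (L x) = card (T - {x})"
      unfolding L_def by (subst degree_prod_eq_sum_degree) auto
    moreover have "lead_coeff (L x) = 1" unfolding L_def by (simp add: lead_coeff_prod)
    moreover have "card (T - {x}) = degree P" using that P by simp
    ultimately show ?thesis by metis
  qed
  have "degree Q \<le> degree P"
    unfolding Q_def using T L by (intro degree_sum_le) (auto intro: order_trans[OF degree_smult_le])
  then have "degree (Q - P) < card T" using P degree_diff_le[of Q "degree P" P] by simp
  moreover have "poly Q z = poly P z" if z: "z \<in> T" for z
  proof -
    have "poly (L x) z = (if x = z then w z else 0)" if "x \<in> T" for x
      using T z that by (auto simp: L_def w_def poly_prod)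
    then have "poly Q z = (\<Sum>x\<in>T. if x = z then poly P z else 0)"
      unfolding Q_def poly_sum poly_smult using w by (intro sum.cong) auto
    then show ?thesis using T z by simp
  qed
  then have "T \<subseteq> {z. poly (Q - P) z = 0}" by auto
  ultimately have "Q - P = 0"
    using T by (metis card_mono card_poly_roots_bound le_less_trans less_irrefl poly_roots_finite)
  then have "coeff Q (degree P) = lead_coeff P" by simp
  then show ?thesis using L by (simp add: Q_def coeff_sum w_def)
qed

text \<open>For a monic \<open>P\<close> of degree \<open>card T - 1\<close> the Lagrange quotients
  sum to 1, so at some point the product of distances is at most N times |P|. Remove that point and
  induct. \<open>N\<close> is kept apart from \<open>card T\<close> so that the factors do not
  change during the induction.\<close>

lemma disc_le:
  assumes "finite T" "card T \<le> N"
  shows "disc (\<lambda>x y. cmod (x - y)) T \<le> (\<Prod>x\<in>T. (real N)\<^sup>2 * exp (real N * lambda_inf x))\<^sup>2"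
  using assms
proof (induction "card T" arbitrary: T)
  case 0
  then show ?case by (simp add: disc_def)
next
  case (Suc k)
  \<comment> \<open>One factor \<open>N\<close> pays for the number of Lagrange terms, the other for
    the factor degree + 1 in the size of \<open>P\<close>.\<close>
  define B where "B x = (real N)\<^sup>2 * exp (real N * lambda_inf x)" for x
  define W where "W x = (\<Prod>y\<in>T - {x}. cmod (x - y))" for x
  have W: "0 < W x" for x by (auto simp: W_def intro!: prod_pos)
  have N: "Suc k \<le> N" using Suc by simp
  obtain P :: "complex poly" where P: "degree P = k" "lead_coeff P = 1"
    "\<And>c. cmod (poly P c) \<le> (real k + 1) * exp (real k * lambda_inf c)"
    using small_monic_poly by blast
  have bound: "real N * cmod (poly P x) \<le> B x" for x
  proof -
    have "cmod (poly P x) \<le> real N * exp (real N * lambda_inf x)"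
      by (rule order_trans[OF P(3)], intro mult_mono) (use N lambda_inf_nonneg in \<open>auto intro!: mult_right_mono\<close>)
    then show ?thesis by (simp add: B_def power2_eq_square mult.assoc mult_left_mono)
  qed
  have "\<exists>x\<in>T. W x \<le> B x"
  proof (rule ccontr)
    assume "\<not> ?thesis"
    then have less: "B x < W x" if "x \<in> T" for x using that by auto
    have "T \<noteq> {}" using Suc.hyps(2) by auto
    have "1 = cmod (\<Sum>x\<in>T. poly P x / (\<Prod>y\<in>T - {x}. x - y))"
      using lagrange_lead_coeff[of T P] Suc P by simp
    also have "\<dots> \<le> (\<Sum>x\<in>T. cmod (poly P x) / W x)"
      by (rule order_trans[OF norm_sum]) (simp add: norm_divide W_def prod_norm)
    also have "\<dots> < (\<Sum>x\<in>T. 1 / real N)"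
    proof (rule sum_strict_mono[OF Suc.prems(1) \<open>T \<noteq> {}\<close>])
      fix x assume "x \<in> T"
      then have "real N * cmod (poly P x) < W x" using less bound by (meson le_less_trans)
      then show "cmod (poly P x) / W x < 1 / real N" using W[of x] N by (simp add: field_simps)
    qed
    also have "\<dots> \<le> 1" using Suc.prems(2) N by simp
    finally show False by simp
  qed
  then obtain x where x: "x \<in> T" "W x \<le> B x" by blast
  have IH: "disc (\<lambda>x y. cmod (x - y)) (T - {x}) \<le> (\<Prod>x\<in>T - {x}. B x)\<^sup>2"
    unfolding B_def by (rule Suc.hyps(1)) (use Suc x in auto)
  have "disc (\<lambda>x y. cmod (x - y)) T = disc (\<lambda>x y. cmod (x - y)) (T - {x}) * (W x)\<^sup>2"
    unfolding W_def by (rule disc_remove) (use Suc.prems x norm_minus_commute in auto)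
  also have "\<dots> \<le> (\<Prod>x\<in>T - {x}. B x)\<^sup>2 * (B x)\<^sup>2"
    by (intro mult_mono IH power_mono x(2)) (use W[of x] in auto)
  also have "\<dots> = (\<Prod>x\<in>T. B x)\<^sup>2"
    using Suc.prems(1) x(1) by (simp add: prod.remove[of T x] power_mult_distrib)
  finally show ?case unfolding B_def .
qed

lemma ln_disc_le:
  assumes "finite T" "0 < card T"
  shows "disc (\<lambda>x y. cmod (x - y)) T \<le>
    exp (real (card T) * (4 * ln (real (card T)) + 2 * (\<Sum>x\<in>T. lambda_inf x)))"
proof -
  let ?N = "real (card T)"
  have "(\<Prod>x\<in>T. ?N\<^sup>2 * exp (?N * lambda_inf x))\<^sup>2 = (\<Prod>x\<in>T. exp (2 * ln ?N + ?N * lambda_inf x))\<^sup>2"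
    using assms(2) by (simp add: exp_add exp_double)
  also have "\<dots> = exp (2 * (\<Sum>x\<in>T. 2 * ln ?N + ?N * lambda_inf x))"
    by (simp add: exp_sum[OF assms(1)] exp_double)
  also have "2 * (\<Sum>x\<in>T. 2 * ln ?N + ?N * lambda_inf x) = ?N * (4 * ln ?N + 2 * (\<Sum>x\<in>T. lambda_inf x))"
    by (simp add: sum.distrib sum_distrib_left distrib_left mult.left_commute)
  finally show ?thesis using disc_le[OF assms(1) order_refl] by simp
qed

lemma finite_diameter_le:
  assumes "finite T" "2 \<le> card T"
  shows "finite_diameter (\<lambda>x y. cmod (x - y)) T \<le>
    exp ((4 * ln (real (card T)) + 2 * (\<Sum>x\<in>T. lambda_inf x)) / (real (card T) - 1))"
proof -
  let ?N = "real (card T)" and ?E = "4 * ln (real (card T)) + 2 * (\<Sum>x\<in>T. lambda_inf x)"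
  have "0 \<le> disc (\<lambda>x y. cmod (x - y)) T" by (simp add: disc_def prod_nonneg)
  then have "disc (\<lambda>x y. cmod (x - y)) T powr (1 / (?N * (?N - 1))) \<le> exp (?N * ?E) powr (1 / (?N * (?N - 1)))"
    using ln_disc_le[OF assms(1)] assms(2) by (intro powr_mono2) auto
  also have "\<dots> = exp (?E / (?N - 1))" using assms(2) by (simp add: exp_powr_real)
  finally show ?thesis by (subst finite_diameter_eq_disc) (use assms in auto)
qed

text \<open>Large sets of discriminant at least 1 suffice, since \<open>disc_subset_ge_1\<close>
  shrinks them to every prescribed size. The matching upper bound is
  \<open>finite_diameter_le\<close>, where \<open>lambda_inf\<close> vanishes on the set.\<close>

lemma transfinite_diameter_mandelbrot:
  assumes lower: "\<And>n. \<exists>T\<subseteq>mandelbrot. finite T \<and> n \<le> card T \<and> 1 \<le> disc (\<lambda>x y. cmod (x - y)) T"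
  shows "transfinite_diameter (\<lambda>x y. cmod (x - y)) mandelbrot = 1"
proof (rule transfinite_diameter_eq_1)
  let ?d = "\<lambda>x y. cmod (x - y)"
  fix n :: nat assume n: "2 \<le> n"
  obtain T where T: "T \<subseteq> mandelbrot" "finite T" "n \<le> card T" "1 \<le> disc ?d T" using lower by blast
  then obtain T' where T': "T' \<subseteq> T" "card T' = n" "1 \<le> disc ?d T'"
    using disc_subset_ge_1[of T ?d n] n by (auto simp: norm_minus_commute)
  then have fin: "finite T'" using T(2) finite_subset by blast
  have "finite_diameter ?d T' = disc ?d T' powr (1 / (real n * (real n - 1)))"
    using finite_diameter_eq_disc[OF fin, of ?d] T'(2) by simp
  also have "\<dots> \<ge> 1" using T'(3) n by (intro ge_one_powr_ge_zero) auto
  finally show "\<exists>T\<subseteq>mandelbrot. finite T \<and> card T = n \<and> 1 \<le> finite_diameter ?d T"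
    using T' T fin by blast
next
  fix T assume T: "T \<subseteq> mandelbrot" "finite T" "2 \<le> card T"
  have "(\<Sum>x\<in>T. lambda_inf x) = 0" using T(1) by (intro sum.neutral) (auto simp: lambda_inf_mandelbrot)
  then show "finite_diameter (\<lambda>x y. cmod (x - y)) T \<le> exp (4 * ln (real (card T)) / (real (card T) - 1))"
    using finite_diameter_le[OF T(2,3)] by simp
next
  show "(\<lambda>n. exp (4 * ln (real n) / (real n - 1))) \<longlonglongrightarrow> 1" by real_asymp
qed auto

section \<open>The product formula and p-adic absolute values\<close>

lemma prod_int_prime_powers:
  fixes a :: int
  assumes "a \<noteq> 0" "finite F" "\<And>p. p \<in> F \<Longrightarrow> prime p" "\<And>p. prime p \<Longrightarrow> int p dvd a \<Longrightarrow> p \<in> F"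
  shows "(\<Prod>p\<in>F. int p ^ multiplicity (int p) a) = \<bar>a\<bar>"
proof -
  have sub: "prime_factors a \<subseteq> int ` F"
  proof
    fix q assume q: "q \<in> prime_factors a"
    then have "prime q" "q dvd a" by auto
    then have "int (nat q) = q" "prime (nat q)" by (auto simp: prime_ge_0_int prime_nat_iff_prime)
    then show "q \<in> int ` F" using assms(4)[of "nat q"] \<open>q dvd a\<close> by (metis imageI)
  qed
  have "\<bar>a\<bar> = (\<Prod>q\<in>prime_factors a. q ^ multiplicity q a)"
    using assms(1) prod_prime_factors[of a] by simp
  also have "\<dots> = (\<Prod>q\<in>int ` F. q ^ multiplicity q a)"
    using assms sub by (intro prod.mono_neutral_left) (auto simp: prime_factors_multiplicity)
  finally show ?thesis by (simp add: prod.reindex)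
qed

lemma padic_abs_of_int:
  "padic_abs p (of_int k) = (if k = 0 then 0 else real p powi (- int (multiplicity (int p) k)))"
  by (simp add: padic_abs_def)

lemma padic_abs_of_int_le_1:
  assumes "prime p"
  shows "padic_abs p (of_int k) \<le> 1"
proof -
  have "1 \<le> real p" using assms prime_ge_1_nat by force
  then have "1 \<le> real p ^ multiplicity (int p) k" by simp
  then show ?thesis
    by (auto simp: padic_abs_of_int power_int_minus inverse_le_1_iff intro: order_trans[of _ 0])
qed

lemma padic_abs_quotient:
  assumes r: "quotient_of r = (a, b)" and p: "prime p" and "r \<noteq> 0"
  shows "padic_abs p r = real p ^ multiplicity (int p) b / real p ^ multiplicity (int p) a"
  using assms prime_gt_0_nat[OF p]
  by (simp add: padic_abs_def power_int_diff)

text \<open>In lowest terms a prime dividing the denominator does not divide the numerator, so the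
  absolute value is exactly the prime power in the denominator. For r = 0 the denominator is
  1.\<close>

lemma padic_abs_denominator:
  assumes r: "quotient_of r = (a, b)" and p: "prime p"
  shows "real p ^ multiplicity (int p) b \<le> max 1 (padic_abs p r)"
proof (cases "int p dvd b \<and> r \<noteq> 0")
  case True
  have "coprime a b" using r by (rule quotient_of_coprime)
  then have "\<not> int p dvd a" using True p by (meson coprime_common_divisor not_prime_unit prime_nat_int_transfer)
  then have "multiplicity (int p) a = 0" by (rule not_dvd_imp_multiplicity_0)
  then show ?thesis using padic_abs_quotient[OF r p] True by simp
next
  case False
  have "\<not> int p dvd b"
  proof
    assume "int p dvd b"
    with False have "r = 0" by simp
    then have "b = 1" using r by simp
    then show False using \<open>int p dvd b\<close> p by (simp add: prime_nat_iff)
  qed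
  then have "multiplicity (int p) b = 0" by (rule not_dvd_imp_multiplicity_0)
  then show ?thesis by simp
qed

lemma finite_prime_divisors:
  assumes "(b :: int) \<noteq> 0"
  shows "finite {p :: nat. int p dvd b}"
proof (rule finite_subset)
  show "{p :: nat. int p dvd b} \<subseteq> {..nat \<bar>b\<bar>}"
  proof
    fix p assume "p \<in> {p :: nat. int p dvd b}"
    then have "\<bar>int p\<bar> \<le> \<bar>b\<bar>" using assms by (intro dvd_imp_le_int) auto
    then show "p \<in> {..nat \<bar>b\<bar>}" by simp
  qed
qed simp

lemma finite_padic_abs_ne_1:
  assumes "r \<noteq> 0"
  shows "finite {p. prime p \<and> padic_abs p r \<noteq> 1}"
proof -
  obtain a b where r: "quotient_of r = (a, b)" by fastforce
  have ab: "a \<noteq> 0" "b \<noteq> 0" using assms r quotient_of_denom_pos[OF r] quotient_of_div[OF r] by auto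
  have "{p. prime p \<and> padic_abs p r \<noteq> 1} \<subseteq> {p :: nat. int p dvd a} \<union> {p :: nat. int p dvd b}"
  proof (rule subsetI, rule ccontr)
    fix p assume p: "p \<in> {p. prime p \<and> padic_abs p r \<noteq> 1}"
      and "p \<notin> {p :: nat. int p dvd a} \<union> {p :: nat. int p dvd b}"
    then show False
      using padic_abs_quotient[OF r _ assms, of p] by (simp add: not_dvd_imp_multiplicity_0)
  qed
  then show ?thesis by (rule finite_subset) (use finite_prime_divisors ab in auto)
qed

lemma product_formula:
  assumes "r \<noteq> 0" "finite F" "\<And>p. p \<in> F \<Longrightarrow> prime p" "\<And>p. prime p \<Longrightarrow> padic_abs p r \<noteq> 1 \<Longrightarrow> p \<in> F"
  shows "\<bar>real_of_rat r\<bar> * (\<Prod>p\<in>F. padic_abs p r) = 1"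
proof -
  obtain a b where r: "quotient_of r = (a, b)" by fastforce
  have b: "b > 0" and a: "a \<noteq> 0"
    using assms(1) r quotient_of_denom_pos[OF r] quotient_of_div[OF r] by auto
  \<comment> \<open>Enlarging \<open>F\<close> by all primes of the numerator and denominator only
    adds factors equal to 1, and makes both prime factorizations available over the same index
    set.\<close>
  define F' where "F' = F \<union> {p. prime p \<and> (int p dvd a \<or> int p dvd b)}"
  have fin: "finite F'"
  proof -
    have "{p. prime p \<and> (int p dvd a \<or> int p dvd b)} \<subseteq> {p :: nat. int p dvd a} \<union> {p :: nat. int p dvd b}" by auto
    then have "finite {p. prime p \<and> (int p dvd a \<or> int p dvd b)}"
      by (rule finite_subset) (use finite_prime_divisors a b in auto)
    then show ?thesis using assms(2) by (simp add: F'_def)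
  qed
  have prime: "prime p" if "p \<in> F'" for p using that assms(3) by (auto simp: F'_def)
  have prod: "(\<Prod>p\<in>F'. real p ^ multiplicity (int p) c) = real_of_int \<bar>c\<bar>"
    if "c \<noteq> 0" "\<And>p. prime p \<Longrightarrow> int p dvd c \<Longrightarrow> p \<in> F'" for c
  proof -
    have "real_of_int \<bar>c\<bar> = real_of_int (\<Prod>p\<in>F'. int p ^ multiplicity (int p) c)"
      by (simp only: prod_int_prime_powers[OF that(1) fin prime that(2)])
    then show ?thesis by simp
  qed
  have num: "(\<Prod>p\<in>F'. real p ^ multiplicity (int p) a) = \<bar>of_int a\<bar>"
    using prod[of a] a by (simp add: F'_def)
  have den: "(\<Prod>p\<in>F'. real p ^ multiplicity (int p) b) = of_int b"
    using prod[of b] b by (simp add: F'_def)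
  have "(\<Prod>p\<in>F. padic_abs p r) = (\<Prod>p\<in>F'. padic_abs p r)"
  proof (rule prod.mono_neutral_left[OF fin])
    show "F \<subseteq> F'" by (simp add: F'_def)
    show "\<forall>p\<in>F' - F. padic_abs p r = 1" using prime assms(4) by blast
  qed
  also have "\<dots> = (\<Prod>p\<in>F'. real p ^ multiplicity (int p) b / real p ^ multiplicity (int p) a)"
    using padic_abs_quotient[OF r prime assms(1)] by simp
  also have "\<dots> = of_int b / \<bar>of_int a\<bar>" by (simp add: prod_dividef num den)
  finally show ?thesis using a b by (simp add: quotient_of_div[OF r] of_rat_divide abs_divide)
qed

lemma finite_bounded_rats: "finite {r :: rat. snd (quotient_of r) \<le> D \<and> \<bar>real_of_rat r\<bar> \<le> B}"
proof (rule finite_subset)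
  let ?K = "\<lceil>B * of_int D\<rceil>"
  show "{r :: rat. snd (quotient_of r) \<le> D \<and> \<bar>real_of_rat r\<bar> \<le> B}
      \<subseteq> (\<lambda>(a, b). of_int a / of_int b) ` ({- ?K..?K} \<times> {1..D})"
  proof
    fix r :: rat assume "r \<in> {r. snd (quotient_of r) \<le> D \<and> \<bar>real_of_rat r\<bar> \<le> B}"
    then have *: "snd (quotient_of r) \<le> D" "\<bar>real_of_rat r\<bar> \<le> B" by auto
    obtain a b where ab: "quotient_of r = (a, b)" by fastforce
    with * have r: "quotient_of r = (a, b)" "b \<le> D" "\<bar>real_of_rat r\<bar> \<le> B" by simp_all
    have b: "b > 0" using quotient_of_denom_pos[OF r(1)] .
    have eq: "r = of_int a / of_int b" using quotient_of_div[OF r(1)] .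
    have "\<bar>real_of_int a\<bar> = \<bar>real_of_rat r\<bar> * of_int b" using b by (simp add: eq of_rat_divide abs_divide)
    also have "0 \<le> B" using r(3) by linarith
    then have "\<bar>real_of_rat r\<bar> * of_int b \<le> B * of_int D" using r b by (intro mult_mono) auto
    finally have "\<bar>real_of_int a\<bar> \<le> of_int ?K" by linarith
    then have "\<bar>a\<bar> \<le> ?K" by linarith
    then have "(a, b) \<in> {- ?K..?K} \<times> {1..D}" using b r(2) by auto
    then show "r \<in> (\<lambda>(a, b). of_int a / of_int b) ` ({- ?K..?K} \<times> {1..D})" using eq by force
  qed
qed simp

text \<open>The roots are given through a map \<open>f\<close> so that applying a homomorphism to
  the coefficients amounts to composing it with \<open>f\<close>, even before it is known to permute
  \<open>T\<close>.\<close>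

definition root_poly :: "('a \<Rightarrow> 'b :: idom) \<Rightarrow> 'a set \<Rightarrow> 'b poly" where
  "root_poly f T = (\<Prod>x\<in>T. [:- f x, 1:])"

lemma coeff_linear_mult: "coeff ([:- a, 1:] * q) i = (if i = 0 then 0 else coeff q (i - 1)) - a * coeff q i"
  for a :: "'a :: idom"
  by (cases i) (auto simp: mult_pCons_left coeff_pCons)

lemma root_poly_insert: "finite T \<Longrightarrow> x \<notin> T \<Longrightarrow> root_poly f (insert x T) = [:- f x, 1:] * root_poly f T"
  unfolding root_poly_def by (rule prod.insert)

lemma root_poly_empty: "root_poly f {} = 1"
  by (simp add: root_poly_def)

lemma degree_root_poly: "finite T \<Longrightarrow> degree (root_poly f T) = card T"
  unfolding root_poly_def by (subst degree_prod_eq_sum_degree) auto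

lemma lead_coeff_root_poly: "lead_coeff (root_poly f T) = 1"
  by (simp add: root_poly_def lead_coeff_prod)

lemma poly_root_poly: "poly (root_poly f T) z = (\<Prod>x\<in>T. z - f x)"
  by (simp add: root_poly_def poly_prod)

lemma coeff_root_poly_hom:
  assumes "finite T" and g: "\<And>x y. g (x + y) = g x + g y" "\<And>x y. g (x * y) = g x * g y" "g 1 = 1"
  shows "g (coeff (root_poly f T) i) = coeff (root_poly (\<lambda>x. g (f x)) T) i"
proof -
  have g0: "g 0 = 0" using g(1)[of 0 0] by (metis add.right_neutral add_left_cancel)
  have diff: "g (x - y) = g x - g y" for x y using g(1)[of "x - y" y] by simp
  show ?thesis using assms(1)
  proof (induction T arbitrary: i)
    case empty
    then show ?case using g0 g(3) by (simp add: root_poly_empty)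
  next
    case (insert x T)
    show ?case
      unfolding root_poly_insert[OF insert.hyps(1,2)] coeff_linear_mult diff g(2) insert.IH
      by (simp add: g0 insert.IH)
  qed
qed

lemma split_simple_roots:
  fixes p :: "'a :: alg_closed_field poly"
  assumes "lead_coeff p = 1" and simple: "\<And>a. poly p a = 0 \<Longrightarrow> poly (pderiv p) a \<noteq> 0"
  shows "p = root_poly (\<lambda>x. x) {x. poly p x = 0}" "card {x. poly p x = 0} = degree p"
proof -
  have ne: "p \<noteq> 0" using assms(1) by auto
  obtain A where A: "p = (\<Prod>x\<in>#A. [:- x, 1:])"
    using alg_closed_imp_factorization[OF ne] assms(1) by auto
  have root: "poly p x = 0 \<longleftrightarrow> x \<in># A" for x
    unfolding A by (auto simp: poly_prod_mset prod_mset_zero_iff)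
  have count: "count A x \<le> 1" for x
  proof (rule ccontr)
    assume "\<not> count A x \<le> 1"
    then have "{#x, x#} \<subseteq># A" by (auto simp: subseteq_mset_def)
    then obtain B where "A = {#x, x#} + B" by (auto simp: mset_subset_eq_exists_conv)
    then have "p = [:- x, 1:] * ([:- x, 1:] * (\<Prod>x\<in>#B. [:- x, 1:]))" using A by simp
    then have "poly p x = 0" "poly (pderiv p) x = 0" by (simp_all only: pderiv_mult) simp_all
    then show False using simple by blast
  qed
  have "A = mset_set (set_mset A)"
  proof (rule multiset_eqI)
    fix x
    show "count A x = count (mset_set (set_mset A)) x"
    proof (cases "x \<in># A")
      case True
      then have "count A x = 1" using count[of x] count_greater_zero_iff[of A x] by linarith
      then show ?thesis using True by simp
    qed (simp add: not_in_iff)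
  qed
  moreover have "set_mset A = {x. poly p x = 0}" using root by auto
  ultimately have "A = mset_set {x. poly p x = 0}" by simp
  then show *: "p = root_poly (\<lambda>x. x) {x. poly p x = 0}"
    using A by (simp add: root_poly_def prod_unfold_prod_mset)
  show "card {x. poly p x = 0} = degree p"
    using degree_root_poly[OF poly_roots_finite[OF ne], of "\<lambda>x. x"] * by simp
qed

text \<open>Turns the inner products of a discriminant into values of the derivative; used for the
  roots of unity.\<close>

lemma pderiv_root_poly:
  assumes "finite T" "x \<in> T"
  shows "poly (pderiv (root_poly (\<lambda>x. x) T)) x = (\<Prod>y\<in>T - {x}. x - y)"
proof -
  have "root_poly (\<lambda>x. x) T = [:- x, 1:] * root_poly (\<lambda>x. x) (T - {x})"
    using root_poly_insert[of "T - {x}" x "\<lambda>x. x"] assms by (simp add: insert_absorb)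
  then show ?thesis by (simp add: pderiv_mult pderiv_pCons poly_root_poly del: mult_pCons_left)
qed

text \<open>Bernoulli's lower bound for t^n is only linear, like the hypothesis. Squaring it and
  using the hypothesis at 2n sets quadratic against linear growth.\<close>

lemma power_le_linear:
  fixes t :: real
  assumes "\<And>n. t ^ n \<le> real n + 1"
  shows "t \<le> 1"
proof (rule ccontr)
  define \<delta> where "\<delta> = t - 1"
  assume "\<not> t \<le> 1"
  then have \<delta>: "0 < \<delta>" by (simp add: \<delta>_def)
  have "\<delta> * \<delta> * real n < 4" if "n > 0" for n
  proof -
    have "1 + real n * \<delta> \<le> t ^ n" using Bernoulli_inequality[of \<delta> n] \<delta> by (simp add: \<delta>_def)
    then have "real n * \<delta> \<le> t ^ n" by simp
    then have "(real n * \<delta>) ^ 2 \<le> (t ^ n) ^ 2" using \<delta> by (intro power_mono) auto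
    also have "\<dots> = t ^ (2 * n)" by (simp add: power_mult[symmetric] mult.commute)
    also have "\<dots> \<le> real (2 * n) + 1" by (rule assms)
    also have "\<dots> < 4 * real n" using that by simp
    finally have "real n * (\<delta> * \<delta> * real n) < real n * 4" by (simp add: power2_eq_square mult_ac)
    then show ?thesis using that by simp
  qed
  moreover obtain n where n: "4 < real n * (\<delta> * \<delta>)" using reals_Archimedean3[of "\<delta> * \<delta>"] \<delta> by auto
  moreover have "n > 0" using n by (cases n) auto
  ultimately show False by (metis mult.commute not_less_iff_gr_or_eq)
qed

text \<open>\<open>w\<close> stands for the absolute value of a p-adic complex field pulled back
  along an embedding, so that the discriminants at p can be treated inside \<open>qbar\<close>. Only
  the triangle inequality is assumed, as this is what \<open>is_absolute_value\<close>
  provides.\<close>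

locale padic_extension =
  fixes p :: nat and w :: "qbar \<Rightarrow> real"
  assumes prime: "prime p"
    and w_nonneg: "0 \<le> w x" and w_eq_0: "w x = 0 \<longleftrightarrow> x = 0"
    and w_mult: "w (x * y) = w x * w y" and w_add: "w (x + y) \<le> w x + w y"
    and w_of_rat: "w (of_rat r) = padic_abs p r"
begin

lemma w_0 [simp]: "w 0 = 0" by (simp add: w_eq_0)

lemma w_1 [simp]: "w 1 = 1"
  using w_mult[of 1 1] w_eq_0[of 1] by simp

lemma w_power: "w (x ^ n) = w x ^ n"
  by (induction n) (simp_all add: w_mult)

lemma w_minus [simp]: "w (- x) = w x"
proof -
  have "(w (- 1))\<^sup>2 = 1" using w_mult[of "-1" "-1"] by (simp add: power2_eq_square)
  then have "w (- 1) = 1" using w_nonneg[of "-1"] by (simp add: power2_eq_1_iff)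
  then show ?thesis using w_mult[of "-1" x] by simp
qed

lemma w_prod: "w (\<Prod>x\<in>A. f x) = (\<Prod>x\<in>A. w (f x))"
  by (induction A rule: infinite_finite_induct) (simp_all add: w_mult)

lemma w_of_nat_le_1: "w (of_nat k) \<le> 1"
  using w_of_rat[of "of_int (int k)"] padic_abs_of_int_le_1[OF prime, of "int k"] by simp

lemma w_sum_le: "w (\<Sum>x\<in>A. f x) \<le> (\<Sum>x\<in>A. w (f x))"
  by (induction A rule: infinite_finite_induct) (auto intro: order_trans[OF w_add])

text \<open>The integers have absolute value at most \<open>1\<close>, so expanding \<open>(x + y) ^ n\<close> costs only a factor
  \<open>n + 1\<close>, which disappears after taking \<open>n\<close>-th roots.\<close>

lemma w_ultrametric: "w (x + y) \<le> max (w x) (w y)"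
proof (rule ccontr)
  define M where "M = max (w x) (w y)"
  assume "\<not> w (x + y) \<le> max (w x) (w y)"
  then have less: "M < w (x + y)" unfolding M_def by linarith
  have M0: "0 \<le> M" using w_nonneg[of x] by (simp add: M_def)
  have pos: "0 < M"
  proof (rule ccontr)
    assume "\<not> 0 < M"
    then have "w x = 0" "w y = 0" using w_nonneg[of x] w_nonneg[of y] unfolding M_def by linarith+
    then show False using less M0 by (simp add: w_eq_0)
  qed
  define t where "t = w (x + y) / M"
  have bound: "t ^ n \<le> real n + 1" for n
  proof -
    have "w (x + y) ^ n = w (\<Sum>k\<le>n. of_nat (n choose k) * x ^ k * y ^ (n - k))"
      by (simp add: binomial_ring flip: w_power)
    also have "\<dots> \<le> (\<Sum>k\<le>n. w (of_nat (n choose k)) * w x ^ k * w y ^ (n - k))"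
      by (rule order_trans[OF w_sum_le]) (simp add: w_mult w_power)
    also have "\<dots> \<le> (\<Sum>k\<le>n. 1 * M ^ k * M ^ (n - k))"
      using max.cobounded1[of "w x" "w y"] max.cobounded2[of "w y" "w x"] M0
      by (intro sum_mono mult_mono power_mono w_of_nat_le_1)
         (auto simp: w_nonneg simp flip: M_def)
    also have "\<dots> = (real n + 1) * M ^ n" by (simp flip: power_add)
    finally show ?thesis using pos by (simp add: t_def power_divide field_simps)
  qed
  have "t \<le> 1" by (rule power_le_linear[OF bound])
  then show False using less pos by (simp add: t_def field_simps)
qed

lemma w_sum_max: "finite A \<Longrightarrow> (\<And>x. x \<in> A \<Longrightarrow> w (f x) \<le> B) \<Longrightarrow> 0 \<le> B \<Longrightarrow> w (\<Sum>x\<in>A. f x) \<le> B"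
  by (induction A rule: finite_induct) (auto intro: order_trans[OF w_ultrametric])

lemma w_diff: "w (x - y) \<le> max (w x) (w y)"
  using w_ultrametric[of x "- y"] by simp

text \<open>The upper half of Gauss's lemma at p: adjoining a root \<open>x\<close> multiplies the
  bound on the coefficients by at most \<open>max 1 (w x)\<close>.\<close>

lemma w_coeff_root_poly: "finite T \<Longrightarrow> w (coeff (root_poly (\<lambda>x. x) T) i) \<le> (\<Prod>x\<in>T. max 1 (w x))"
proof (induction T arbitrary: i rule: finite_induct)
  case empty
  then show ?case by (simp add: root_poly_empty)
next
  case (insert x T)
  let ?B = "\<Prod>x\<in>T. max 1 (w x)"
  have B: "0 \<le> ?B" by (intro prod_nonneg) auto
  let ?q = "root_poly (\<lambda>x. x) T"
  have "w (coeff ([:- x, 1:] * ?q) i) \<le> max (w (if i = 0 then 0 else coeff ?q (i - 1))) (w x * w (coeff ?q i))"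
    unfolding coeff_linear_mult w_mult[symmetric] by (rule w_diff)
  also have "\<dots> \<le> max 1 (w x) * ?B"
  proof (rule max.boundedI)
    have "w (if i = 0 then 0 else coeff ?q (i - 1)) \<le> 1 * ?B" using insert.IH B by simp
    also have "\<dots> \<le> max 1 (w x) * ?B" by (intro mult_right_mono B) simp
    finally show "w (if i = 0 then 0 else coeff ?q (i - 1)) \<le> max 1 (w x) * ?B" .
    show "w x * w (coeff ?q i) \<le> max 1 (w x) * ?B" by (intro mult_mono insert.IH w_nonneg) auto
  qed
  finally show ?case using insert by (simp add: root_poly_insert del: mult_pCons_left)
qed

text \<open>If \<open>w x\<close> exceeded 1, the leading term would strictly dominate all the
  others.\<close>

lemma w_integral:
  assumes "poly P x = 0" "lead_coeff P = 1" "\<And>i. w (coeff P i) \<le> 1"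
  shows "w x \<le> 1"
proof (rule ccontr)
  assume "\<not> w x \<le> 1"
  then have gt: "1 < w x" by simp
  define n where "n = degree P"
  have "P \<noteq> 0" using assms(2) by auto
  then have "n \<noteq> 0" using degree_pos_if_root[of P x] assms(1) by (simp add: n_def)
  then obtain m where m: "n = Suc m" by (cases n) auto
  have "poly P x = x ^ n + (\<Sum>i<n. coeff P i * x ^ i)"
    using assms(2) unfolding poly_altdef n_def[symmetric] by (simp add: n_def flip: lessThan_Suc_atMost)
  then have "x ^ n = - (\<Sum>i<n. coeff P i * x ^ i)" using assms(1) by (simp add: eq_neg_iff_add_eq_0)
  then have "w x ^ n = w (\<Sum>i<n. coeff P i * x ^ i)" by (metis w_minus w_power)
  also have "\<dots> \<le> w x ^ m"
  proof (rule w_sum_max)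
    fix i assume "i \<in> {..<n}"
    then have "w (coeff P i * x ^ i) \<le> 1 * w x ^ i"
      unfolding w_mult w_power by (intro mult_right_mono assms(3)) (simp add: w_nonneg)
    also have "\<dots> \<le> w x ^ m" using gt \<open>i \<in> {..<n}\<close> m by (simp add: power_increasing)
    finally show "w (coeff P i * x ^ i) \<le> w x ^ m" .
  qed (use w_nonneg in auto)
  finally show False using gt m by simp
qed

lemma w_coeff_psi_poly: "w (coeff (psi_poly n) i) \<le> 1"
proof (induction n arbitrary: i)
  case (Suc n)
  have "w (coeff ((psi_poly n)\<^sup>2) i) \<le> 1"
    unfolding power2_eq_square coeff_mult
    by (rule w_sum_max) (auto simp: w_mult intro!: mult_le_one Suc w_nonneg)
  moreover have "w (coeff [:0, 1:] i) \<le> 1" by (auto simp: coeff_pCons split: nat.splits)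
  ultimately show ?case using w_ultrametric[of "coeff ((psi_poly n)\<^sup>2) i" "coeff [:0, 1:] i"] by simp
qed simp

lemma w_psi_poly_root: "poly (psi_poly (Suc n)) x = 0 \<Longrightarrow> w x \<le> 1"
  using w_integral[of "psi_poly (Suc n)" x] degree_psi_poly[of n, where 'a = qbar] w_coeff_psi_poly by blast

lemma w_poly_le_1:
  assumes "w x \<le> 1" "\<And>i. w (coeff P i) \<le> 1"
  shows "w (poly P x) \<le> 1"
  unfolding poly_altdef
  by (rule w_sum_max) (auto simp: w_mult w_power intro!: mult_le_one assms w_nonneg power_le_one zero_le_power)

text \<open>The ultrametric inequality bounds a distance by the larger of two sizes, hence by the
  product of both sizes cut off below at 1. This product separates the variables.\<close>

lemma disc_le_height:
  assumes "finite T"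
  shows "disc (\<lambda>x y. w (x - y)) T \<le> exp (2 * real (card T) * (\<Sum>x\<in>T. log_plus (w x)))"
proof -
  have "w (x - y) \<le> exp (log_plus (w x) + log_plus (w y))" for x y
  proof -
    have "w (x - y) \<le> max (w x) (w y)" by (rule w_diff)
    also have "\<dots> \<le> max (w x) 1 * max (w y) 1"
    proof (rule max.boundedI)
      have "w x * 1 \<le> max (w x) 1 * max (w y) 1" by (intro mult_mono) (auto simp: w_nonneg)
      then show "w x \<le> max (w x) 1 * max (w y) 1" by simp
      have "1 * w y \<le> max (w x) 1 * max (w y) 1" by (intro mult_mono) (auto simp: w_nonneg)
      then show "w y \<le> max (w x) 1 * max (w y) 1" by simp
    qed
    also have "\<dots> = exp (log_plus (w x) + log_plus (w y))"
      by (simp add: log_plus_def exp_add)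
    finally show ?thesis .
  qed
  then have "disc (\<lambda>x y. w (x - y)) T \<le> (\<Prod>x\<in>T. \<Prod>y\<in>T - {x}. exp (log_plus (w x) + log_plus (w y)))"
    unfolding disc_def by (intro prod_mono conjI prod_nonneg ballI) (auto simp: w_nonneg)
  \<comment> \<open>Putting the diagonal back only inserts factors that are at least 1.\<close>
  also have "\<dots> \<le> (\<Prod>x\<in>T. \<Prod>y\<in>T. exp (log_plus (w x) + log_plus (w y)))"
  proof (intro prod_mono conjI prod_nonneg ballI)
    fix x assume "x \<in> T"
    show "(\<Prod>y\<in>T - {x}. exp (log_plus (w x) + log_plus (w y))) \<le> (\<Prod>y\<in>T. exp (log_plus (w x) + log_plus (w y)))"
      using assms by (intro prod_mono2) (auto simp: log_plus_def)
  qed simp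
  also have "\<dots> = exp (\<Sum>x\<in>T. \<Sum>y\<in>T. log_plus (w x) + log_plus (w y))"
    using assms by (simp add: exp_sum)
  also have "(\<Sum>x\<in>T. \<Sum>y\<in>T. log_plus (w x) + log_plus (w y)) = 2 * real (card T) * (\<Sum>x\<in>T. log_plus (w x))"
    by (simp add: sum.distrib sum_distrib_left[symmetric])
  finally show ?thesis .
qed

lemma disc_pos: "finite T \<Longrightarrow> 0 < disc (\<lambda>x y. w (x - y)) T"
  unfolding disc_def by (intro prod_pos) (auto simp: w_eq_0 less_le w_nonneg)

lemma w_prime_less_1: "w (of_nat p) < 1"
proof -
  have "padic_abs p (of_int (int p)) = inverse (real p)"
  proof -
    have "multiplicity (int p) (int p) = 1"
      using prime_gt_1_nat[OF prime] by (intro multiplicity_self) auto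
    then show ?thesis
      using prime_gt_0_nat[OF prime] unfolding padic_abs_of_int by (simp add: power_int_minus)
  qed
  moreover have "1 < real p" using prime prime_gt_1_nat by force
  ultimately show ?thesis using w_of_rat[of "of_int (int p)"] by (simp add: inverse_less_1_iff)
qed

lemma w_of_nat_not_dvd:
  assumes "\<not> p dvd m"
  shows "w (of_nat m) = 1"
proof -
  have "padic_abs p (of_int (int m)) = 1"
    using assms unfolding padic_abs_of_int by (cases "m = 0") (auto simp: not_dvd_imp_multiplicity_0)
  then show ?thesis using w_of_rat[of "of_int (int m)"] by simp
qed

text \<open>The derivative m * x^(m - 1) of x^m - 1 has absolute value 1 at each root, because p
  does not divide m.\<close>

lemma disc_roots_of_unity:
  assumes m: "\<not> p dvd m"
  defines "T \<equiv> {x :: qbar. x ^ m = 1}"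
  shows "finite T" "card T = m" "\<And>x. x \<in> T \<Longrightarrow> w x = 1" "disc (\<lambda>x y. w (x - y)) T = 1"
proof -
  have m0: "m \<noteq> 0" using m by (cases m) auto
  define P where "P = monom 1 m - (1 :: qbar poly)"
  have T: "T = {x. poly P x = 0}" by (simp add: T_def P_def poly_monom)
  have "degree (monom 1 m + (- 1 :: qbar poly)) = m"
    using m0 by (subst degree_add_eq_left) (simp_all add: degree_monom_eq)
  then have deg: "degree P = m" by (simp add: P_def)
  have lead: "lead_coeff P = 1" unfolding deg using m0 by (simp add: P_def)
  show w1: "w x = 1" if "x \<in> T" for x
  proof -
    have "w x ^ m = 1 ^ m" using that w_power[of x m] by (simp add: T_def)
    then show ?thesis using power_eq_imp_eq_base[of "w x" m 1] w_nonneg[of x] m0 by simp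
  qed
  have der: "poly (pderiv P) x = of_nat m * x ^ (m - 1)" for x
    by (simp add: P_def pderiv_diff pderiv_monom poly_monom)
  have simple: "poly (pderiv P) a \<noteq> 0" if "poly P a = 0" for a
  proof -
    have "a ^ m = 1" using that by (simp add: P_def poly_monom)
    then have "a \<noteq> 0" using m0 by (auto simp: power_0_left)
    then show ?thesis using m0 by (simp add: der)
  qed
  show fin: "finite T" unfolding T using lead by (intro poly_roots_finite) auto
  show "card T = m" using split_simple_roots(2)[OF lead simple] deg T by simp
  have "P = root_poly (\<lambda>x. x) T" using split_simple_roots(1)[OF lead simple] T by simp
  then have "w (\<Prod>y\<in>T - {x}. x - y) = 1" if "x \<in> T" for x
    using pderiv_root_poly[OF fin that] der[of x] w1[OF that] w_of_nat_not_dvd[OF m]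
    by (simp add: w_mult w_power)
  then show "disc (\<lambda>x y. w (x - y)) T = 1" by (simp add: disc_def w_prod)
qed

text \<open>These points give the lower bound for the transfinite diameter of the p-adic unit disc.
  Take roots of unity of order pn + 1, which is prime to p and at least n: their distances are at
  most 1 and multiply to 1, so each equals 1.\<close>

lemma ex_unit_points:
  "\<exists>T. finite T \<and> card T = n \<and> (\<forall>x\<in>T. w x = 1) \<and> (\<forall>x\<in>T. \<forall>y\<in>T. x \<noteq> y \<longrightarrow> w (x - y) = 1)"
proof -
  let ?T = "{x :: qbar. x ^ (p * n + 1) = 1}"
  have "\<not> p dvd p * n + 1" using prime_gt_1_nat[OF prime] dvd_add_right_iff[of p "p * n" 1] by simp
  note T = disc_roots_of_unity[OF this]
  have le: "w (x - y) \<le> 1" if "x \<in> ?T" "y \<in> ?T" for x y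
    using w_diff[of x y] T(3)[OF that(1)] T(3)[OF that(2)] by simp
  have one: "w (x - y) = 1" if xy: "x \<in> ?T" "y \<in> ?T" "x \<noteq> y" for x y
  proof -
    let ?g = "\<lambda>x. \<Prod>y\<in>?T - {x}. w (x - y)"
    have g: "0 \<le> ?g z" "?g z \<le> 1" if "z \<in> ?T" for z
      using le that by (auto intro!: prod_nonneg prod_le_1 simp: w_nonneg)
    have "disc (\<lambda>x y. w (x - y)) ?T = w (x - y) * (\<Prod>y\<in>?T - {x} - {y}. w (x - y)) * (\<Prod>x\<in>?T - {x}. ?g x)"
      unfolding disc_def using T(1) xy by (subst prod.remove[of _ x], simp_all) (subst prod.remove[of _ y], simp_all)
    also have "\<dots> \<le> w (x - y) * 1 * 1"
      using g xy le by (intro mult_mono prod_le_1) (auto intro!: prod_nonneg mult_nonneg_nonneg simp: w_nonneg)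
    finally show ?thesis using T(4) le[OF xy(1,2)] by simp
  qed
  have "n \<le> card ?T" unfolding T(2) using prime_gt_0_nat[OF prime] by (simp add: le_SucI)
  then obtain T' where "T' \<subseteq> ?T" "card T' = n" "finite T'" by (rule obtain_subset_with_card_n)
  then show ?thesis using T(3) one by blast
qed

end

section \<open>Local and global heights\<close>

locale ring_embedding =
  fixes g :: "'a :: field_char_0 \<Rightarrow> 'b :: field_char_0"
  assumes add: "g (x + y) = g x + g y" and mult: "g (x * y) = g x * g y" and one [simp]: "g 1 = 1"
begin

lemma zero [simp]: "g 0 = 0"
  using add[of 0 0] by (metis add.right_neutral add_left_cancel)

lemma diff: "g (x - y) = g x - g y"
  using add[of "x - y" y] by simp

lemma minus: "g (- x) = - g x"
  using diff[of 0 x] by simp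

lemma prod: "g (\<Prod>x\<in>A. f x) = (\<Prod>x\<in>A. g (f x))"
  by (induction A rule: infinite_finite_induct) (simp_all add: mult)

lemma eq_0_iff [simp]: "g x = 0 \<longleftrightarrow> x = 0"
proof
  assume "g x = 0"
  show "x = 0"
  proof (rule ccontr)
    assume "x \<noteq> 0"
    then have "g (x * inverse x) = 1" by simp
    then show False using \<open>g x = 0\<close> unfolding mult by simp
  qed
qed simp

lemma inj: "inj_on g A"
proof (rule inj_onI)
  fix x y assume "g x = g y"
  then have "g (x - y) = 0" by (simp only: diff) simp
  then show "x = y" by simp
qed

lemma of_nat: "g (of_nat n) = of_nat n"
  by (induction n) (simp_all add: add)

lemma of_int: "g (of_int k) = of_int k"
  by (cases k rule: int_cases2) (simp_all add: of_nat minus)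

lemma of_rat: "g (of_rat r) = of_rat r"
proof -
  obtain a b where r: "quotient_of r = (a, b)" by fastforce
  have b: "b \<noteq> 0" using quotient_of_denom_pos[OF r] by simp
  have "g (of_rat r) * g (of_int b) = g (of_int a)"
    unfolding mult[symmetric] using b by (simp add: quotient_of_div[OF r] of_rat_divide)
  then have "g (of_rat r) = of_int a / of_int b" using b by (simp add: of_int field_simps)
  then show ?thesis by (simp add: quotient_of_div[OF r] of_rat_divide)
qed

lemma poly_psi_poly_hom: "g (poly (psi_poly n) x) = poly (psi_poly n) (g x)"
  by (induction n) (simp_all add: add mult power2_eq_square)

end

lemma ring_isoD:
  assumes "\<sigma> \<in> ring_iso Qbar Qbar"
  shows "ring_embedding \<sigma>"
  using assms by unfold_locales (auto simp: ring_iso_def ring_hom_def ring_of_type_algebra_def)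

lemma prod_reindex_pairs:
  assumes "inj_on f T"
  shows "(\<Prod>x\<in>f ` T. \<Prod>y\<in>f ` T - {x}. d x y) = (\<Prod>x\<in>T. \<Prod>y\<in>T - {x}. d (f x) (f y))"
proof -
  have "(\<Prod>y\<in>f ` T - {f x}. d (f x) y) = (\<Prod>y\<in>T - {x}. d (f x) (f y))" if "x \<in> T" for x
  proof -
    have "f ` T - {f x} = f ` (T - {x})" using assms that by (auto simp: inj_on_def)
    moreover have "inj_on f (T - {x})" using assms by (rule inj_on_subset) auto
    ultimately show ?thesis by (simp add: prod.reindex)
  qed
  then show ?thesis using assms by (simp add: prod.reindex)
qed

lemma disc_image: "inj_on f T \<Longrightarrow> disc d (f ` T) = disc (\<lambda>x y. d (f x) (f y)) T"
  unfolding disc_def by (rule prod_reindex_pairs)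

text \<open>An automorphism permutes the roots and so fixes the coefficients.\<close>

lemma galois_stable_coeff_root_poly:
  assumes "finite T" "galois_stable T"
  shows "coeff (root_poly (\<lambda>x. x) T) i \<in> \<rat>"
proof (rule Rats_if_fixed)
  fix \<sigma> assume \<sigma>: "\<sigma> \<in> ring_iso Qbar Qbar"
  interpret ring_embedding \<sigma> using \<sigma> by (rule ring_isoD)
  have "\<sigma> (coeff (root_poly (\<lambda>x. x) T) i) = coeff (root_poly \<sigma> T) i"
    by (rule coeff_root_poly_hom) (simp_all add: assms add mult)
  also have "root_poly \<sigma> T = root_poly (\<lambda>x. x) (\<sigma> ` T)"
    by (simp add: root_poly_def prod.reindex inj)
  also have "\<sigma> ` T = T" using assms(2) \<sigma> by (simp add: galois_stable_def)
  finally show "\<sigma> (coeff (root_poly (\<lambda>x. x) T) i) = coeff (root_poly (\<lambda>x. x) T) i" .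
qed

lemma galois_stable_discriminant:
  assumes "galois_stable T"
  shows "(\<Prod>x\<in>T. \<Prod>y\<in>T - {x}. x - y) \<in> \<rat>"
proof (rule Rats_if_fixed)
  fix \<sigma> assume \<sigma>: "\<sigma> \<in> ring_iso Qbar Qbar"
  interpret ring_embedding \<sigma> using \<sigma> by (rule ring_isoD)
  have "\<sigma> (\<Prod>x\<in>T. \<Prod>y\<in>T - {x}. x - y) = (\<Prod>x\<in>T. \<Prod>y\<in>T - {x}. \<sigma> x - \<sigma> y)"
    by (simp add: prod diff)
  also have "\<dots> = (\<Prod>x\<in>\<sigma> ` T. \<Prod>y\<in>\<sigma> ` T - {x}. x - y)"
    by (rule prod_reindex_pairs[symmetric]) (rule inj)
  also have "\<sigma> ` T = T" using assms \<sigma> by (simp add: galois_stable_def)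
  finally show "\<sigma> (\<Prod>x\<in>T. \<Prod>y\<in>T - {x}. x - y) = (\<Prod>x\<in>T. \<Prod>y\<in>T - {x}. x - y)" .
qed

text \<open>Parameters for which the critical point 0 is periodic with period dividing
  \<open>n + 1\<close>.\<close>

definition hyperbolic_centers :: "nat \<Rightarrow> qbar set" where
  "hyperbolic_centers n = {x. poly (psi_poly (Suc n)) x = 0}"

lemma finite_hyperbolic_centers: "finite (hyperbolic_centers n)"
proof -
  have "psi_poly (Suc n) \<noteq> (0 :: qbar poly)"
    using degree_psi_poly[of n, where 'a = qbar] by (metis leading_coeff_0_iff zero_neq_one)
  then show ?thesis unfolding hyperbolic_centers_def by (rule poly_roots_finite)
qed

lemma galois_stable_hyperbolic_centers: "galois_stable (hyperbolic_centers n)"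
  unfolding galois_stable_def
proof
  fix \<sigma> assume "\<sigma> \<in> ring_iso Qbar Qbar"
  then interpret ring_embedding \<sigma> by (rule ring_isoD)
  have "\<sigma> ` hyperbolic_centers n \<subseteq> hyperbolic_centers n"
    by (auto simp: hyperbolic_centers_def simp flip: poly_psi_poly_hom simp del: psi_poly.simps)
  then show "\<sigma> ` hyperbolic_centers n = hyperbolic_centers n"
    using endo_inj_surj[OF finite_hyperbolic_centers] inj by blast
qed

lemma psi_funpow: "psi (m + n) c = ((\<lambda>z. z\<^sup>2 + c) ^^ m) (psi n c)"
  by (simp add: psi_def funpow_add)

lemma psi_eq_0_mandelbrot:
  assumes "psi (Suc m) c = 0"
  shows "c \<in> mandelbrot"
proof -
  have per: "psi (k + Suc m) c = psi k c" for k
    using psi_funpow[of k "Suc m" c] assms by (simp add: psi_def)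
  have "psi (k + q * Suc m) c = psi k c" for k q
  proof (induction q)
    case (Suc q)
    have "psi (k + Suc q * Suc m) c = psi ((k + q * Suc m) + Suc m) c" by (simp add: algebra_simps)
    then show ?case using per[of "k + q * Suc m"] Suc by simp
  qed simp
  from this[of "n mod Suc m" "n div Suc m" for n] have "psi n c = psi (n mod Suc m) c" for n
    by (simp only: mod_div_mult_eq)
  moreover have "n mod Suc m \<in> {..m}" for n by (simp add: less_Suc_eq_le[symmetric])
  ultimately have "range (\<lambda>n. psi n c) \<subseteq> (\<lambda>n. psi n c) ` {..m}" by blast
  then have "finite (range (\<lambda>n. psi n c))" by (rule finite_subset) simp
  then show ?thesis by (simp add: mandelbrot_def finite_imp_bounded)
qed

text \<open>Gleason's 2-adic argument. The derivative of psi^2 + c with respect to c is 1 + 2 * psi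
  * psi'. Roots of the monic integral \<open>psi_poly\<close> are 2-adically integral, so there the
  second summand has absolute value below 1 and cannot cancel 1: all roots are simple.\<close>

lemma card_hyperbolic_centers:
  assumes "padic_extension 2 w"
  shows "card (hyperbolic_centers n) = 2 ^ n"
proof -
  interpret padic_extension 2 w by (rule assms)
  let ?p = "psi_poly n :: qbar poly"
  have "poly (pderiv (psi_poly (Suc n))) a \<noteq> 0" if a: "poly (psi_poly (Suc n)) a = 0" for a :: qbar
  proof
    assume "poly (pderiv (psi_poly (Suc n))) a = 0"
    then have "1 + of_nat 2 * poly (?p * pderiv ?p) a = 0"
      by (simp add: pderiv_add pderiv_mult power2_eq_square pderiv_pCons algebra_simps)
    then have eq: "- 1 = of_nat 2 * poly (?p * pderiv ?p) a" by (rule minus_unique)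
    have le: "w a \<le> 1" using a by (rule w_psi_poly_root)
    have "w (coeff (pderiv ?p) i) \<le> 1" for i
      unfolding coeff_pderiv w_mult by (intro mult_le_one w_of_nat_le_1 w_coeff_psi_poly w_nonneg)
    then have "w (poly (pderiv ?p) a) \<le> 1" by (intro w_poly_le_1 le)
    moreover have "w (poly ?p a) \<le> 1" by (intro w_poly_le_1 le w_coeff_psi_poly)
    ultimately have "w (poly (?p * pderiv ?p) a) \<le> 1"
      by (simp add: w_mult mult_le_one w_nonneg)
    then have "w (of_nat 2) * w (poly (?p * pderiv ?p) a) \<le> w (of_nat 2) * 1"
      by (intro mult_left_mono w_nonneg)
    moreover have "1 = w (of_nat 2) * w (poly (?p * pderiv ?p) a)"
      using arg_cong[OF eq, of w] by (simp only: w_mult w_minus w_1)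
    ultimately show False using w_prime_less_1 by simp
  qed
  then show ?thesis
    using split_simple_roots(2)[of "psi_poly (Suc n) :: qbar poly"] degree_psi_poly[of n, where 'a = qbar]
    unfolding hyperbolic_centers_def by metis
qed

lemma norm_of_rat_complex: "cmod (of_rat r) = \<bar>real_of_rat r\<bar>"
  by (cases r) (simp add: Fract_of_int_quotient of_rat_divide norm_divide abs_divide)

section \<open>Heights and discriminants at all places together\<close>

locale adelic = iota: ring_embedding \<iota>
  for \<iota> :: "qbar \<Rightarrow> complex" +
  fixes w :: "nat \<Rightarrow> qbar \<Rightarrow> real"
  assumes padic: "prime p \<Longrightarrow> padic_extension p (w p)"
begin

definition local_height :: "nat \<Rightarrow> qbar set \<Rightarrow> real" where
  "local_height p T = (\<Sum>x\<in>T. log_plus (w p x))"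

definition inf_height :: "qbar set \<Rightarrow> real" where
  "inf_height T = (\<Sum>x\<in>T. lambda_inf (\<iota> x))"

definition total_height :: "qbar set \<Rightarrow> real" where
  "total_height T = (\<Sum>x\<in>T. lambda_inf (\<iota> x) + (\<Sum>\<^sub>\<infinity>p\<in>{p. prime p}. log_plus (w p x)))"

abbreviation disc_inf :: "qbar set \<Rightarrow> real" where
  "disc_inf T \<equiv> disc (\<lambda>x y. cmod (\<iota> x - \<iota> y)) T"

abbreviation disc_p :: "nat \<Rightarrow> qbar set \<Rightarrow> real" where
  "disc_p p T \<equiv> disc (\<lambda>x y. w p (x - y)) T"

lemma local_height_nonneg: "0 \<le> local_height p T"
  unfolding local_height_def by (intro sum_nonneg) (simp add: log_plus_def)

lemma inf_height_nonneg: "0 \<le> inf_height T"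
  unfolding inf_height_def by (intro sum_nonneg lambda_inf_nonneg)

text \<open>Beyond \<open>F\<close> every point of \<open>T\<close> is integral, so the infinite sum
  over the primes reduces to \<open>F\<close>. Further primes may be included, which lets one
  \<open>F\<close> serve for heights and discriminants at once.\<close>

definition supports :: "nat set \<Rightarrow> qbar set \<Rightarrow> bool" where
  "supports F T \<longleftrightarrow> finite F \<and> (\<forall>p\<in>F. prime p) \<and> (\<forall>p. prime p \<longrightarrow> (\<exists>x\<in>T. 1 < w p x) \<longrightarrow> p \<in> F)"

lemma w_of_rat: "prime p \<Longrightarrow> w p (of_rat r) = padic_abs p r"
  using padic padic_extension.w_of_rat by blast

text \<open>Where all coefficients of the monic polynomial with roots \<open>T\<close> are integral,
  so are the points of \<open>T\<close>. The coefficients are rational, so only finitely many primes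
  fail. Through \<open>E\<close> later proofs force in the primes they need.\<close>

lemma ex_supports:
  assumes T: "finite T" "galois_stable T" and E: "finite E" "\<And>p. p \<in> E \<Longrightarrow> prime p"
  shows "\<exists>F. supports F T \<and> E \<subseteq> F"
proof -
  let ?P = "root_poly (\<lambda>x. x) T"
  have fin: "finite {p. prime p \<and> 1 < w p (coeff ?P i)}" for i
  proof -
    obtain r where r: "coeff ?P i = of_rat r"
      using galois_stable_coeff_root_poly[OF T, of i] by (auto elim: Rats_cases)
    show ?thesis
    proof (cases "r = 0")
      case True
      have "w p 0 = 0" if "prime p" for p using padic[OF that] padic_extension.w_0 by blast
      then have "{p. prime p \<and> 1 < w p (coeff ?P i)} = {}" using r True by auto
      then show ?thesis by (simp only: finite.emptyI)
    next
      case False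
      have "{p. prime p \<and> 1 < w p (coeff ?P i)} \<subseteq> {p. prime p \<and> padic_abs p r \<noteq> 1}"
        using r w_of_rat by auto
      then show ?thesis using finite_padic_abs_ne_1[OF False] by (rule finite_subset)
    qed
  qed
  define B where "B = (\<Union>i\<in>{..card T}. {p. prime p \<and> 1 < w p (coeff ?P i)})"
  have "w p x \<le> 1" if p: "prime p" "p \<notin> B" and x: "x \<in> T" for p x
  proof -
    interpret padic_extension p "w p" using p(1) by (rule padic)
    show ?thesis
    proof (rule w_integral)
      show "poly ?P x = 0" using T(1) x by (auto simp: poly_root_poly)
      show "lead_coeff ?P = 1" by (rule lead_coeff_root_poly)
      show "w p (coeff ?P i) \<le> 1" for i
      proof (cases "i \<le> card T")
        case True
        then show ?thesis using p by (auto simp: B_def not_less)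
      next
        case False
        then show ?thesis using T(1) by (simp add: coeff_eq_0 degree_root_poly)
      qed
    qed
  qed
  note le_1 = this
  have "supports (B \<union> E) T"
    unfolding supports_def
  proof (intro conjI ballI allI impI)
    show "finite (B \<union> E)" using fin E(1) by (simp add: B_def)
    show "prime p" if "p \<in> B \<union> E" for p using that E(2) by (auto simp: B_def)
    show "p \<in> B \<union> E" if "prime p" "\<exists>x\<in>T. 1 < w p x" for p
    proof (rule ccontr)
      assume "p \<notin> B \<union> E"
      moreover from that obtain x where "x \<in> T" "1 < w p x" by blast
      ultimately show False using le_1[of p x] that(1) by simp
    qed
  qed
  then show ?thesis by blast
qed

lemma total_height_eq:
  assumes F: "supports F T"
  shows "total_height T = inf_height T + (\<Sum>p\<in>F. local_height p T)"
proof -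
  have "(\<Sum>\<^sub>\<infinity>p\<in>{p. prime p}. log_plus (w p x)) = (\<Sum>p\<in>F. log_plus (w p x))" if x: "x \<in> T" for x
  proof -
    have "(\<Sum>\<^sub>\<infinity>p\<in>{p. prime p}. log_plus (w p x)) = (\<Sum>\<^sub>\<infinity>p\<in>F. log_plus (w p x))"
    proof (rule infsum_cong_neutral)
      fix p assume "p \<in> {p. prime p} - F"
      then have "w p x \<le> 1" using F x by (auto simp: supports_def not_less[symmetric])
      then show "log_plus (w p x) = 0" by (simp add: log_plus_def max_def)
    qed (use F in \<open>auto simp: supports_def\<close>)
    then show ?thesis using F by (simp add: supports_def)
  qed
  then have "total_height T = (\<Sum>x\<in>T. lambda_inf (\<iota> x) + (\<Sum>p\<in>F. log_plus (w p x)))"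
    unfolding total_height_def by simp
  also have "\<dots> = inf_height T + (\<Sum>p\<in>F. local_height p T)"
    unfolding sum.distrib inf_height_def local_height_def by (simp add: sum.swap[of _ T F])
  finally show ?thesis .
qed

lemma local_heights_le_total:
  assumes T: "finite T" "galois_stable T"
  shows "inf_height T \<le> total_height T" "prime p \<Longrightarrow> local_height p T \<le> total_height T"
    "0 \<le> total_height T"
proof -
  obtain F where "supports F T" using ex_supports[OF T, of "{}"] by auto
  then have eq: "total_height T = inf_height T + (\<Sum>p\<in>F. local_height p T)" by (rule total_height_eq)
  have "0 \<le> (\<Sum>p\<in>F. local_height p T)" by (intro sum_nonneg local_height_nonneg)
  then show "inf_height T \<le> total_height T" "0 \<le> total_height T" using eq inf_height_nonneg[of T] by linarith+
  assume p: "prime p"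
  then obtain F where F: "supports F T" "p \<in> F" using ex_supports[OF T, of "{p}"] by auto
  have "local_height p T \<le> (\<Sum>p\<in>F. local_height p T)"
    using F by (intro member_le_sum local_height_nonneg) (auto simp: supports_def)
  then show "local_height p T \<le> total_height T"
    using total_height_eq[OF F(1)] inf_height_nonneg[of T] by linarith
qed

lemma disc_product_formula:
  assumes T: "finite T" "galois_stable T" and E: "finite E" "\<And>p. p \<in> E \<Longrightarrow> prime p"
  obtains F where "supports F T" "E \<subseteq> F" "disc_inf T * (\<Prod>p\<in>F. disc_p p T) = 1"
proof -
  define D where "D = (\<Prod>x\<in>T. \<Prod>y\<in>T - {x}. x - y)"
  obtain r where r: "D = of_rat r"
    using galois_stable_discriminant[OF T(2)] by (auto simp: D_def elim: Rats_cases)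
  have "D \<noteq> 0" using T(1) by (simp add: D_def)
  then have r0: "r \<noteq> 0" using r by auto
  let ?E = "E \<union> {p. prime p \<and> padic_abs p r \<noteq> 1}"
  have "finite ?E" using E(1) finite_padic_abs_ne_1[OF r0] by simp
  moreover have "prime p" if "p \<in> ?E" for p using that E(2) by blast
  ultimately obtain F where F: "supports F T" "?E \<subseteq> F" using ex_supports[OF T, of ?E] by blast
  have "disc_inf T = cmod (\<iota> D)"
    by (simp add: disc_def D_def iota.prod iota.diff prod_norm)
  also have "\<dots> = \<bar>real_of_rat r\<bar>" unfolding r iota.of_rat by (rule norm_of_rat_complex)
  finally have "disc_inf T = \<bar>real_of_rat r\<bar>" .
  moreover have "disc_p p T = padic_abs p r" if "p \<in> F" for p
  proof -
    have p: "prime p" using that F by (auto simp: supports_def)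
    interpret padic_extension p "w p" using p by (rule padic)
    have "disc_p p T = w p D" by (simp add: disc_def D_def w_prod)
    then show ?thesis by (simp add: r w_of_rat)
  qed
  moreover have "\<bar>real_of_rat r\<bar> * (\<Prod>p\<in>F. padic_abs p r) = 1"
    using F r0 by (intro product_formula) (auto simp: supports_def)
  ultimately have "disc_inf T * (\<Prod>p\<in>F. disc_p p T) = 1" by simp
  then show ?thesis using that F by blast
qed

lemma disc_inf_image: "disc (\<lambda>x y. cmod (x - y)) (\<iota> ` T) = disc_inf T"
  by (rule disc_image) (rule iota.inj)

text \<open>\<open>B\<close> is the sum of the upper bounds for the logarithms at all places of a
  support. As the logarithms sum to 0, the lower bound at one place is minus the upper bounds of the
  others, so the same \<open>B\<close> works in both directions and at every place.\<close>

lemma disc_estimates: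
  assumes T: "finite T" "galois_stable T" "0 < card T"
  defines "B \<equiv> real (card T) * (4 * ln (real (card T)) + 2 * total_height T)"
  shows "0 < disc_inf T" "\<bar>ln (disc_inf T)\<bar> \<le> B"
    and "prime p \<Longrightarrow> 0 < disc_p p T" "prime p \<Longrightarrow> \<bar>ln (disc_p p T)\<bar> \<le> B"
proof -
  let ?N = "real (card T)"
  have ln0: "0 \<le> ln ?N" using T(3) by simp
  show inf_pos: "0 < disc_inf T"
    unfolding disc_def by (intro prod_pos) (use iota.inj in \<open>auto simp: inj_on_def\<close>)
  have p_pos: "0 < disc_p p T" if "prime p" for p
    using padic_extension.disc_pos[OF padic[OF that] T(1)] .
  then show "prime p \<Longrightarrow> 0 < disc_p p T" .
  have "disc_inf T \<le> exp (?N * (4 * ln ?N + 2 * inf_height T))"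
    using ln_disc_le[of "\<iota> ` T"] T
    by (simp add: disc_inf_image card_image iota.inj inf_height_def sum.reindex)
  then have inf_le: "ln (disc_inf T) \<le> ?N * (4 * ln ?N + 2 * inf_height T)"
    using inf_pos by (metis ln_exp ln_le_cancel_iff exp_gt_zero)
  have p_le: "ln (disc_p p T) \<le> 2 * ?N * local_height p T" if "prime p" for p
  proof -
    have "disc_p p T \<le> exp (2 * ?N * local_height p T)"
      using padic_extension.disc_le_height[OF padic[OF that] T(1)] by (simp add: local_height_def)
    then show ?thesis using p_pos[OF that] by (metis ln_exp ln_le_cancel_iff exp_gt_zero)
  qed
  have sum_eq: "ln (disc_inf T) + (\<Sum>q\<in>F. ln (disc_p q T)) = 0"
    if F: "supports F T" "disc_inf T * (\<Prod>q\<in>F. disc_p q T) = 1" for F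
  proof -
    have pos: "0 < disc_p q T" if "q \<in> F" for q using that F p_pos by (auto simp: supports_def)
    have "0 = ln (disc_inf T * (\<Prod>q\<in>F. disc_p q T))" using F(2) by simp
    also have "\<dots> = ln (disc_inf T) + ln (\<Prod>q\<in>F. disc_p q T)"
      using inf_pos prod_pos[of F "\<lambda>q. disc_p q T"] pos by (simp add: ln_mult)
    also have "ln (\<Prod>q\<in>F. disc_p q T) = (\<Sum>q\<in>F. ln (disc_p q T))"
    proof (rule ln_prod)
      fix q assume "q \<in> F"
      from pos[OF this] show "disc_p q T \<noteq> 0" by simp
    qed (use F in \<open>simp add: supports_def\<close>)
    finally show ?thesis by simp
  qed
  have B: "B = ?N * (4 * ln ?N + 2 * inf_height T) + (\<Sum>q\<in>F. 2 * ?N * local_height q T)"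
    if "supports F T" for F
    by (simp add: B_def total_height_eq[OF that] sum_distrib_left algebra_simps)
  have nonneg: "0 \<le> ?N * (4 * ln ?N + 2 * inf_height T)" using ln0 inf_height_nonneg by simp
  have nonneg': "0 \<le> (\<Sum>q\<in>A. 2 * ?N * local_height q T)" for A
    by (intro sum_nonneg) (simp add: local_height_nonneg)
  obtain F where F: "supports F T" "disc_inf T * (\<Prod>q\<in>F. disc_p q T) = 1"
    using disc_product_formula[OF T(1,2), of "{}"] by auto
  have "(\<Sum>q\<in>F. ln (disc_p q T)) \<le> (\<Sum>q\<in>F. 2 * ?N * local_height q T)"
    using F by (intro sum_mono p_le) (auto simp: supports_def)
  then show "\<bar>ln (disc_inf T)\<bar> \<le> B"
    using sum_eq[OF F] B[OF F(1)] inf_le nonneg nonneg'[of F] by linarith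
  assume p: "prime p"
  obtain F where F: "supports F T" "{p} \<subseteq> F" "disc_inf T * (\<Prod>q\<in>F. disc_p q T) = 1"
    using disc_product_formula[OF T(1,2), of "{p}"] p by auto
  then have fin: "finite F" "p \<in> F" by (auto simp: supports_def)
  have "(\<Sum>q\<in>F - {p}. ln (disc_p q T)) \<le> (\<Sum>q\<in>F - {p}. 2 * ?N * local_height q T)"
    using F by (intro sum_mono p_le) (auto simp: supports_def)
  moreover have "0 \<le> 2 * ?N * local_height p T" by (simp add: local_height_nonneg)
  ultimately show "\<bar>ln (disc_p p T)\<bar> \<le> B"
    using sum_eq[OF F(1,3)] B[OF F(1)] inf_le p_le[OF p] nonneg nonneg'[of "F - {p}"]
      sum.remove[OF fin, of "\<lambda>q. ln (disc_p q T)"] sum.remove[OF fin, of "\<lambda>q. 2 * ?N * local_height q T"]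
    by linarith
qed

text \<open>The centers are integral at every prime, so every p-adic discriminant is at most 1 and
  the archimedean one has to compensate.\<close>

lemma disc_hyperbolic_centers: "1 \<le> disc_inf (hyperbolic_centers n)"
proof -
  let ?T = "hyperbolic_centers n"
  obtain F where F: "supports F ?T" "disc_inf ?T * (\<Prod>p\<in>F. disc_p p ?T) = 1"
    using disc_product_formula[OF finite_hyperbolic_centers galois_stable_hyperbolic_centers, of "{}"] by auto
  have le: "0 \<le> disc_p p ?T \<and> disc_p p ?T \<le> 1" if "p \<in> F" for p
  proof -
    have p: "prime p" using that F by (auto simp: supports_def)
    interpret padic_extension p "w p" using p by (rule padic)
    have "(\<Sum>x\<in>?T. log_plus (w p x)) = 0"
      by (intro sum.neutral ballI)
         (use w_psi_poly_root in \<open>force simp: hyperbolic_centers_def log_plus_def max_def simp del: psi_poly.simps\<close>)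
    then show ?thesis
      using disc_le_height[OF finite_hyperbolic_centers, of n] disc_pos[OF finite_hyperbolic_centers, of n] by simp
  qed
  then have "(\<Prod>p\<in>F. disc_p p ?T) \<le> 1" by (intro prod_le_1) auto
  moreover have "0 \<le> disc_inf ?T" by (simp add: disc_def prod_nonneg)
  ultimately have "disc_inf ?T * (\<Prod>p\<in>F. disc_p p ?T) \<le> disc_inf ?T * 1" by (intro mult_left_mono)
  then show ?thesis using F(2) by simp
qed

lemma transfinite_diameter_mandelbrot_eq_1:
  "transfinite_diameter (\<lambda>x y. cmod (x - y)) mandelbrot = 1"
proof (rule transfinite_diameter_mandelbrot)
  fix n
  let ?T = "\<iota> ` hyperbolic_centers n"
  have "?T \<subseteq> mandelbrot"
  proof
    fix c assume "c \<in> ?T"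
    then obtain x where x: "poly (psi_poly (Suc n)) x = 0" "c = \<iota> x"
      by (auto simp: hyperbolic_centers_def simp del: psi_poly.simps)
    then have "psi (Suc n) c = 0"
      using iota.poly_psi_poly_hom[of "Suc n" x] by (simp add: poly_psi_poly del: psi_poly.simps)
    then show "c \<in> mandelbrot" by (rule psi_eq_0_mandelbrot)
  qed
  \<comment> \<open>The place 2 enters here to count the centers: there are 2^n of them.\<close>
  moreover have "n \<le> card ?T"
    using card_hyperbolic_centers[OF padic[of 2], of n]
    by (simp add: card_image iota.inj less_imp_le)
  ultimately show "\<exists>T\<subseteq>mandelbrot. finite T \<and> n \<le> card T \<and> 1 \<le> disc (\<lambda>x y. cmod (x - y)) T"
    using finite_hyperbolic_centers[of n] disc_hyperbolic_centers[of n]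
    by (intro exI[of _ ?T]) (simp add: disc_inf_image)
qed

text \<open>By the Gauss bound, the power of p in the denominator of a coefficient is at most the
  exponential of the local height at p; multiplying over p bounds the whole denominator. The
  archimedean size is bounded through \<open>norm_le_lambda_inf\<close>.\<close>

lemma coeff_bounds:
  assumes T: "finite T" "galois_stable T" and H: "total_height T \<le> B" and N: "card T \<le> N"
    and r: "coeff (root_poly (\<lambda>x. x) T) i = of_rat r"
  shows "of_int (snd (quotient_of r)) \<le> exp B" "\<bar>real_of_rat r\<bar> \<le> 3 ^ N * exp B"
proof -
  obtain a b where ab: "quotient_of r = (a, b)" by fastforce
  have b: "b > 0" using quotient_of_denom_pos[OF ab] .
  have "finite {p. prime p \<and> int p dvd b}"
    by (rule finite_subset[OF _ finite_prime_divisors[of b]]) (use b in auto)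
  moreover have "prime p" if "p \<in> {p. prime p \<and> int p dvd b}" for p using that by simp
  ultimately obtain F where F: "supports F T" "{p. prime p \<and> int p dvd b} \<subseteq> F"
    using ex_supports[OF T, of "{p. prime p \<and> int p dvd b}"] by blast
  have "(\<Prod>p\<in>F. int p ^ multiplicity (int p) b) = \<bar>b\<bar>"
  proof (rule prod_int_prime_powers)
    show "b \<noteq> 0" using b by simp
    show "finite F" "\<And>p. p \<in> F \<Longrightarrow> prime p" using F(1) by (simp_all add: supports_def)
    show "p \<in> F" if "prime p" "int p dvd b" for p using F(2) that by blast
  qed
  then have "real_of_int b = real_of_int (\<Prod>p\<in>F. int p ^ multiplicity (int p) b)" using b by simp
  also have "\<dots> = (\<Prod>p\<in>F. real p ^ multiplicity (int p) b)" by simp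
  also have "\<dots> \<le> (\<Prod>p\<in>F. exp (local_height p T))"
  proof (intro prod_mono conjI)
    fix p assume "p \<in> F"
    then have p: "prime p" using F by (auto simp: supports_def)
    interpret padic_extension p "w p" using p by (rule padic)
    have "real p ^ multiplicity (int p) b \<le> max 1 (w p (of_rat r))"
      unfolding w_of_rat by (rule padic_abs_denominator[OF ab p])
    also have "\<dots> \<le> (\<Prod>x\<in>T. max 1 (w p x))"
      using w_coeff_root_poly[OF T(1), of i] r by (auto intro!: prod_ge_1)
    also have "\<dots> = exp (local_height p T)"
      using T(1) by (simp add: local_height_def exp_sum log_plus_def max.commute)
    finally show "real p ^ multiplicity (int p) b \<le> exp (local_height p T)" .
  qed simp
  also have "\<dots> = exp (\<Sum>p\<in>F. local_height p T)" using F by (simp add: exp_sum supports_def)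
  also have "\<dots> \<le> exp B" using total_height_eq[OF F(1)] H inf_height_nonneg[of T] by simp
  finally show "of_int (snd (quotient_of r)) \<le> exp B" using ab by simp
  have bound: "cmod (coeff (root_poly \<iota> T) i) \<le> (\<Prod>x\<in>T. 1 + cmod (\<iota> x))" for i
    using T(1)
  proof (induction T arbitrary: i rule: finite_induct)
    case empty
    then show ?case by (simp add: root_poly_empty)
  next
    case (insert x T)
    let ?q = "root_poly \<iota> T" and ?B = "\<Prod>x\<in>T. 1 + cmod (\<iota> x)"
    have B: "0 \<le> ?B" by (intro prod_nonneg) auto
    have "cmod (coeff ([:- \<iota> x, 1:] * ?q) i)
        \<le> cmod (if i = 0 then 0 else coeff ?q (i - 1)) + cmod (\<iota> x * coeff ?q i)"
      unfolding coeff_linear_mult by (rule norm_triangle_ineq4)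
    also have "\<dots> \<le> ?B + cmod (\<iota> x) * ?B"
      using insert.IH B by (intro add_mono) (auto simp: norm_mult intro!: mult_left_mono)
    finally show ?case
      unfolding root_poly_insert[OF insert.hyps(1,2)] prod.insert[OF insert.hyps(1,2)]
      by (simp add: algebra_simps)
  qed
  have "\<bar>real_of_rat r\<bar> = cmod (\<iota> (of_rat r))"
    unfolding iota.of_rat by (rule norm_of_rat_complex[symmetric])
  also have "\<iota> (of_rat r) = coeff (root_poly \<iota> T) i"
    unfolding r[symmetric] by (rule coeff_root_poly_hom) (simp_all add: T iota.add iota.mult)
  also have "cmod (coeff (root_poly \<iota> T) i) \<le> (\<Prod>x\<in>T. 1 + cmod (\<iota> x))" by (rule bound)
  also have "\<dots> \<le> (\<Prod>x\<in>T. 3 * exp (lambda_inf (\<iota> x)))"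
  proof (intro prod_mono conjI)
    fix x
    \<comment> \<open>The constant 3 is 1 + 2, from 1 <= exp(lambda) and |z| <= 2 *
      exp(lambda).\<close>
    show "1 + cmod (\<iota> x) \<le> 3 * exp (lambda_inf (\<iota> x))"
      using norm_le_lambda_inf[of "\<iota> x"] lambda_inf_nonneg[of "\<iota> x"] one_le_exp_iff[of "lambda_inf (\<iota> x)"] by linarith
  qed simp
  also have "\<dots> = 3 ^ card T * exp (inf_height T)"
    using T(1) by (simp add: prod.distrib inf_height_def exp_sum)
  also have "\<dots> \<le> 3 ^ N * exp B"
    using N H local_heights_le_total(1)[OF T] by (intro mult_mono power_increasing) auto
  finally show "\<bar>real_of_rat r\<bar> \<le> 3 ^ N * exp B" .
qed

text \<open>A finite set is recovered from the coefficients of its monic polynomial, and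
  \<open>coeff_bounds\<close> leaves finitely many choices for each of them.\<close>

lemma northcott: "finite {T. finite T \<and> galois_stable T \<and> card T \<le> N \<and> total_height T \<le> B}"
proof -
  let ?A = "{T. finite T \<and> galois_stable T \<and> card T \<le> N \<and> total_height T \<le> B}"
  define R :: "qbar set" where "R = of_rat ` {r. snd (quotient_of r) \<le> \<lfloor>exp B\<rfloor> \<and> \<bar>real_of_rat r\<bar> \<le> 3 ^ N * exp B}"
  have finR: "finite R" unfolding R_def by (intro finite_imageI finite_bounded_rats)
  have coeffs: "coeff (root_poly (\<lambda>x. x) T) i \<in> R" if T: "T \<in> ?A" for T i
  proof -
    obtain r where r: "coeff (root_poly (\<lambda>x. x) T) i = of_rat r"
      using galois_stable_coeff_root_poly[of T i] T by (auto elim: Rats_cases)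
    then have "of_int (snd (quotient_of r)) \<le> exp B \<and> \<bar>real_of_rat r\<bar> \<le> 3 ^ N * exp B"
      using coeff_bounds[of T B N i r] T by auto
    then show ?thesis unfolding r R_def by (intro imageI) (simp add: le_floor_iff)
  qed
  let ?f = "\<lambda>T. map (coeff (root_poly (\<lambda>x. x) T)) [0..<Suc N]"
  have "?f ` ?A \<subseteq> {xs. set xs \<subseteq> R \<and> length xs = Suc N}"
  proof (rule image_subsetI)
    fix T assume "T \<in> ?A"
    then have "coeff (root_poly (\<lambda>x. x) T) i \<in> R" for i by (rule coeffs)
    then show "?f T \<in> {xs. set xs \<subseteq> R \<and> length xs = Suc N}" by (auto simp del: upt_Suc)
  qed
  then have "finite (?f ` ?A)" by (rule finite_subset) (rule finite_lists_length_eq[OF finR])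
  moreover have "inj_on ?f ?A"
  proof (rule inj_onI)
    fix T U assume TU: "T \<in> ?A" "U \<in> ?A" and eq: "?f T = ?f U"
    have "coeff (root_poly (\<lambda>x. x) T) i = coeff (root_poly (\<lambda>x. x) U) i" for i
    proof (cases "i \<le> N")
      case True
      have "?f T ! i = ?f U ! i" by (rule arg_cong[OF eq])
      then show ?thesis using True by (simp add: nth_map del: upt_Suc)
    next
      case False
      then show ?thesis using TU by (simp add: coeff_eq_0 degree_root_poly)
    qed
    then have rp: "root_poly (\<lambda>x. x) T = root_poly (\<lambda>x. x) U" by (rule poly_eqI)
    have roots: "V = {x. poly (root_poly (\<lambda>x. x) V) x = 0}" if "V \<in> ?A" for V
      using that by (auto simp: poly_root_poly)
    have "T = {x. poly (root_poly (\<lambda>x. x) T) x = 0}" by (rule roots[OF TU(1)])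
    also have "\<dots> = U" unfolding rp by (rule roots[OF TU(2), symmetric])
    finally show "T = U" .
  qed
  ultimately show ?thesis by (rule finite_imageD)
qed

text \<open>Sets with fewer than K points and average height below 1 have total height at most K.
  There are finitely many by \<open>northcott\<close>, and \<open>S\<close> takes each of them at
  most once.\<close>

lemma card_at_top:
  assumes "inj S" "\<And>n. finite (S n)" "\<And>n. galois_stable (S n)"
    and h: "(\<lambda>n. 1 / real (card (S n)) * total_height (S n)) \<longlonglongrightarrow> 0"
  shows "filterlim (\<lambda>n. card (S n)) at_top sequentially"
  unfolding filterlim_at_top
proof
  fix K
  have "\<forall>\<^sub>F n in sequentially. 1 / real (card (S n)) * total_height (S n) < 1"
    using h by (rule order_tendstoD) simp
  then obtain n0 where n0: "\<And>n. n \<ge> n0 \<Longrightarrow> 1 / real (card (S n)) * total_height (S n) < 1"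
    by (auto simp: eventually_sequentially)
  let ?A = "{T. finite T \<and> galois_stable T \<and> card T \<le> K \<and> total_height T \<le> real K}"
  have "S n \<in> ?A" if "n \<ge> n0" "card (S n) < K" for n
  proof -
    have "total_height (S n) \<le> real (card (S n))"
    \<comment> \<open>For the empty set the average is 0 by division by zero and bounds nothing, but
      its total height is an empty sum.\<close>
    proof (cases "card (S n) = 0")
      case True
      then have "S n = {}" using assms(2) by simp
      then show ?thesis by (simp add: total_height_def)
    next
      case False
      then show ?thesis using n0[OF that(1)] by (simp add: field_simps)
    qed
    then show ?thesis using that assms(2,3) by simp
  qed
  then have "{n. n0 \<le> n \<and> card (S n) < K} \<subseteq> S -` ?A" by auto
  moreover have "finite (S -` ?A)" by (rule finite_vimageI[OF northcott assms(1)])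
  ultimately have "finite {n. n0 \<le> n \<and> card (S n) < K}" by (rule finite_subset)
  then obtain m where m: "\<And>n. n0 \<le> n \<Longrightarrow> card (S n) < K \<Longrightarrow> n \<le> m"
    by (auto simp: finite_nat_set_iff_bounded_le)
  have "K \<le> card (S n)" if "max n0 (Suc m) \<le> n" for n
    using m[of n] that by (meson Suc_n_not_le_n le_trans max.bounded_iff not_less)
  then show "\<forall>\<^sub>F n in sequentially. K \<le> card (S n)" unfolding eventually_sequentially by blast
qed

text \<open>Divided by N(N - 1), the bound on the logarithm is of order ln N / N plus a multiple of
  the average height H / N.\<close>

lemma finite_diameter_tendsto_1:
  fixes d :: "nat \<Rightarrow> real" and N :: "nat \<Rightarrow> nat" and H :: "nat \<Rightarrow> real"
  assumes N: "filterlim N at_top sequentially" and H: "(\<lambda>n. 1 / real (N n) * H n) \<longlonglongrightarrow> 0"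
    and d: "\<And>n. 0 < N n \<Longrightarrow> 0 < d n"
      "\<And>n. 0 < N n \<Longrightarrow> \<bar>ln (d n)\<bar> \<le> real (N n) * (4 * ln (real (N n)) + 2 * H n)"
  shows "(\<lambda>n. d n powr (1 / (real (N n) * (real (N n) - 1)))) \<longlonglongrightarrow> 1"
proof -
  define e where "e n = 1 / (real (N n) * (real (N n) - 1)) * ln (d n)" for n
  have lim1: "(\<lambda>n. 4 * ln (real (N n)) / (real (N n) - 1)) \<longlonglongrightarrow> 0"
    by (rule filterlim_compose[OF _ N, of "\<lambda>k. 4 * ln (real k) / (real k - 1)"]) real_asymp
  have lim2: "(\<lambda>n. real (N n) / (real (N n) - 1)) \<longlonglongrightarrow> 1"
    by (rule filterlim_compose[OF _ N, of "\<lambda>k. real k / (real k - 1)"]) real_asymp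
  have "(\<lambda>n. 4 * ln (real (N n)) / (real (N n) - 1)
      + 2 * (real (N n) / (real (N n) - 1)) * (1 / real (N n) * H n)) \<longlonglongrightarrow> 0 + 2 * 1 * 0"
    by (intro tendsto_intros lim1 lim2 H)
  then have lim: "(\<lambda>n. 4 * ln (real (N n)) / (real (N n) - 1)
      + 2 * (real (N n) / (real (N n) - 1)) * (1 / real (N n) * H n)) \<longlonglongrightarrow> 0" by simp
  have ev: "\<forall>\<^sub>F n in sequentially. 2 \<le> N n" using N unfolding filterlim_at_top by blast
  have "e \<longlonglongrightarrow> 0"
  proof (rule Lim_null_comparison[OF _ lim])
    show "\<forall>\<^sub>F n in sequentially. norm (e n) \<le> 4 * ln (real (N n)) / (real (N n) - 1)
      + 2 * (real (N n) / (real (N n) - 1)) * (1 / real (N n) * H n)"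
      using ev
    proof eventually_elim
      case (elim n)
      let ?N = "real (N n)"
      have pos: "0 < ?N * (?N - 1)" using elim by simp
      have "norm (e n) = \<bar>1 / (?N * (?N - 1))\<bar> * \<bar>ln (d n)\<bar>"
        by (simp only: e_def real_norm_def abs_mult)
      also have "\<bar>1 / (?N * (?N - 1))\<bar> = 1 / (?N * (?N - 1))" using pos by (intro abs_of_nonneg) simp
      also have "1 / (?N * (?N - 1)) * \<bar>ln (d n)\<bar> = \<bar>ln (d n)\<bar> / (?N * (?N - 1))" by simp
      also have "\<dots> \<le> ?N * (4 * ln ?N + 2 * H n) / (?N * (?N - 1))"
        using pos d(2)[of n] elim by (intro divide_right_mono) auto
      also have "\<dots> = 4 * ln ?N / (?N - 1) + 2 * (?N / (?N - 1)) * (1 / ?N * H n)"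
        using elim by (simp add: add_divide_distrib)
      finally show ?case .
    qed
  qed
  then have "(\<lambda>n. exp (e n)) \<longlonglongrightarrow> exp 0" by (rule tendsto_exp)
  then have lim_exp: "(\<lambda>n. exp (e n)) \<longlonglongrightarrow> 1" by simp
  show ?thesis
  proof (rule Lim_transform_eventually[OF lim_exp])
    show "\<forall>\<^sub>F n in sequentially. exp (e n) = d n powr (1 / (real (N n) * (real (N n) - 1)))"
      using ev
    proof eventually_elim
      case (elim n)
      then have "0 < d n" using d(1) by simp
      then show ?case by (simp add: e_def powr_def)
    qed
  qed
qed

end

section \<open>Weak limits in the plane\<close>

text \<open>Schoenberg's space-filling curve, with the usual piecewise linear function replaced by a
  clipped cosine, which has the same values on \<open>[0, 1/3]\<close> and \<open>[2/3, 1]\<close> modulo \<open>2\<close>.\<close>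

definition bump :: "real \<Rightarrow> real" where
  "bump t = max 0 (min 1 (1 / 2 - cos (pi * t)))"

lemma bump_bounds: "0 \<le> bump t" "bump t \<le> 1"
  by (simp_all add: bump_def)

lemma continuous_bump: "continuous_on UNIV bump"
  unfolding bump_def by (intro continuous_intros)

lemma bump_periodic: "bump (2 * of_int z + r) = bump r"
proof -
  have "cos (pi * (2 * of_int z + r)) = cos ((2 * pi) * of_int z + pi * r)" by (simp add: algebra_simps)
  also have "\<dots> = cos (pi * r)" by (simp add: cos_add cos_int_2pin sin_int_2pin)
  finally show ?thesis by (simp add: bump_def)
qed

lemma bump_0: "0 \<le> r \<Longrightarrow> r \<le> 1 / 3 \<Longrightarrow> bump r = 0"
proof -
  assume r: "0 \<le> r" "r \<le> 1 / 3"
  then have "cos (pi / 3) \<le> cos (pi * r)" by (intro cos_monotone_0_pi_le) (auto simp: field_simps)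
  then show ?thesis by (simp add: bump_def cos_60)
qed

lemma bump_1: "2 / 3 \<le> r \<Longrightarrow> r \<le> 1 \<Longrightarrow> bump r = 1"
proof -
  assume r: "2 / 3 \<le> r" "r \<le> 1"
  have "cos (pi * r) \<le> cos (pi * (2 / 3))" using r by (intro cos_monotone_0_pi_le) (auto simp: field_simps)
  also have "cos (pi * (2 / 3)) = - cos (pi / 3)" using cos_pi_minus[of "pi / 3"] by (simp add: field_simps)
  finally show ?thesis by (simp add: bump_def cos_60)
qed

text \<open>The point of the Cantor set with ternary digits 2 * a_k.\<close>

definition cantor_sum :: "(nat \<Rightarrow> int) \<Rightarrow> real" where
  "cantor_sum a = (\<Sum>k. 2 * of_int (a k) / 3 ^ Suc k)"

context
  fixes a :: "nat \<Rightarrow> int"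
  assumes digits: "\<And>k. a k \<in> {0, 1}"
begin

lemma cantor_sums: "(\<lambda>k. 2 / 3 ^ Suc k) sums (1 :: real)"
  using sums_mult[OF geometric_sums[of "1 / 3 :: real"], of "2 / 3"]
  by (simp add: power_one_over field_simps)

lemma summable_cantor: "summable (\<lambda>k. 2 * of_int (a k) / 3 ^ Suc k :: real)"
proof (rule summable_comparison_test')
  show "summable (\<lambda>k. 2 / 3 ^ Suc k :: real)" using cantor_sums by (rule sums_summable)
  fix n :: nat
  show "norm (2 * of_int (a n) / 3 ^ Suc n :: real) \<le> 2 / 3 ^ Suc n" using digits[of n] by auto
qed

lemma cantor_sum_bounds: "0 \<le> cantor_sum a" "cantor_sum a \<le> 1"
proof -
  have nn: "0 \<le> (2 * of_int (a k) / 3 ^ Suc k :: real)" for k using digits[of k] by auto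
  show "0 \<le> cantor_sum a" unfolding cantor_sum_def by (rule suminf_nonneg[OF summable_cantor nn])
  have "cantor_sum a \<le> (\<Sum>k. 2 / 3 ^ Suc k :: real)"
    unfolding cantor_sum_def
  proof (rule suminf_le[OF _ summable_cantor])
    show "2 * of_int (a k) / 3 ^ Suc k \<le> (2 / 3 ^ Suc k :: real)" for k using digits[of k] by auto
    show "summable (\<lambda>k. 2 / 3 ^ Suc k :: real)" using cantor_sums by (rule sums_summable)
  qed
  then show "cantor_sum a \<le> 1" using sums_unique[OF cantor_sums] by simp
qed

lemma cantor_sum_shift: "3 * cantor_sum a = 2 * of_int (a 0) + cantor_sum (\<lambda>k. a (Suc k))"
proof -
  have "cantor_sum a = 2 * of_int (a 0) / 3 + (\<Sum>k. 2 * of_int (a (Suc k)) / 3 ^ Suc (Suc k))"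
    unfolding cantor_sum_def using suminf_split_head[OF summable_cantor] by simp
  also have "(\<Sum>k. 2 * of_int (a (Suc k)) / 3 ^ Suc (Suc k) :: real)
      = (\<Sum>k. (2 * of_int (a (Suc k)) / 3 ^ Suc k) / 3)" by simp
  also have "\<dots> = cantor_sum (\<lambda>k. a (Suc k)) / 3"
  proof -
    have "summable (\<lambda>k. 2 * of_int (a (Suc k)) / 3 ^ Suc (Suc k) :: real)"
      using summable_Suc_iff[of "\<lambda>k. 2 * of_int (a k) / 3 ^ Suc k :: real"] summable_cantor by simp
    then have "summable (\<lambda>k. 3 * (2 * of_int (a (Suc k)) / 3 ^ Suc (Suc k)) :: real)" by (rule summable_mult)
    then have "summable (\<lambda>k. 2 * of_int (a (Suc k)) / 3 ^ Suc k :: real)" by simp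
    then show ?thesis unfolding cantor_sum_def by (rule suminf_divide)
  qed
  finally show ?thesis by simp
qed

end

text \<open>Multiplication by 3^m shifts the ternary digits by m places. The integral part split off
  is even, a period of \<open>bump\<close>, and the remainder lies in [0, 1/3] or [2/3, 1] according
  to the digit \<open>a m\<close>.\<close>

lemma bump_cantor_sum:
  assumes "\<And>k. a k \<in> {0, 1}"
  shows "bump (3 ^ m * cantor_sum a) = of_int (a m)"
proof -
  have ex: "\<exists>z. 3 ^ m * cantor_sum a = 2 * of_int z + cantor_sum (\<lambda>k. a (m + k))"
  proof (induction m)
    case 0
    show ?case by (rule exI[of _ 0]) simp
  next
    case (Suc m)
    then obtain z where "3 ^ m * cantor_sum a = 2 * of_int z + cantor_sum (\<lambda>k. a (m + k))" by blast
    then have "3 ^ Suc m * cantor_sum a = 2 * of_int (3 * z) + 3 * cantor_sum (\<lambda>k. a (m + k))" by simp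
    also have "3 * cantor_sum (\<lambda>k. a (m + k)) = 2 * of_int (a m) + cantor_sum (\<lambda>k. a (Suc m + k))"
      using cantor_sum_shift[of "\<lambda>k. a (m + k)"] assms by simp
    finally have "3 ^ Suc m * cantor_sum a = 2 * of_int (3 * z + a m) + cantor_sum (\<lambda>k. a (Suc m + k))" by simp
    then show ?case by blast
  qed
  let ?r = "cantor_sum (\<lambda>k. a (m + k))"
  have r: "3 * ?r = 2 * of_int (a m) + cantor_sum (\<lambda>k. a (m + Suc k))"
    using cantor_sum_shift[of "\<lambda>k. a (m + k)"] assms by simp
  have b: "0 \<le> cantor_sum (\<lambda>k. a (m + Suc k))" "cantor_sum (\<lambda>k. a (m + Suc k)) \<le> 1"
    using cantor_sum_bounds[of "\<lambda>k. a (m + Suc k)"] assms by blast+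
  have "bump ?r = of_int (a m)"
  proof (cases "a m = 0")
    case True
    then show ?thesis using r b bump_0[of ?r] by simp
  next
    case False
    then have "a m = 1" using assms[of m] by simp
    then show ?thesis using r b bump_1[of ?r] by simp
  qed
  then show ?thesis using ex bump_periodic by metis
qed

text \<open>The digits are chosen as differences of floors so that the partial sums collapse to
  floor(2^n x) / 2^n.\<close>

lemma binary_expansion:
  fixes x :: real
  assumes "0 \<le> x" "x < 1"
  shows "\<exists>b :: nat \<Rightarrow> int. (\<forall>k. b k \<in> {0, 1}) \<and> (\<lambda>k. of_int (b k) / 2 ^ Suc k) sums x"
proof -
  define b where "b k = \<lfloor>2 ^ Suc k * x\<rfloor> - 2 * \<lfloor>2 ^ k * x\<rfloor>" for k
  have "b k \<in> {0, 1}" for k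
  proof -
    have "2 ^ Suc k * x = 2 * (2 ^ k * x)" by simp
    then have "b k = 0 \<or> b k = 1" unfolding b_def by linarith
    then show ?thesis by simp
  qed
  moreover have part: "(\<Sum>k<n. of_int (b k) / 2 ^ Suc k) = of_int \<lfloor>2 ^ n * x\<rfloor> / (2 :: real) ^ n" for n
  proof (induction n)
    case 0
    have "\<lfloor>x\<rfloor> = 0" using assms by linarith
    then show ?case by simp
  qed (simp add: b_def field_simps)
  have "(\<lambda>n. of_int \<lfloor>2 ^ n * x\<rfloor> / 2 ^ n) \<longlonglongrightarrow> x"
  proof (rule tendsto_sandwich)
    have le: "of_int \<lfloor>2 ^ n * x\<rfloor> / 2 ^ n \<le> x" "x - (1 / 2) ^ n \<le> of_int \<lfloor>2 ^ n * x\<rfloor> / 2 ^ n" for n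
    proof -
      have "of_int \<lfloor>2 ^ n * x\<rfloor> \<le> 2 ^ n * x" "2 ^ n * x - 1 \<le> of_int \<lfloor>2 ^ n * x\<rfloor>" by linarith+
      then show "of_int \<lfloor>2 ^ n * x\<rfloor> / 2 ^ n \<le> x" "x - (1 / 2) ^ n \<le> of_int \<lfloor>2 ^ n * x\<rfloor> / 2 ^ n"
        by (simp_all add: field_simps power_one_over)
    qed
    show "\<forall>\<^sub>F n in sequentially. of_int \<lfloor>2 ^ n * x\<rfloor> / 2 ^ n \<le> x" by (simp add: le)
    show "\<forall>\<^sub>F n in sequentially. x - (1 / 2) ^ n \<le> of_int \<lfloor>2 ^ n * x\<rfloor> / 2 ^ n" by (simp add: le)
    have "(\<lambda>n. x - (1 / 2) ^ n) \<longlonglongrightarrow> x - 0" by (intro tendsto_diff tendsto_const LIMSEQ_power_zero) simp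
    then show "(\<lambda>n. x - (1 / 2) ^ n) \<longlonglongrightarrow> x" by simp
  qed simp
  then have "(\<lambda>k. of_int (b k) / 2 ^ Suc k) sums x" unfolding sums_def part .
  ultimately show ?thesis by blast
qed

text \<open>For i = 0 or 1, at a Cantor point this coordinate has as binary digits the sequence
  \<open>a\<close> read at the positions of parity \<open>i\<close>; interleaving two binary
  expansions therefore hits any prescribed pair.\<close>

definition schoenberg :: "nat \<Rightarrow> real \<Rightarrow> real" where
  "schoenberg i t = (\<Sum>k. bump (3 ^ (2 * k + i) * t) / 2 ^ Suc k)"

lemma continuous_schoenberg: "continuous_on UNIV (schoenberg i)"
proof -
  have "uniform_limit UNIV (\<lambda>n t. \<Sum>k<n. bump (3 ^ (2 * k + i) * t) / 2 ^ Suc k)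
      (\<lambda>t. \<Sum>k. bump (3 ^ (2 * k + i) * t) / 2 ^ Suc k) sequentially"
  proof (rule Weierstrass_m_test)
    show "norm (bump (3 ^ (2 * n + i) * t) / 2 ^ Suc n) \<le> (1 / 2) ^ Suc n" for n t
      using bump_bounds[of "3 ^ (2 * n + i) * t"] by (simp add: power_one_over divide_right_mono)
    show "summable (\<lambda>n. (1 / 2 :: real) ^ Suc n)" by (simp add: summable_geometric)
  qed
  moreover have "continuous_on UNIV (\<lambda>t. \<Sum>k<n. bump (3 ^ (2 * k + i) * t) / 2 ^ Suc k)" for n
    by (intro continuous_intros continuous_on_compose2[OF continuous_bump]) auto
  ultimately show ?thesis
    unfolding schoenberg_def by (intro uniform_limit_theorem) (auto intro: always_eventually)
qed

lemma schoenberg_surj: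
  assumes "0 \<le> x" "x < 1" "0 \<le> y" "y < 1"
  shows "\<exists>t\<in>{0..1}. schoenberg 0 t = x \<and> schoenberg 1 t = y"
proof -
  obtain b where b: "\<And>k. b k \<in> {0, 1 :: int}" "(\<lambda>k. of_int (b k) / 2 ^ Suc k) sums x"
    using binary_expansion[OF assms(1,2)] by blast
  obtain c where c: "\<And>k. c k \<in> {0, 1 :: int}" "(\<lambda>k. of_int (c k) / 2 ^ Suc k) sums y"
    using binary_expansion[OF assms(3,4)] by blast
  define a where "a k = (if even k then b (k div 2) else c (k div 2))" for k
  have a: "a k \<in> {0, 1}" for k using b(1)[of "k div 2"] c(1)[of "k div 2"] by (simp add: a_def)
  have "a (2 * k + 0) = b k" "a (2 * k + 1) = c k" for k by (simp_all add: a_def)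
  then have "schoenberg 0 (cantor_sum a) = x" "schoenberg 1 (cantor_sum a) = y"
    unfolding schoenberg_def bump_cantor_sum[OF a] using b(2) c(2) by (simp_all only: sums_unique[symmetric])
  moreover have "cantor_sum a \<in> {0..1}" using cantor_sum_bounds[of a] a by simp
  ultimately show ?thesis by blast
qed

lemma space_filling_curve:
  assumes "R > 0"
  shows "\<exists>P :: real \<Rightarrow> complex. continuous_on UNIV P \<and> cball 0 R \<subseteq> P ` {0..1}"
proof -
  \<comment> \<open>With the factor 4R, coordinates of points of the ball correspond to parameters
    in [1/4, 3/4], safely below the excluded value 1.\<close>
  define P where "P t = Complex (4 * R * (schoenberg 0 t - 1 / 2)) (4 * R * (schoenberg 1 t - 1 / 2))" for t
  have "continuous_on UNIV P"
    unfolding P_def Complex_eq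
    by (intro continuous_intros continuous_on_compose2[OF continuous_schoenberg]) auto
  moreover have "z \<in> P ` {0..1}" if "z \<in> cball 0 R" for z
  proof -
    have "\<bar>Re z\<bar> \<le> R" "\<bar>Im z\<bar> \<le> R"
      using that abs_Re_le_cmod[of z] abs_Im_le_cmod[of z] by auto
    then have "0 \<le> Re z / (4 * R) + 1 / 2" "Re z / (4 * R) + 1 / 2 < 1"
      "0 \<le> Im z / (4 * R) + 1 / 2" "Im z / (4 * R) + 1 / 2 < 1"
      using assms by (auto simp: field_simps)
    then obtain t where t: "t \<in> {0..1}" "schoenberg 0 t = Re z / (4 * R) + 1 / 2"
      "schoenberg 1 t = Im z / (4 * R) + 1 / 2" using schoenberg_surj by blast
    then have "P t = z" using assms by (simp add: P_def complex_eq_iff)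
    then show ?thesis using t(1) by blast
  qed
  ultimately show ?thesis by blast
qed

section \<open>Averages over finite sets and weak compactness\<close>

definition average :: "'a set \<Rightarrow> ('a \<Rightarrow> real) \<Rightarrow> real" where
  "average T f = 1 / real (card T) * (\<Sum>z\<in>T. f z)"

lemma measurable_uniform_count_measure [simp]:
  "f \<in> measurable (uniform_count_measure A) N \<longleftrightarrow> f \<in> A \<rightarrow> space N"
  using measurable_cong_sets[OF sets_uniform_count_measure_count_space refl, of A N]
  by (simp add: measurable_count_space_eq1)

lemma prob_space_uniform_count_measure: "finite A \<Longrightarrow> A \<noteq> {} \<Longrightarrow> prob_space (uniform_count_measure A)"
  by (rule prob_spaceI) (simp add: emeasure_uniform_count_measure space_uniform_count_measure)

lemma integral_uniform_distr:
  fixes f :: "'b :: topological_space \<Rightarrow> real"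
  assumes "finite T" "f \<in> borel_measurable borel"
  shows "(\<integral>z. f z \<partial>distr (uniform_count_measure T) borel s) = average T (\<lambda>z. f (s z))"
  using assms
  by (subst integral_distr) (auto simp: integral_uniform_count_measure average_def)

lemma average_mono: "(\<And>z. z \<in> T \<Longrightarrow> f z \<le> g z) \<Longrightarrow> average T f \<le> average T g"
  unfolding average_def by (intro mult_left_mono sum_mono) auto

lemma average_nonneg: "(\<And>z. z \<in> T \<Longrightarrow> 0 \<le> f z) \<Longrightarrow> 0 \<le> average T f"
  unfolding average_def by (simp add: sum_nonneg)

lemma average_add: "average T (\<lambda>z. f z + g z) = average T f + average T g"
  by (simp add: average_def sum.distrib distrib_left)

lemma average_cmult: "average T (\<lambda>z. c * f z) = c * average T f"
  by (simp add: average_def sum_distrib_left mult.left_commute)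

lemma abs_average_le: "\<bar>average T f\<bar> \<le> average T (\<lambda>z. \<bar>f z\<bar>)"
  unfolding average_def by (simp add: abs_mult sum_abs divide_right_mono)

lemma average_diff: "average T (\<lambda>z. f z - g z) = average T f - average T g"
  by (simp add: average_def sum_subtractf right_diff_distrib)

text \<open>Points of a large ball are pulled back to \<open>[0, 1]\<close> along the space-filling curve, where Helly's
  selection theorem applies; the few points outside the ball do not matter.\<close>

lemma weak_limit_exists:
  fixes T :: "nat \<Rightarrow> complex set"
  assumes T: "\<And>n. finite (T n)" "\<And>n. T n \<noteq> {}" and R: "R > 0"
    and outside: "(\<lambda>n. average (T n) (\<lambda>z. if R < cmod z then 1 else 0)) \<longlonglongrightarrow> 0"
  shows "\<exists>r \<nu>. strict_mono (r :: nat \<Rightarrow> nat) \<and> prob_space \<nu> \<and> sets \<nu> = sets borel \<and>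
    (\<forall>f :: complex \<Rightarrow> real. continuous_on UNIV f \<longrightarrow> bounded (range f) \<longrightarrow>
       (\<lambda>n. average (T (r n)) f) \<longlonglongrightarrow> (\<integral>z. f z \<partial>\<nu>))"
proof -
  obtain P :: "real \<Rightarrow> complex" where P: "continuous_on UNIV P" "cball 0 R \<subseteq> P ` {0..1}"
    using space_filling_curve[OF R] by blast
  have "\<forall>z. \<exists>t\<in>{0..1}. cmod z \<le> R \<longrightarrow> P t = z"
  proof
    fix z show "\<exists>t\<in>{0..1}. cmod z \<le> R \<longrightarrow> P t = z"
    proof (cases "cmod z \<le> R")
      case True
      then have "z \<in> P ` {0..1}" using P(2) by auto
      then show ?thesis by blast
    qed (auto intro: bexI[of _ 0])
  qed
  then obtain s where s: "\<And>z. s z \<in> {0..1}" "\<And>z. cmod z \<le> R \<Longrightarrow> P (s z) = z" by metis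
  \<comment> \<open>\<open>s\<close> is a mere choice function, but every map out of the discrete
    space \<open>uniform_count_measure\<close> is measurable.\<close>
  define m where "m n = distr (uniform_count_measure (T n)) borel s" for n
  have real_dist: "real_distribution (m n)" for n
  proof -
    interpret prob_space "uniform_count_measure (T n)" using T by (rule prob_space_uniform_count_measure)
    show ?thesis unfolding m_def by (rule real_distribution_distr) simp
  qed
  have "tight m"
    unfolding tight_def
  proof (intro conjI allI impI)
    fix e :: real assume e: "0 < e"
    have "measure (m n) {-1<..1} = 1" for n
    proof -
      have "measure (m n) {-1<..1} = measure (uniform_count_measure (T n)) (s -` {-1<..1} \<inter> space (uniform_count_measure (T n)))"
        unfolding m_def by (rule measure_distr) simp_all
      also have "s -` {-1<..1} \<inter> space (uniform_count_measure (T n)) = space (uniform_count_measure (T n))"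
        using s(1) by (force simp: greaterThanAtMost_iff)
      also have "measure (uniform_count_measure (T n)) (space (uniform_count_measure (T n))) = 1"
        using T by (intro prob_space.prob_space prob_space_uniform_count_measure)
      finally show ?thesis .
    qed
    then show "\<exists>a b. a < b \<and> (\<forall>n. 1 - e < measure (m n) {a<..b})"
      using e by (intro exI[of _ "-1"] exI[of _ 1]) simp
  qed (rule real_dist)
  from tight_imp_convergent_subsubsequence[OF this, of "\<lambda>n. n"]
  obtain r M where r: "strict_mono r" "real_distribution M" "weak_conv_m (\<lambda>n. m (r n)) M"
    by (auto simp: strict_mono_def o_def)
  interpret M: real_distribution M by (rule r(2))
  have Pm: "P \<in> borel_measurable borel" using P(1) by (rule borel_measurable_continuous_onI)
  then have PM: "P \<in> measurable M borel" by simp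
  define \<nu> where "\<nu> = distr M borel P"
  have "(\<lambda>n. average (T (r n)) f) \<longlonglongrightarrow> (\<integral>z. f z \<partial>\<nu>)"
    if f: "continuous_on UNIV f" "bounded (range f)" for f :: "complex \<Rightarrow> real"
  proof -
    obtain B where B: "\<And>z. \<bar>f z\<bar> \<le> B" using f(2) by (auto simp: bounded_iff)
    have fm: "f \<in> borel_measurable borel" using f(1) by (rule borel_measurable_continuous_onI)
    have cont: "isCont (\<lambda>t. f (P t)) x" for x
    proof -
      have "continuous_on UNIV (\<lambda>t. f (P t))" using continuous_on_compose2[OF f(1) P(1)] by simp
      then show ?thesis by (simp add: continuous_on_eq_continuous_at)
    qed
    have "(\<lambda>n. integral\<^sup>L (m (r n)) (\<lambda>t. f (P t))) \<longlonglongrightarrow> integral\<^sup>L M (\<lambda>t. f (P t))"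
      by (rule weak_conv_imp_integral_bdd_continuous_conv[OF real_dist r(2) r(3) cont, of B])
         (simp add: B)
    moreover have "integral\<^sup>L (m (r n)) (\<lambda>t. f (P t)) = average (T (r n)) (\<lambda>z. f (P (s z)))" for n
      unfolding m_def using T(1) fm Pm by (intro integral_uniform_distr) simp_all
    moreover have "integral\<^sup>L M (\<lambda>t. f (P t)) = (\<integral>z. f z \<partial>\<nu>)"
      unfolding \<nu>_def by (rule integral_distr[OF PM fm, symmetric])
    ultimately have lim: "(\<lambda>n. average (T (r n)) (\<lambda>z. f (P (s z)))) \<longlonglongrightarrow> (\<integral>z. f z \<partial>\<nu>)" by simp
    \<comment> \<open>The pushed-forward averages see \<open>P (s z)\<close> in place of
      \<open>z\<close>. The two differ only outside the ball, where \<open>f\<close> is bounded and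
      the proportion of points tends to 0.\<close>
    have "(\<lambda>n. average (T (r n)) f - average (T (r n)) (\<lambda>z. f (P (s z)))) \<longlonglongrightarrow> 0"
    proof (rule Lim_null_comparison)
      have "\<bar>average (T (r n)) f - average (T (r n)) (\<lambda>z. f (P (s z)))\<bar>
          \<le> 2 * B * average (T (r n)) (\<lambda>z. if R < cmod z then 1 else 0)" for n
      proof -
        have "\<bar>average (T (r n)) f - average (T (r n)) (\<lambda>z. f (P (s z)))\<bar>
            \<le> average (T (r n)) (\<lambda>z. \<bar>f z - f (P (s z))\<bar>)"
          unfolding average_diff[symmetric] by (rule abs_average_le)
        also have "\<dots> \<le> average (T (r n)) (\<lambda>z. 2 * B * (if R < cmod z then 1 else 0))"
        proof (rule average_mono)
          fix z
          have "\<bar>f z - f (P (s z))\<bar> \<le> 2 * B" using B[of z] B[of "P (s z)"] by linarith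
          then show "\<bar>f z - f (P (s z))\<bar> \<le> 2 * B * (if R < cmod z then 1 else 0)"
            using s(2)[of z] by (cases "R < cmod z") (simp_all add: not_less)
        qed
        finally show ?thesis unfolding average_cmult .
      qed
      then show "\<forall>\<^sub>F n in sequentially. norm (average (T (r n)) f - average (T (r n)) (\<lambda>z. f (P (s z))))
          \<le> 2 * B * average (T (r n)) (\<lambda>z. if R < cmod z then 1 else 0)"
        by (auto intro: always_eventually)
      have "(\<lambda>n. average (T (r n)) (\<lambda>z. if R < cmod z then 1 else 0)) \<longlonglongrightarrow> 0"
        using LIMSEQ_subseq_LIMSEQ[OF outside r(1)] by (simp add: o_def)
      then show "(\<lambda>n. 2 * B * average (T (r n)) (\<lambda>z. if R < cmod z then 1 else 0)) \<longlonglongrightarrow> 0"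
        by (rule tendsto_mult_right_zero)
    qed
    from tendsto_add[OF this lim] show ?thesis by simp
  qed
  moreover have "prob_space \<nu>" unfolding \<nu>_def by (rule M.prob_space_distr[OF PM])
  moreover have "sets \<nu> = sets borel" by (simp add: \<nu>_def)
  ultimately show ?thesis using r(1) by blast
qed

text \<open>Closed sets form an intersection-stable generator, and 1 - n * infdist x K, cut off at
  0, decreases to the indicator of a nonempty closed K. The empty set is separate because its
  \<open>infdist\<close> is 0.\<close>

lemma measure_eqI_bounded_continuous:
  fixes M N :: "'a :: metric_space measure"
  assumes M: "prob_space M" "sets M = sets borel" and N: "prob_space N" "sets N = sets borel"
    and eq: "\<And>f :: 'a \<Rightarrow> real. continuous_on UNIV f \<Longrightarrow> bounded (range f) \<Longrightarrow> (\<integral>x. f x \<partial>M) = (\<integral>x. f x \<partial>N)"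
  shows "M = N"
proof (rule measure_eqI_generator_eq[of "Collect closed" UNIV _ _ "\<lambda>_. UNIV"])
  interpret M: prob_space M by (rule M(1))
  interpret N: prob_space N by (rule N(1))
  show "sets M = sigma_sets UNIV (Collect closed)" "sets N = sigma_sets UNIV (Collect closed)"
    using M(2) N(2) by (simp_all add: borel_eq_closed)
  show "Int_stable (Collect closed)" by (auto simp: Int_stable_def)
  show "emeasure M UNIV \<noteq> \<infinity>" by simp
  fix K :: "'a set" assume "K \<in> Collect closed"
  then have K: "closed K" by simp
  show "emeasure M K = emeasure N K"
  proof (cases "K = {}")
    case False
    define f where "f n x = max 0 (1 - real n * infdist x K)" for n x
    have cont: "continuous_on UNIV (f n)" for n unfolding f_def by (intro continuous_intros)
    have f01: "0 \<le> f n x" "f n x \<le> 1" for n x by (simp_all add: f_def infdist_nonneg)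
    then have bdd: "bounded (range (f n))" for n by (auto simp: bounded_iff intro!: exI[of _ 1])
    have lim: "(\<lambda>n. f n x) \<longlonglongrightarrow> indicator K x" for x
    proof (cases "x \<in> K")
      case True
      then show ?thesis by (simp add: f_def)
    next
      case x: False
      then have pos: "0 < infdist x K"
        using K False in_closed_iff_infdist_zero[of K x] infdist_nonneg[of x K] by auto
      obtain n0 where n0: "1 < real n0 * infdist x K" using reals_Archimedean3[OF pos] by blast
      have "f n x = 0" if "n \<ge> n0" for n
      proof -
        have "real n0 * infdist x K \<le> real n * infdist x K" using that pos by simp
        then show ?thesis using n0 by (simp add: f_def)
      qed
      then have "\<forall>\<^sub>F n in sequentially. f n x = indicator K x"
        using x by (auto simp: eventually_sequentially)
      then show ?thesis by (rule tendsto_eventually)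
    qed
    have *: "(\<lambda>n. \<integral>x. f n x \<partial>L) \<longlonglongrightarrow> measure L K" if L: "prob_space L" "sets L = sets borel" for L
    proof -
      interpret L: prob_space L by (rule L(1))
      have fm: "f n \<in> borel_measurable L" for n
        using borel_measurable_continuous_onI[OF cont] L(2) by (simp cong: measurable_cong_sets)
      have Km: "K \<in> sets L" using K L(2) by simp
      have "(\<lambda>n. \<integral>x. f n x \<partial>L) \<longlonglongrightarrow> (\<integral>x. indicator K x \<partial>L)"
      proof (rule integral_dominated_convergence[where w = "\<lambda>_. 1"])
        show "AE x in L. norm (f n x) \<le> 1" for n using f01 by simp
        show "indicator K \<in> borel_measurable L" using Km by simp
      qed (use lim fm in auto)
      then show ?thesis using Km by simp
    qed
    have "measure M K = measure N K"
      using LIMSEQ_unique[OF *[OF M] *[OF N, folded eq[OF cont bdd]]] .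
    then show ?thesis by (simp add: M.emeasure_eq_measure N.emeasure_eq_measure)
  qed simp
qed auto

section \<open>Logarithmic energy\<close>

text \<open>On the Riemann sphere, \<open>-2 ln \<bar>x - y\<bar>\<close> becomes \<open>- ln (1 - v x y)\<close> up to functions of one variable,
  where \<open>v\<close> is a positive definite kernel with values in \<open>[0, 1]\<close>. Hence it is the
  sum of the positive definite kernels \<open>v ^ k / k\<close> (the term \<open>k = 0\<close> vanishes since \<open>x / 0 = 0\<close>).\<close>

definition height_weight :: "complex \<Rightarrow> real" where
  "height_weight z = ln (1 + (cmod z)\<^sup>2)"

definition chord :: "complex \<Rightarrow> complex \<Rightarrow> real" where
  "chord x y = (cmod (x - y))\<^sup>2 / ((1 + (cmod x)\<^sup>2) * (1 + (cmod y)\<^sup>2))"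

definition sphere_kernel :: "complex \<Rightarrow> complex \<Rightarrow> real" where
  "sphere_kernel x y = 1 - chord x y"

text \<open>The numerator of \<open>sphere_kernel\<close> is |1 + x * cnj y|^2 = 1 + 2 Re x Re y + 2
  Im x Im y + |x|^2 |y|^2. Each summand is a product of a function of x and the same function of y;
  the factor \<open>sqrt 2\<close> shares out the coefficient 2.\<close>

definition features :: "(complex \<Rightarrow> real) list" where
  "features = [\<lambda>z. 1 / (1 + (cmod z)\<^sup>2), \<lambda>z. sqrt 2 * Re z / (1 + (cmod z)\<^sup>2),
     \<lambda>z. sqrt 2 * Im z / (1 + (cmod z)\<^sup>2), \<lambda>z. (cmod z)\<^sup>2 / (1 + (cmod z)\<^sup>2)]"

text \<open>Products of k features, as a list with repetitions: this is the k-fold tensor power of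
  the feature map, so no multinomial coefficients appear in
  \<open>sphere_kernel_power\<close>.\<close>

fun monomials :: "nat \<Rightarrow> (complex \<Rightarrow> real) list" where
  "monomials 0 = [\<lambda>_. 1]"
| "monomials (Suc k) = concat (map (\<lambda>f. map (\<lambda>g z. f z * g z) (monomials k)) features)"

lemma one_plus_sq_pos: "0 < 1 + (cmod z)\<^sup>2"
  by (simp add: add_pos_nonneg)

lemma sphere_kernel_features: "sphere_kernel x y = (\<Sum>f\<leftarrow>features. f x * f y)"
proof -
  let ?a = "1 + (cmod x)\<^sup>2" and ?b = "1 + (cmod y)\<^sup>2"
  have ab: "?a \<noteq> 0" "?b \<noteq> 0" using one_plus_sq_pos[of x] one_plus_sq_pos[of y] by linarith+
  have num: "?a * ?b - (cmod (x - y))\<^sup>2 = 1 + 2 * (Re x * Re y) + 2 * (Im x * Im y) + (cmod x)\<^sup>2 * (cmod y)\<^sup>2"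
    unfolding cmod_power2 by (simp add: power2_eq_square algebra_simps)
  have "sphere_kernel x y
      = (1 + 2 * (Re x * Re y) + 2 * (Im x * Im y) + (cmod x)\<^sup>2 * (cmod y)\<^sup>2) / (?a * ?b)"
    unfolding num[symmetric] diff_divide_distrib divide_self[OF no_zero_divisors[OF ab]]
    by (simp only: sphere_kernel_def chord_def)
  also have "\<dots> = (\<Sum>f\<leftarrow>features. f x * f y)"
  proof -
    have "sqrt 2 * s / A * (sqrt 2 * t / B) = 2 * (s * t) / (A * B)" for s t A B :: real
    proof -
      have "sqrt 2 * s / A * (sqrt 2 * t / B) = (sqrt 2 * sqrt 2) * (s * t) / (A * B)"
        by (simp only: times_divide_times_eq mult_ac)
      also have "sqrt 2 * sqrt 2 = (2 :: real)" by simp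
      finally show ?thesis .
    qed
    then show ?thesis
      by (simp only: features_def list.map sum_list.Cons sum_list.Nil times_divide_times_eq
          add_divide_distrib mult_1_left add_0_right add.assoc)
  qed
  finally show ?thesis .
qed

lemma sum_list_monomials_Suc:
  "(\<Sum>f\<leftarrow>monomials (Suc k). h f) = (\<Sum>f\<leftarrow>features. \<Sum>g\<leftarrow>monomials k. h (\<lambda>z. f z * g z))"
proof -
  have "(\<Sum>f\<leftarrow>concat (map F fs). h f) = (\<Sum>f\<leftarrow>fs. \<Sum>g\<leftarrow>F f. h g)" for F :: "(complex \<Rightarrow> real) \<Rightarrow> (complex \<Rightarrow> real) list" and fs
    by (induction fs) auto
  then show ?thesis by (simp add: o_def)
qed

lemma sphere_kernel_power: "sphere_kernel x y ^ k = (\<Sum>f\<leftarrow>monomials k. f x * f y)"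
proof (induction k)
  case (Suc k)
  have "(\<Sum>f\<leftarrow>monomials (Suc k). f x * f y) = (\<Sum>f\<leftarrow>features. \<Sum>g\<leftarrow>monomials k. (f x * f y) * (g x * g y))"
    unfolding sum_list_monomials_Suc by (simp add: mult_ac)
  also have "\<dots> = (\<Sum>f\<leftarrow>features. f x * f y) * (\<Sum>g\<leftarrow>monomials k. g x * g y)"
    by (simp only: sum_list_const_mult sum_list_mult_const)
  finally show ?case using Suc sphere_kernel_features by simp
qed simp

lemma features_continuous: "f \<in> set features \<Longrightarrow> continuous_on UNIV f"
proof -
  have "1 + (cmod z)\<^sup>2 \<noteq> 0" for z using one_plus_sq_pos[of z] by linarith
  then show "f \<in> set features \<Longrightarrow> continuous_on UNIV f"
    unfolding features_def by (auto intro!: continuous_intros)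
qed

text \<open>The squares of the features sum to the kernel on the diagonal, which is 1: the features
  map the plane into a unit sphere.\<close>

lemma features_bound: "f \<in> set features \<Longrightarrow> \<bar>f z\<bar> \<le> 1"
proof -
  assume f: "f \<in> set features"
  have "(f z)\<^sup>2 \<le> (\<Sum>f\<leftarrow>features. (f z)\<^sup>2)"
    using f by (intro member_le_sum_list) auto
  also have "\<dots> = sphere_kernel z z" by (simp add: sphere_kernel_features power2_eq_square)
  also have "\<dots> = 1" by (simp add: sphere_kernel_def chord_def)
  finally show "\<bar>f z\<bar> \<le> 1" by (simp add: abs_square_le_1)
qed

lemma monomials_continuous: "f \<in> set (monomials k) \<Longrightarrow> continuous_on UNIV f"
proof (induction k arbitrary: f)
  case (Suc k)
  then obtain g h where "g \<in> set features" "h \<in> set (monomials k)" "f = (\<lambda>z. g z * h z)" by auto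
  then show ?case using Suc.IH features_continuous by (auto intro!: continuous_on_mult)
qed simp

lemma monomials_bound: "f \<in> set (monomials k) \<Longrightarrow> \<bar>f z\<bar> \<le> 1"
proof (induction k arbitrary: f)
  case (Suc k)
  then obtain g h where "g \<in> set features" "h \<in> set (monomials k)" "f = (\<lambda>z. g z * h z)" by auto
  then show ?case using Suc.IH[of h] features_bound[of g z] by (simp add: abs_mult mult_le_one)
qed simp

lemma monomials_mult: "f \<in> set (monomials k) \<Longrightarrow> g \<in> set (monomials m) \<Longrightarrow> (\<lambda>z. f z * g z) \<in> set (monomials (k + m))"
proof (induction k arbitrary: f)
  case (Suc k)
  then obtain u h where uh: "u \<in> set features" "h \<in> set (monomials k)" "f = (\<lambda>z. u z * h z)" by auto
  then have "(\<lambda>z. h z * g z) \<in> set (monomials (k + m))" using Suc by blast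
  then have "(\<lambda>z. u z * (h z * g z)) \<in> set (monomials (Suc (k + m)))" using uh(1) by auto
  then show ?case using uh(3) by (simp add: mult.assoc)
qed simp

text \<open>Equal features force the kernel to take its diagonal value 1, that is, chordal distance
  0.\<close>

lemma features_separate:
  assumes "\<And>f. f \<in> set features \<Longrightarrow> f x = f y"
  shows "x = y"
proof -
  have "sphere_kernel x y = (\<Sum>f\<leftarrow>features. f x * f x)"
    unfolding sphere_kernel_features
  proof (intro arg_cong[of _ _ sum_list] map_cong refl)
    fix f assume "f \<in> set features"
    from assms[OF this] show "f x * f y = f x * f x" by simp
  qed
  also have "\<dots> = sphere_kernel x x" by (simp add: sphere_kernel_features)
  finally have "chord x y = 0" by (simp add: sphere_kernel_def chord_def)
  then show ?thesis using one_plus_sq_pos[of x] one_plus_sq_pos[of y] by (auto simp: chord_def)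
qed

lemma sphere_kernel_bounds: "0 \<le> sphere_kernel x y" "x \<noteq> y \<Longrightarrow> sphere_kernel x y < 1"
proof -
  let ?a = "1 + (cmod x)\<^sup>2" and ?b = "1 + (cmod y)\<^sup>2"
  have pos: "0 < ?a * ?b" using one_plus_sq_pos by simp
  \<comment> \<open>The right-hand side is |1 + x * cnj y|^2, split into the squares of its real and
    imaginary parts.\<close>
  have "?a * ?b - (cmod (x - y))\<^sup>2 = (1 + (Re x * Re y + Im x * Im y))\<^sup>2 + (Im x * Re y - Re x * Im y)\<^sup>2"
    unfolding cmod_power2 by (simp add: power2_eq_square algebra_simps)
  then have "(cmod (x - y))\<^sup>2 \<le> ?a * ?b"
    using zero_le_power2[of "1 + (Re x * Re y + Im x * Im y)"] zero_le_power2[of "Im x * Re y - Re x * Im y"] by linarith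
  then have "chord x y \<le> 1" unfolding chord_def using pos by (subst pos_divide_le_eq) auto
  then show "0 \<le> sphere_kernel x y" by (simp add: sphere_kernel_def)
  assume "x \<noteq> y"
  then have "0 < chord x y" unfolding chord_def using pos by (intro divide_pos_pos) auto
  then show "sphere_kernel x y < 1" by (simp add: sphere_kernel_def)
qed

lemma ln_chord:
  assumes "x \<noteq> y"
  shows "- ln (chord x y) = - 2 * ln (cmod (x - y)) + height_weight x + height_weight y"
proof -
  have "0 < cmod (x - y)" using assms by simp
  then show ?thesis
    using one_plus_sq_pos[of x] one_plus_sq_pos[of y]
    by (simp add: chord_def height_weight_def ln_div ln_mult ln_realpow)
qed

lemma sphere_kernel_sums:
  assumes "x \<noteq> y"
  shows "(\<lambda>k. sphere_kernel x y ^ k / real k) sums (- ln (chord x y))"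
proof -
  have "\<bar>- sphere_kernel x y\<bar> < 1" using sphere_kernel_bounds[of x y] assms by simp
  from sums_minus[OF ln_series'[OF this]] show ?thesis by (simp add: sphere_kernel_def)
qed

text \<open>With values in \<open>ennreal\<close> the diagonal becomes infinite by the harmonic
  series, without a case distinction, and sums and integrals may be exchanged freely.\<close>

definition log_series :: "complex \<Rightarrow> complex \<Rightarrow> ennreal" where
  "log_series x y = (\<Sum>k. ennreal (sphere_kernel x y ^ k / real k))"

lemma log_series_eq:
  assumes "x \<noteq> y"
  shows "log_series x y = ennreal (- ln (chord x y))"
  unfolding log_series_def sums_unique[OF sphere_kernel_sums[OF assms]]
  by (rule suminf_ennreal2) (auto simp: sphere_kernel_bounds sums_summable[OF sphere_kernel_sums[OF assms]])

lemma log_series_diag: "log_series x x = \<top>"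
proof (rule ccontr)
  assume "log_series x x \<noteq> \<top>"
  then have "(\<Sum>k. ennreal (inverse (real k))) \<noteq> \<top>"
    by (simp add: log_series_def sphere_kernel_def chord_def inverse_eq_divide)
  then have "summable (\<lambda>k. inverse (real k))" by (intro summable_suminf_not_top) auto
  then show False using not_summable_harmonic[where 'a = real] by simp
qed

lemma height_weight_nonneg: "0 \<le> height_weight z"
  by (simp add: height_weight_def)

text \<open>The positive and negative parts of the kernel stand on opposite sides, so that
  everything lives in \<open>ennreal\<close> and no difference of infinities can occur, not even on
  the diagonal.\<close>

lemma log_kernel_identity:
  "2 * e2ennreal (log_kernel x y) + (ennreal (height_weight x) + ennreal (height_weight y))
    = log_series x y + 2 * e2ennreal (- log_kernel x y)"
proof (cases "x = y")
  case True
  then show ?thesis by (simp add: log_series_diag log_kernel_def ennreal_mult_top)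
next
  case False
  define k where "k = - ln (cmod (x - y))"
  let ?h = "height_weight x + height_weight y"
  have ser: "log_series x y = ennreal (2 * k + ?h)"
    unfolding log_series_eq[OF False] ln_chord[OF False] k_def by (simp add: algebra_simps)
  have nn: "0 \<le> 2 * k + ?h"
  proof -
    have "0 \<le> - ln (chord x y)"
      using sphere_kernel_bounds[of x y] False unfolding sphere_kernel_def by simp
    then show ?thesis using False by (simp add: ln_chord k_def)
  qed
  have ker: "log_kernel x y = ereal k" using False by (simp add: log_kernel_def k_def)
  have two: "2 * ennreal t = ennreal (2 * t)" for t
    by (cases "0 \<le> t") (auto simp: ennreal_mult ennreal_neg)
  have h: "ennreal (height_weight x) + ennreal (height_weight y) = ennreal ?h"
    by (simp add: height_weight_nonneg)
  have hn: "0 \<le> ?h" by (simp add: height_weight_nonneg)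
  show ?thesis
  proof (cases "0 \<le> k")
    case True
    then show ?thesis unfolding ker ser h using hn
      by (simp add: two e2ennreal_ereal ennreal_neg flip: ennreal_plus)
  next
    case False
    then have "ennreal (2 * k + ?h) + ennreal (2 * (- k)) = ennreal ?h"
      using nn by (subst ennreal_plus[symmetric]) auto
    then show ?thesis unfolding ker ser h using False
      by (simp add: two e2ennreal_ereal ennreal_neg)
  qed
qed

text \<open>This is the double integral of the k-th power of \<open>sphere_kernel\<close>. Being a
  finite sum of squares of integrals of bounded continuous functions, it passes to weak
  limits.\<close>

definition moment :: "complex measure \<Rightarrow> nat \<Rightarrow> real" where
  "moment \<mu> k = (\<Sum>f\<leftarrow>monomials k. (\<integral>z. f z \<partial>\<mu>)\<^sup>2)"

definition sphere_energy :: "complex measure \<Rightarrow> ennreal" where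
  "sphere_energy \<mu> = (\<integral>\<^sup>+x. (\<integral>\<^sup>+y. log_series x y \<partial>\<mu>) \<partial>\<mu>)"

lemma sum_list_integral:
  fixes fs :: "('a \<Rightarrow> real) list"
  assumes "\<And>f. f \<in> set fs \<Longrightarrow> integrable M f"
  shows "integrable M (\<lambda>y. \<Sum>f\<leftarrow>fs. c f * f y) \<and>
    (\<integral>y. (\<Sum>f\<leftarrow>fs. c f * f y) \<partial>M) = (\<Sum>f\<leftarrow>fs. c f * (\<integral>y. f y \<partial>M))"
  using assms by (induction fs) auto

lemma continuous_sum_list:
  fixes fs :: "('a :: topological_space \<Rightarrow> real) list"
  shows "(\<And>f. f \<in> set fs \<Longrightarrow> continuous_on UNIV f) \<Longrightarrow> continuous_on UNIV (\<lambda>y. \<Sum>f\<leftarrow>fs. c f * f y)"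
  by (induction fs) (auto intro!: continuous_intros)

lemma moment_nonneg: "0 \<le> moment \<mu> k"
  unfolding moment_def by (rule sum_list_nonneg) auto

lemma measurable_log_series [measurable]: "(\<lambda>(x, y). log_series x y) \<in> borel_measurable (borel \<Otimes>\<^sub>M borel)"
  unfolding log_series_def sphere_kernel_def chord_def by measurable

lemma measurable_log_kernel [measurable]: "(\<lambda>(x, y). log_kernel x y) \<in> borel_measurable (borel \<Otimes>\<^sub>M borel)"
  unfolding log_kernel_def by measurable

lemma measurable_height_weight [measurable]: "height_weight \<in> borel_measurable borel"
  unfolding height_weight_def by measurable

locale plane_prob = prob_space \<mu> for \<mu> :: "complex measure" +
  assumes sets_eq [measurable_cong]: "sets \<mu> = sets borel"
begin

lemma integrable_bounded_continuous:
  fixes f :: "complex \<Rightarrow> real"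
  assumes "continuous_on UNIV f" "\<And>z. \<bar>f z\<bar> \<le> B"
  shows "integrable \<mu> f"
proof (rule integrable_const_bound)
  show "AE z in \<mu>. norm (f z) \<le> B" using assms(2) by simp
  have "f \<in> borel_measurable borel" using assms(1) by (rule borel_measurable_continuous_onI)
  then show "f \<in> borel_measurable \<mu>" by measurable
qed

lemma integrable_monomials: "f \<in> set (monomials k) \<Longrightarrow> integrable \<mu> f"
  by (rule integrable_bounded_continuous[OF monomials_continuous monomials_bound])

text \<open>All terms are nonnegative, so sum and integrals may be exchanged; in each term the
  features separate the two variables.\<close>

lemma sphere_energy_eq: "sphere_energy \<mu> = (\<Sum>k. ennreal (moment \<mu> k / real k))"
proof -
  define I where "I f = (\<integral>z. f z \<partial>\<mu>)" for f :: "complex \<Rightarrow> real"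
  define G where "G k x = (\<Sum>f\<leftarrow>monomials k. I f * f x)" for k x
  have inner: "(\<integral>\<^sup>+y. ennreal (sphere_kernel x y ^ k / real k) \<partial>\<mu>) = ennreal (G k x / real k)" for x k
  proof -
    have int: "integrable \<mu> (\<lambda>y. sphere_kernel x y ^ k)"
      "(\<integral>y. sphere_kernel x y ^ k \<partial>\<mu>) = G k x"
      using sum_list_integral[of "monomials k" \<mu> "\<lambda>f. f x"] integrable_monomials
      by (simp_all add: sphere_kernel_power G_def I_def mult.commute)
    have "(\<integral>\<^sup>+y. ennreal (sphere_kernel x y ^ k / real k) \<partial>\<mu>) = ennreal (\<integral>y. sphere_kernel x y ^ k / real k \<partial>\<mu>)"
      using int(1) by (intro nn_integral_eq_integral) (auto simp: sphere_kernel_bounds)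
    then show ?thesis using int(2) by simp
  qed
  have Gn: "0 \<le> G k x" for k x
  proof -
    have "G k x = (\<integral>y. sphere_kernel x y ^ k \<partial>\<mu>)"
      using sum_list_integral[of "monomials k" \<mu> "\<lambda>f. f x"] integrable_monomials
      by (simp add: sphere_kernel_power G_def I_def mult.commute)
    then show ?thesis by (simp add: sphere_kernel_bounds)
  qed
  have cont: "continuous_on UNIV (G k)" for k
    unfolding G_def by (rule continuous_sum_list[OF monomials_continuous])
  then have Gm [measurable]: "G k \<in> borel_measurable borel" for k by (rule borel_measurable_continuous_onI)
  have outer: "(\<integral>\<^sup>+x. ennreal (G k x / real k) \<partial>\<mu>) = ennreal (moment \<mu> k / real k)" for k
  proof -
    have int: "integrable \<mu> (G k)" "(\<integral>x. G k x \<partial>\<mu>) = moment \<mu> k"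
      using sum_list_integral[of "monomials k" \<mu> I] integrable_monomials
      by (simp_all add: G_def[abs_def] I_def[symmetric] moment_def power2_eq_square)
    have "(\<integral>\<^sup>+x. ennreal (G k x / real k) \<partial>\<mu>) = ennreal (\<integral>x. G k x / real k \<partial>\<mu>)"
      using int(1) Gn by (intro nn_integral_eq_integral) auto
    then show ?thesis using int(2) by simp
  qed
  have "(\<integral>\<^sup>+y. log_series x y \<partial>\<mu>) = (\<Sum>k. ennreal (G k x / real k))" for x
    unfolding log_series_def inner[symmetric]
    by (rule nn_integral_suminf) (unfold sphere_kernel_def chord_def, measurable)
  then have "sphere_energy \<mu> = (\<integral>\<^sup>+x. (\<Sum>k. ennreal (G k x / real k)) \<partial>\<mu>)"
    by (simp add: sphere_energy_def)
  also have "\<dots> = (\<Sum>k. \<integral>\<^sup>+x. ennreal (G k x / real k) \<partial>\<mu>)"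
    by (rule nn_integral_suminf) measurable
  finally show ?thesis by (simp only: outer)
qed

lemma log_energy_identity:
  "2 * (\<integral>\<^sup>+x. (\<integral>\<^sup>+y. e2ennreal (log_kernel x y) \<partial>\<mu>) \<partial>\<mu>) + 2 * (\<integral>\<^sup>+x. ennreal (height_weight x) \<partial>\<mu>)
    = sphere_energy \<mu> + 2 * (\<integral>\<^sup>+x. (\<integral>\<^sup>+y. e2ennreal (- log_kernel x y) \<partial>\<mu>) \<partial>\<mu>)"
proof -
  let ?l = "\<integral>\<^sup>+x. ennreal (height_weight x) \<partial>\<mu>"
  have "(\<integral>\<^sup>+x. (\<integral>\<^sup>+y. 2 * e2ennreal (log_kernel x y) + (ennreal (height_weight x) + ennreal (height_weight y)) \<partial>\<mu>) \<partial>\<mu>)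
      = (\<integral>\<^sup>+x. 2 * (\<integral>\<^sup>+y. e2ennreal (log_kernel x y) \<partial>\<mu>) + (ennreal (height_weight x) + ?l) \<partial>\<mu>)"
    by (simp add: nn_integral_add nn_integral_cmult emeasure_space_1)
  also have "\<dots> = 2 * (\<integral>\<^sup>+x. (\<integral>\<^sup>+y. e2ennreal (log_kernel x y) \<partial>\<mu>) \<partial>\<mu>) + 2 * ?l"
    by (simp add: nn_integral_add nn_integral_cmult emeasure_space_1 mult_2)
  finally have left: "(\<integral>\<^sup>+x. (\<integral>\<^sup>+y. 2 * e2ennreal (log_kernel x y) + (ennreal (height_weight x) + ennreal (height_weight y)) \<partial>\<mu>) \<partial>\<mu>)
      = 2 * (\<integral>\<^sup>+x. (\<integral>\<^sup>+y. e2ennreal (log_kernel x y) \<partial>\<mu>) \<partial>\<mu>) + 2 * ?l" .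
  have "(\<integral>\<^sup>+x. (\<integral>\<^sup>+y. log_series x y + 2 * e2ennreal (- log_kernel x y) \<partial>\<mu>) \<partial>\<mu>)
      = sphere_energy \<mu> + 2 * (\<integral>\<^sup>+x. (\<integral>\<^sup>+y. e2ennreal (- log_kernel x y) \<partial>\<mu>) \<partial>\<mu>)"
    by (simp add: nn_integral_add nn_integral_cmult sphere_energy_def)
  then show ?thesis using left by (simp only: log_kernel_identity)
qed

end

section \<open>Probability measures on the Mandelbrot set\<close>

lemma mandelbrot_eq: "mandelbrot = (\<Inter>n. {c. cmod (psi n c) \<le> 2})"
proof
  show "mandelbrot \<subseteq> (\<Inter>n. {c. cmod (psi n c) \<le> 2})"
  proof (intro subsetI INT_I CollectI)
    fix c n assume "c \<in> mandelbrot"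
    then show "cmod (psi n c) \<le> 2"
      using norm_psi_le[of "n - 1" c] by (cases n) (simp_all add: lambda_inf_mandelbrot)
  qed
  show "(\<Inter>n. {c. cmod (psi n c) \<le> 2}) \<subseteq> mandelbrot"
    by (auto simp: mandelbrot_def bounded_iff intro!: exI[of _ 2])
qed

lemma continuous_psi: "continuous_on UNIV (psi n)"
  by (induction n) (simp_all add: psi_def continuous_intros)

lemma closed_mandelbrot: "closed mandelbrot"
  unfolding mandelbrot_eq
  by (intro closed_INT ballI closed_Collect_le continuous_intros continuous_psi)

lemma norm_mandelbrot: "c \<in> mandelbrot \<Longrightarrow> cmod c \<le> 2"
  using norm_le_lambda_inf[of c] lambda_inf_mandelbrot[of c] by simp

locale mandelbrot_prob = plane_prob +
  assumes AE_mandelbrot: "AE z in \<mu>. z \<in> mandelbrot"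

lemma prob_measures_on_mandelbrot: "\<mu> \<in> prob_measures_on mandelbrot \<longleftrightarrow> mandelbrot_prob \<mu>"
proof
  assume \<mu>: "\<mu> \<in> prob_measures_on mandelbrot"
  then interpret prob_space \<mu> by (simp add: prob_measures_on_def)
  have "AE z in \<mu>. z \<in> mandelbrot"
    using \<mu> by (intro AE_prob_1) (simp add: prob_measures_on_def measure_def)
  then show "mandelbrot_prob \<mu>"
    using \<mu> by unfold_locales (auto simp: prob_measures_on_def)
next
  assume "mandelbrot_prob \<mu>"
  then interpret mandelbrot_prob \<mu> .
  have "emeasure \<mu> mandelbrot = 1"
    using AE_mandelbrot closed_mandelbrot by (intro emeasure_eq_1_AE) (auto simp: sets_eq)
  then show "\<mu> \<in> prob_measures_on mandelbrot"
    using prob_space_axioms sets_eq by (simp add: prob_measures_on_def)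
qed

context mandelbrot_prob
begin

definition mean_weight :: real where
  "mean_weight = (\<integral>z. height_weight z \<partial>\<mu>)"

lemma AE_weight: "AE z in \<mu>. height_weight z \<le> ln 5"
  using AE_mandelbrot
proof eventually_elim
  case (elim z)
  then have "(cmod z)\<^sup>2 \<le> 2\<^sup>2" by (intro power_mono norm_mandelbrot) auto
  then show ?case unfolding height_weight_def by (subst ln_le_cancel_iff) (auto simp: one_plus_sq_pos)
qed

lemma integrable_weight: "integrable \<mu> height_weight"
  by (rule integrable_const_bound[of _ "ln 5"]) (use AE_weight in \<open>auto simp: height_weight_nonneg\<close>)

lemma nn_integral_weight: "(\<integral>\<^sup>+z. ennreal (height_weight z) \<partial>\<mu>) = ennreal mean_weight"
  unfolding mean_weight_def
  by (rule nn_integral_eq_integral[OF integrable_weight]) (simp add: height_weight_nonneg)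

lemma mean_weight_nonneg: "0 \<le> mean_weight"
  unfolding mean_weight_def by (rule Bochner_Integration.integral_nonneg) (rule height_weight_nonneg)

text \<open>Two points of norm at most 2 have distance at most 4, so ln 4 bounds the negative
  part.\<close>

lemma negative_part_finite: "(\<integral>\<^sup>+x. (\<integral>\<^sup>+y. e2ennreal (- log_kernel x y) \<partial>\<mu>) \<partial>\<mu>) < \<top>"
proof -
  have le: "e2ennreal (- log_kernel x y) \<le> ennreal (ln 4)" if xy: "x \<in> mandelbrot" "y \<in> mandelbrot" for x y
  proof (cases "x = y")
    case False
    have "cmod (x - y) \<le> 4"
      using norm_triangle_ineq4[of x y] norm_mandelbrot[OF xy(1)] norm_mandelbrot[OF xy(2)] by linarith
    then have "ln (cmod (x - y)) \<le> ln 4" using False by (subst ln_le_cancel_iff) auto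
    then show ?thesis using False by (simp add: log_kernel_def e2ennreal_ereal ennreal_leI)
  qed (simp add: log_kernel_def e2ennreal_neg)
  have "(\<integral>\<^sup>+x. (\<integral>\<^sup>+y. e2ennreal (- log_kernel x y) \<partial>\<mu>) \<partial>\<mu>) \<le> (\<integral>\<^sup>+x. (\<integral>\<^sup>+y. ennreal (ln 4) \<partial>\<mu>) \<partial>\<mu>)"
  proof (rule nn_integral_mono_AE)
    show "AE x in \<mu>. (\<integral>\<^sup>+y. e2ennreal (- log_kernel x y) \<partial>\<mu>) \<le> (\<integral>\<^sup>+y. ennreal (ln 4) \<partial>\<mu>)"
      using AE_mandelbrot
    proof eventually_elim
      case (elim x)
      show ?case
        by (rule nn_integral_mono_AE) (use AE_mandelbrot in eventually_elim, use le elim in blast)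
    qed
  qed
  also have "\<dots> = ennreal (ln 4)" by (simp add: emeasure_space_1)
  also have "\<dots> < \<top>" by simp
  finally show ?thesis .
qed

text \<open>Since the capacity is 1, the least energy is 0 and minimality is a statement about
  signs. Integrating \<open>log_kernel_identity\<close> shows that twice the energy is
  \<open>sphere_energy\<close> minus 2 * \<open>mean_weight\<close>; the subtracted parts are
  finite.\<close>

lemma log_energy_sign:
  "0 \<le> log_energy \<mu> \<longleftrightarrow> ennreal (2 * mean_weight) \<le> sphere_energy \<mu>"
  "log_energy \<mu> \<le> 0 \<longleftrightarrow> sphere_energy \<mu> \<le> ennreal (2 * mean_weight)"
proof -
  define a where "a = (\<integral>\<^sup>+x. (\<integral>\<^sup>+y. e2ennreal (log_kernel x y) \<partial>\<mu>) \<partial>\<mu>)"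
  define b where "b = (\<integral>\<^sup>+x. (\<integral>\<^sup>+y. e2ennreal (- log_kernel x y) \<partial>\<mu>) \<partial>\<mu>)"
  have le: "log_energy \<mu> = enn2ereal a - enn2ereal b" by (simp add: log_energy_def a_def b_def)
  have two: "2 * ennreal t = ennreal (2 * t)" if "0 \<le> t" for t using that by (simp add: ennreal_mult)
  obtain b' where b': "0 \<le> b'" "b = ennreal b'"
    using negative_part_finite unfolding b_def[symmetric] by (cases b) auto
  have eq: "2 * a + ennreal (2 * mean_weight) = sphere_energy \<mu> + ennreal (2 * b')"
    using log_energy_identity unfolding a_def[symmetric] b_def[symmetric] nn_integral_weight
    by (simp add: two b' mean_weight_nonneg)
  have "(0 \<le> log_energy \<mu> \<longleftrightarrow> ennreal (2 * mean_weight) \<le> sphere_energy \<mu>) \<and>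
    (log_energy \<mu> \<le> 0 \<longleftrightarrow> sphere_energy \<mu> \<le> ennreal (2 * mean_weight))"
  proof (cases a)
    case (real a')
    then have "sphere_energy \<mu> + ennreal (2 * b') < \<top>"
      unfolding eq[symmetric] by (simp add: two ennreal_mult_less_top)
    then have "sphere_energy \<mu> < \<top>" by simp
    then obtain e where e: "0 \<le> e" "sphere_energy \<mu> = ennreal e" by (cases "sphere_energy \<mu>") auto
    have "ennreal (2 * a' + 2 * mean_weight) = ennreal (e + 2 * b')"
      using eq real e b' mean_weight_nonneg by (simp add: two)
    then have arith: "2 * a' + 2 * mean_weight = e + 2 * b'"
      using real e b' mean_weight_nonneg by (subst (asm) ennreal_inj) auto
    have "log_energy \<mu> = ereal (a' - b')"
      using real b' by (simp add: le enn2ereal_ennreal)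
    then show ?thesis using arith e mean_weight_nonneg by (auto simp: ennreal_le_iff)
  next
    case top
    then have "sphere_energy \<mu> + ennreal (2 * b') = \<top>" unfolding eq[symmetric] by (simp add: ennreal_mult_top)
    then have "sphere_energy \<mu> = \<top>" by simp
    moreover have "log_energy \<mu> = \<infinity>" using top b' by (simp add: le enn2ereal_ennreal)
    ultimately show ?thesis by (simp add: top_unique)
  qed
  then show "0 \<le> log_energy \<mu> \<longleftrightarrow> ennreal (2 * mean_weight) \<le> sphere_energy \<mu>"
    "log_energy \<mu> \<le> 0 \<longleftrightarrow> sphere_energy \<mu> \<le> ennreal (2 * mean_weight)" by auto
qed

end

section \<open>Nonnegativity of the energy\<close>

lemma sum_minus_ln_chord:
  assumes "finite T"
  shows "(\<Sum>x\<in>T. \<Sum>y\<in>T - {x}. - ln (chord x y))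
    = - 2 * ln (disc (\<lambda>x y. cmod (x - y)) T) + 2 * (real (card T) - 1) * (\<Sum>x\<in>T. height_weight x)"
proof -
  let ?h = height_weight
  have "(\<Sum>x\<in>T. \<Sum>y\<in>T - {x}. - ln (chord x y))
      = (\<Sum>x\<in>T. \<Sum>y\<in>T - {x}. - 2 * ln (cmod (x - y)) + ?h x + ?h y)"
    by (intro sum.cong refl ln_chord) auto
  also have "\<dots> = - 2 * (\<Sum>x\<in>T. \<Sum>y\<in>T - {x}. ln (cmod (x - y)))
      + (\<Sum>x\<in>T. \<Sum>y\<in>T - {x}. ?h x) + (\<Sum>x\<in>T. \<Sum>y\<in>T - {x}. ?h y)"
    by (simp only: sum.distrib sum_distrib_left)
  also have "(\<Sum>x\<in>T. \<Sum>y\<in>T - {x}. ?h x) = (real (card T) - 1) * (\<Sum>x\<in>T. ?h x)"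
  proof -
    have "(\<Sum>y\<in>T - {x}. ?h x) = (real (card T) - 1) * ?h x" if "x \<in> T" for x
    proof -
      have "card T \<ge> 1" using that assms by (metis One_nat_def Suc_leI card_gt_0_iff empty_iff)
      then have "real (card (T - {x})) = real (card T) - 1" using that assms by simp
      then show ?thesis by simp
    qed
    then have "(\<Sum>x\<in>T. \<Sum>y\<in>T - {x}. ?h x) = (\<Sum>x\<in>T. (real (card T) - 1) * ?h x)"
      by (rule sum.cong[OF refl])
    then show ?thesis by (simp only: sum_distrib_left)
  qed
  also have "(\<Sum>x\<in>T. \<Sum>y\<in>T - {x}. ?h y) = (real (card T) - 1) * (\<Sum>x\<in>T. ?h x)"
  proof -
    have "(\<Sum>y\<in>T - {x}. ?h y) = (\<Sum>y\<in>T. ?h y) - ?h x" if "x \<in> T" for x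
      using that assms by (simp add: sum_diff1)
    then have "(\<Sum>x\<in>T. \<Sum>y\<in>T - {x}. ?h y) = (\<Sum>x\<in>T. (\<Sum>y\<in>T. ?h y) - ?h x)"
      by (rule sum.cong[OF refl])
    then show ?thesis by (simp add: sum_subtractf algebra_simps)
  qed
  also have "(\<Sum>x\<in>T. \<Sum>y\<in>T - {x}. ln (cmod (x - y))) = ln (disc (\<lambda>x y. cmod (x - y)) T)"
  proof -
    have "ln (\<Prod>y\<in>T - {x}. cmod (x - y)) = (\<Sum>y\<in>T - {x}. ln (cmod (x - y)))" for x
      using assms by (intro ln_prod) auto
    moreover have "ln (disc (\<lambda>x y. cmod (x - y)) T) = (\<Sum>x\<in>T. ln (\<Prod>y\<in>T - {x}. cmod (x - y)))"
      unfolding disc_def using assms by (intro ln_prod) auto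
    ultimately show ?thesis by simp
  qed
  finally show ?thesis by (simp add: algebra_simps)
qed

lemma minus_ln_chord_nonneg: "x \<noteq> y \<Longrightarrow> 0 \<le> - ln (chord x y)"
  using sphere_kernel_bounds[of x y] unfolding sphere_kernel_def by simp

text \<open>For distinct points this is the discriminant bound with \<open>lambda_inf\<close> equal
  to 0, rewritten with \<open>sum_minus_ln_chord\<close>: the logarithm of the discriminant is at
  most 4n ln n and enters with factor 2.\<close>

lemma log_series_sum_ge:
  assumes x: "\<And>i. i < n \<Longrightarrow> x i \<in> mandelbrot" and n: "0 < n"
  shows "(\<Sum>i<n. ennreal (2 * (real n - 1) * height_weight (x i)))
    \<le> (\<Sum>i<n. \<Sum>j\<in>{..<n} - {i}. log_series (x i) (x j)) + ennreal (8 * real n * ln (real n))"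
proof (cases "inj_on x {..<n}")
  case inj: True
  let ?T = "x ` {..<n}"
  have card: "card ?T = n" using inj by (simp add: card_image)
  have ln0: "0 \<le> ln (real n)" using n by simp
  have w0: "0 \<le> 2 * (real n - 1) * height_weight (x i)" for i
    using n by (simp add: height_weight_nonneg)
  have "(\<Sum>z\<in>?T. lambda_inf z) = 0"
    using x by (intro sum.neutral) (auto simp: lambda_inf_mandelbrot)
  then have disc: "disc (\<lambda>x y. cmod (x - y)) ?T \<le> exp (real n * (4 * ln (real n)))"
    using ln_disc_le[of ?T] card n by simp
  have pos: "0 < disc (\<lambda>x y. cmod (x - y)) ?T"
    unfolding disc_def by (intro prod_pos) auto
  have "ln (disc (\<lambda>x y. cmod (x - y)) ?T) \<le> ln (exp (real n * (4 * ln (real n))))"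
    using disc pos by (subst ln_le_cancel_iff) auto
  then have "ln (disc (\<lambda>x y. cmod (x - y)) ?T) \<le> real n * (4 * ln (real n))" by simp
  then have "2 * (real n - 1) * (\<Sum>z\<in>?T. height_weight z)
      \<le> (\<Sum>z\<in>?T. \<Sum>y\<in>?T - {z}. - ln (chord z y)) + 8 * real n * ln (real n)"
    using sum_minus_ln_chord[of ?T] card by simp
  also have "(\<Sum>z\<in>?T. \<Sum>y\<in>?T - {z}. - ln (chord z y)) = (\<Sum>i<n. \<Sum>j\<in>{..<n} - {i}. - ln (chord (x i) (x j)))"
  proof -
    have "(\<Sum>y\<in>?T - {x i}. - ln (chord (x i) y)) = (\<Sum>j\<in>{..<n} - {i}. - ln (chord (x i) (x j)))" if "i < n" for i
    proof -
      have "?T - {x i} = x ` ({..<n} - {i})" using inj that by (auto simp: inj_on_def)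
      moreover have "inj_on x ({..<n} - {i})" using inj by (rule inj_on_subset) auto
      ultimately show ?thesis by (simp add: sum.reindex)
    qed
    then show ?thesis using inj by (simp add: sum.reindex)
  qed
  also have "(\<Sum>z\<in>?T. height_weight z) = (\<Sum>i<n. height_weight (x i))" using inj by (simp add: sum.reindex)
  finally have main: "(\<Sum>i<n. 2 * (real n - 1) * height_weight (x i))
      \<le> (\<Sum>i<n. \<Sum>j\<in>{..<n} - {i}. - ln (chord (x i) (x j))) + 8 * real n * ln (real n)"
    by (simp add: sum_distrib_left)
  have ne: "x i \<noteq> x j" if "i < n" "j \<in> {..<n} - {i}" for i j
    using inj that by (auto simp: inj_on_def)
  have nn: "0 \<le> - ln (chord (x i) (x j))" if "i < n" "j \<in> {..<n} - {i}" for i j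
    by (rule minus_ln_chord_nonneg[OF ne[OF that]])
  have "(\<Sum>i<n. \<Sum>j\<in>{..<n} - {i}. log_series (x i) (x j)) = (\<Sum>i<n. \<Sum>j\<in>{..<n} - {i}. ennreal (- ln (chord (x i) (x j))))"
    by (intro sum.cong refl log_series_eq ne) auto
  also have "\<dots> = (\<Sum>i<n. ennreal (\<Sum>j\<in>{..<n} - {i}. - ln (chord (x i) (x j))))"
    by (intro sum.cong refl sum_ennreal nn) auto
  also have "\<dots> = ennreal (\<Sum>i<n. \<Sum>j\<in>{..<n} - {i}. - ln (chord (x i) (x j)))"
    by (intro sum_ennreal sum_nonneg nn) auto
  finally have ser: "(\<Sum>i<n. \<Sum>j\<in>{..<n} - {i}. log_series (x i) (x j))
    = ennreal (\<Sum>i<n. \<Sum>j\<in>{..<n} - {i}. - ln (chord (x i) (x j)))" .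
  have "(\<Sum>i<n. ennreal (2 * (real n - 1) * height_weight (x i))) = ennreal (\<Sum>i<n. 2 * (real n - 1) * height_weight (x i))"
    by (intro sum_ennreal w0)
  also have "\<dots> \<le> ennreal ((\<Sum>i<n. \<Sum>j\<in>{..<n} - {i}. - ln (chord (x i) (x j))) + 8 * real n * ln (real n))"
    by (rule ennreal_leI[OF main])
  also have "\<dots> = ennreal (\<Sum>i<n. \<Sum>j\<in>{..<n} - {i}. - ln (chord (x i) (x j))) + ennreal (8 * real n * ln (real n))"
    using ln0 by (intro ennreal_plus sum_nonneg nn) auto
  finally show ?thesis unfolding ser .
next
  \<comment> \<open>Coinciding points make the right-hand side infinite through the diagonal of
    \<open>log_series\<close>.\<close>
  case False
  then obtain i j where ij: "i < n" "j < n" "i \<noteq> j" "x i = x j" by (auto simp: inj_on_def)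
  have "log_series (x i) (x j) \<le> (\<Sum>j\<in>{..<n} - {i}. log_series (x i) (x j))"
    using ij by (intro member_le_sum) auto
  also have "\<dots> \<le> (\<Sum>i<n. \<Sum>j\<in>{..<n} - {i}. log_series (x i) (x j))"
    using ij by (intro member_le_sum) auto
  finally have top: "(\<Sum>i<n. \<Sum>j\<in>{..<n} - {i}. log_series (x i) (x j)) = \<top>"
    unfolding ij(4) log_series_diag by (rule top_unique[THEN iffD1])
  show ?thesis unfolding top by simp
qed

lemma (in prob_space) distr_PiM_pair:
  assumes "finite I" "i \<in> I" "j \<in> I" "i \<noteq> j"
  shows "distr (PiM I (\<lambda>_. M)) (M \<Otimes>\<^sub>M M) (\<lambda>x. (x i, x j)) = M \<Otimes>\<^sub>M M"
proof -
  interpret product_prob_space "\<lambda>_. M" I by unfold_locales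
  have m [measurable]: "(\<lambda>x. (x i, x j)) \<in> measurable (PiM I (\<lambda>_. M)) (M \<Otimes>\<^sub>M M)"
    using assms by measurable
  have "M \<Otimes>\<^sub>M M = distr (PiM I (\<lambda>_. M)) (M \<Otimes>\<^sub>M M) (\<lambda>x. (x i, x j))"
  proof (rule pair_measure_eqI)
    show "sigma_finite_measure M" "sigma_finite_measure M" by unfold_locales
    fix A B assume AB: "A \<in> sets M" "B \<in> sets M"
    let ?X = "\<lambda>k. if k = i then A else B"
    have "emeasure (distr (PiM I (\<lambda>_. M)) (M \<Otimes>\<^sub>M M) (\<lambda>x. (x i, x j))) (A \<times> B)
        = emeasure (PiM I (\<lambda>_. M)) ((\<lambda>x. (x i, x j)) -` (A \<times> B) \<inter> space (PiM I (\<lambda>_. M)))"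
      using AB by (intro emeasure_distr m) auto
    also have "(\<lambda>x. (x i, x j)) -` (A \<times> B) \<inter> space (PiM I (\<lambda>_. M))
        = {x \<in> space (PiM I (\<lambda>_. M)). \<forall>k\<in>{i, j}. x k \<in> ?X k}"
      using assms(4) by auto
    also have "emeasure (PiM I (\<lambda>_. M)) \<dots> = (\<Prod>k\<in>{i, j}. emeasure M (?X k))"
      using assms AB by (intro emeasure_PiM_Collect) auto
    also have "\<dots> = emeasure M A * emeasure M B" using assms(4) by simp
    finally show "emeasure M A * emeasure M B
        = emeasure (distr (PiM I (\<lambda>_. M)) (M \<Otimes>\<^sub>M M) (\<lambda>x. (x i, x j))) (A \<times> B)" ..
  qed simp
  then show ?thesis ..
qed

context mandelbrot_prob
begin

text \<open>Averaging the bound for \<open>n\<close> points over independent points with law \<open>\<mu>\<close> shows that \<open>\<mu>\<close> has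
  nonnegative energy.\<close>

lemma sphere_energy_ge: "ennreal (2 * mean_weight) \<le> sphere_energy \<mu>"
proof (cases "sphere_energy \<mu>")
  case (real e)
  \<comment> \<open>Under the product measure each of the n(n - 1) ordered pairs contributes
    \<open>e\<close>, and each point 2(n - 1) times \<open>mean_weight\<close>. Division by n(n - 1)
    leaves an error that tends to 0.\<close>
  have step: "2 * mean_weight \<le> e + 8 * ln (real n) / (real n - 1)" if n: "2 \<le> n" for n
  proof -
    define Q where "Q = PiM {..<n} (\<lambda>_. \<mu>)"
    note prob = prob_space_axioms and fubini = nn_integral_fst and pair_law = distr_PiM_pair
    interpret Q: prob_space Q unfolding Q_def using prob by (intro prob_space_PiM)
    interpret product_prob_space "\<lambda>_. \<mu>" "{..<n}" by unfold_locales
    have comp [measurable]: "(\<lambda>x. x i) \<in> measurable Q \<mu>" if "i < n" for i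
      unfolding Q_def using that by (intro measurable_component_singleton) simp
    have comp': "(\<lambda>x. x i) \<in> borel_measurable Q" if "i < n" for i
      using comp[OF that] by (simp cong: measurable_cong_sets add: sets_eq)
    have ser_m: "(\<lambda>x. log_series (x i) (x j)) \<in> borel_measurable Q" if "i < n" "j < n" for i j
      using measurable_compose[OF measurable_Pair[OF comp'[OF that(1)] comp'[OF that(2)]] measurable_log_series] by simp
    have ser: "(\<integral>\<^sup>+x. log_series (x i) (x j) \<partial>Q) = ennreal e" if ij: "i < n" "j \<in> {..<n} - {i}" for i j
    proof -
      have pm: "(\<lambda>x. (x i, x j)) \<in> measurable Q (\<mu> \<Otimes>\<^sub>M \<mu>)"
        using ij by (intro measurable_Pair comp) auto
      have lm: "(\<lambda>(x, y). log_series x y) \<in> borel_measurable (\<mu> \<Otimes>\<^sub>M \<mu>)" by measurable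
      have "ennreal e = (\<integral>\<^sup>+x. (\<integral>\<^sup>+y. log_series x y \<partial>\<mu>) \<partial>\<mu>)" using real by (simp add: sphere_energy_def)
      also have "\<dots> = (\<integral>\<^sup>+z. (case z of (x, y) \<Rightarrow> log_series x y) \<partial>(\<mu> \<Otimes>\<^sub>M \<mu>))"
        using fubini[OF lm] by simp
      also have "\<mu> \<Otimes>\<^sub>M \<mu> = distr Q (\<mu> \<Otimes>\<^sub>M \<mu>) (\<lambda>x. (x i, x j))"
        unfolding Q_def using ij by (intro pair_law[symmetric]) auto
      also have "(\<integral>\<^sup>+z. (case z of (x, y) \<Rightarrow> log_series x y) \<partial>distr Q (\<mu> \<Otimes>\<^sub>M \<mu>) (\<lambda>x. (x i, x j)))
          = (\<integral>\<^sup>+x. log_series (x i) (x j) \<partial>Q)"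
        using lm by (subst nn_integral_distr[OF pm]) simp_all
      finally show ?thesis ..
    qed
    have wt_m: "(\<lambda>x. ennreal (c * height_weight (x i))) \<in> borel_measurable Q" if "i < n" for i c
      using measurable_compose[OF comp'[OF that] measurable_height_weight] by simp
    have wt: "(\<integral>\<^sup>+x. ennreal (2 * (real n - 1) * height_weight (x i)) \<partial>Q) = ennreal (2 * (real n - 1) * mean_weight)"
      if i: "i < n" for i
    proof -
      have "(\<integral>\<^sup>+x. ennreal (2 * (real n - 1) * height_weight (x i)) \<partial>Q)
          = (\<integral>\<^sup>+z. ennreal (2 * (real n - 1) * height_weight z) \<partial>distr Q \<mu> (\<lambda>x. x i))"
        by (rule nn_integral_distr[OF comp[OF i], symmetric]) measurable
      also have "distr Q \<mu> (\<lambda>x. x i) = \<mu>"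
        unfolding Q_def using i by (intro distr_PiM_component prob) auto
      also have "(\<integral>\<^sup>+z. ennreal (2 * (real n - 1) * height_weight z) \<partial>\<mu>) = ennreal (\<integral>z. 2 * (real n - 1) * height_weight z \<partial>\<mu>)"
        using n integrable_weight by (intro nn_integral_eq_integral) (auto simp: height_weight_nonneg)
      finally show ?thesis by (simp add: mean_weight_def)
    qed
    have ae: "AE x in Q. \<forall>i\<in>{..<n}. x i \<in> mandelbrot"
    proof (rule AE_finite_allI)
      fix i assume "i \<in> {..<n}"
      then show "AE x in Q. x i \<in> mandelbrot"
        unfolding Q_def by (rule AE_component) (rule AE_mandelbrot)
    qed simp
    have "(\<integral>\<^sup>+x. (\<Sum>i<n. ennreal (2 * (real n - 1) * height_weight (x i))) \<partial>Q)
        \<le> (\<integral>\<^sup>+x. (\<Sum>i<n. \<Sum>j\<in>{..<n} - {i}. log_series (x i) (x j)) + ennreal (8 * real n * ln (real n)) \<partial>Q)"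
    proof (rule nn_integral_mono_AE)
      show "AE x in Q. (\<Sum>i<n. ennreal (2 * (real n - 1) * height_weight (x i)))
          \<le> (\<Sum>i<n. \<Sum>j\<in>{..<n} - {i}. log_series (x i) (x j)) + ennreal (8 * real n * ln (real n))"
        using ae
      proof eventually_elim
        case (elim x)
        show ?case by (rule log_series_sum_ge) (use elim n in auto)
      qed
    qed
    also have "\<dots> = (\<Sum>i<n. \<Sum>j\<in>{..<n} - {i}. ennreal e) + ennreal (8 * real n * ln (real n))"
    proof -
      have "(\<integral>\<^sup>+x. (\<Sum>i<n. \<Sum>j\<in>{..<n} - {i}. log_series (x i) (x j)) + ennreal (8 * real n * ln (real n)) \<partial>Q)
          = (\<integral>\<^sup>+x. (\<Sum>i<n. \<Sum>j\<in>{..<n} - {i}. log_series (x i) (x j)) \<partial>Q) + ennreal (8 * real n * ln (real n))"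
        using ser_m by (subst nn_integral_add) (auto simp: Q.emeasure_space_1 intro!: borel_measurable_sum)
      also have "(\<integral>\<^sup>+x. (\<Sum>i<n. \<Sum>j\<in>{..<n} - {i}. log_series (x i) (x j)) \<partial>Q)
          = (\<Sum>i<n. \<integral>\<^sup>+x. (\<Sum>j\<in>{..<n} - {i}. log_series (x i) (x j)) \<partial>Q)"
        using ser_m by (intro nn_integral_sum borel_measurable_sum) auto
      also have "\<dots> = (\<Sum>i<n. \<Sum>j\<in>{..<n} - {i}. \<integral>\<^sup>+x. log_series (x i) (x j) \<partial>Q)"
        using ser_m by (intro sum.cong refl nn_integral_sum) auto
      also have "\<dots> = (\<Sum>i<n. \<Sum>j\<in>{..<n} - {i}. ennreal e)"
        by (intro sum.cong refl ser) auto
      finally show ?thesis .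
    qed
    also have "(\<integral>\<^sup>+x. (\<Sum>i<n. ennreal (2 * (real n - 1) * height_weight (x i))) \<partial>Q)
        = (\<Sum>i<n. \<integral>\<^sup>+x. ennreal (2 * (real n - 1) * height_weight (x i)) \<partial>Q)"
      using wt_m by (intro nn_integral_sum) auto
    also have "\<dots> = (\<Sum>i<n. ennreal (2 * (real n - 1) * mean_weight))"
      by (intro sum.cong refl wt) auto
    also have "\<dots> = ennreal (\<Sum>i<n. 2 * (real n - 1) * mean_weight)"
      using n mean_weight_nonneg by (intro sum_ennreal) auto
    also have "(\<Sum>i<n. \<Sum>j\<in>{..<n} - {i}. ennreal e) = ennreal (\<Sum>i<n. \<Sum>j\<in>{..<n} - {i}. e)"
    proof -
      have "(\<Sum>i<n. \<Sum>j\<in>{..<n} - {i}. ennreal e) = (\<Sum>i<n. ennreal (\<Sum>j\<in>{..<n} - {i}. e))"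
        by (intro sum.cong refl sum_ennreal) (rule real)
      also have "\<dots> = ennreal (\<Sum>i<n. \<Sum>j\<in>{..<n} - {i}. e)"
        by (intro sum_ennreal sum_nonneg) (rule real)
      finally show ?thesis .
    qed
    also have "\<dots> + ennreal (8 * real n * ln (real n)) = ennreal ((\<Sum>i<n. \<Sum>j\<in>{..<n} - {i}. e) + 8 * real n * ln (real n))"
      using real n by (intro ennreal_plus[symmetric] sum_nonneg) auto
    finally have "(\<Sum>i<n. 2 * (real n - 1) * mean_weight) \<le> (\<Sum>i<n. \<Sum>j\<in>{..<n} - {i}. e) + 8 * real n * ln (real n)"
      using real n by (subst (asm) ennreal_le_iff) (auto intro!: add_nonneg_nonneg sum_nonneg)
    moreover have "(\<Sum>i<n. \<Sum>j\<in>{..<n} - {i}. e) = real n * ((real n - 1) * e)"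
      using n by (simp add: of_nat_diff)
    ultimately have "real n * ((real n - 1) * (2 * mean_weight)) \<le> real n * ((real n - 1) * e + 8 * ln (real n))"
      by (simp add: algebra_simps)
    then have "(real n - 1) * (2 * mean_weight) \<le> (real n - 1) * e + 8 * ln (real n)" using n by simp
    then show ?thesis using n by (simp add: field_simps)
  qed
  have "(\<lambda>n. 8 * ln (real n) / (real n - 1)) \<longlonglongrightarrow> 0" by real_asymp
  then have "(\<lambda>n. e + 8 * ln (real n) / (real n - 1)) \<longlonglongrightarrow> e + 0" by (intro tendsto_add tendsto_const)
  then have lim: "(\<lambda>n. e + 8 * ln (real n) / (real n - 1)) \<longlonglongrightarrow> e" by simp
  have "2 * mean_weight \<le> e"
    by (rule LIMSEQ_le_const[OF lim]) (use step in blast)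
  then show ?thesis unfolding real(2) by (rule ennreal_leI)
qed simp

end

section \<open>Strict convexity and uniqueness of the minimizer\<close>

lemma ennreal_half:
  assumes "0 \<le> a" "0 \<le> b"
  shows "ennreal a * ennreal (1 / 2) + ennreal b * ennreal (1 / 2) = ennreal ((a + b) / 2)"
proof -
  have "ennreal t * ennreal (1 / 2) = ennreal (t * (1 / 2))" if "0 \<le> t" for t
    using that by (intro ennreal_mult[symmetric]) auto
  then have "ennreal a * ennreal (1 / 2) + ennreal b * ennreal (1 / 2) = ennreal (a * (1 / 2)) + ennreal (b * (1 / 2))"
    using assms by simp
  also have "\<dots> = ennreal (a * (1 / 2) + b * (1 / 2))" using assms by (intro ennreal_plus[symmetric]) auto
  finally show ?thesis by (simp add: add_divide_distrib)
qed

text \<open>The midpoint of two measures, encoded as the law obtained by tossing a fair coin to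
  choose one of them.\<close>

definition mix :: "complex measure \<Rightarrow> complex measure \<Rightarrow> complex measure" where
  "mix \<mu> \<nu> = measure_pmf (bernoulli_pmf (1 / 2)) \<bind> (\<lambda>b. if b then \<mu> else \<nu>)"

locale two_mandelbrot = mu: mandelbrot_prob \<mu> + nu: mandelbrot_prob \<nu> for \<mu> \<nu>
begin

lemma kernel_measurable:
  "(\<lambda>b. if b then \<mu> else \<nu>) \<in> measurable (measure_pmf (bernoulli_pmf (1 / 2))) (subprob_algebra borel)"
  using mu.sets_eq nu.sets_eq mu.subprob_space_axioms nu.subprob_space_axioms
  by (auto simp: space_subprob_algebra)

lemma nn_integral_mix:
  assumes "f \<in> borel_measurable borel"
  shows "(\<integral>\<^sup>+z. f z \<partial>mix \<mu> \<nu>) = (\<integral>\<^sup>+z. f z \<partial>\<mu>) * ennreal (1 / 2) + (\<integral>\<^sup>+z. f z \<partial>\<nu>) * ennreal (1 / 2)"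
  unfolding mix_def nn_integral_bind[OF assms kernel_measurable] by (subst nn_integral_bernoulli_pmf) auto

lemma sets_mix: "sets (mix \<mu> \<nu>) = sets borel"
  unfolding mix_def by (rule sets_bind) (auto simp: mu.sets_eq nu.sets_eq)

lemma half: "a * ennreal (1 / 2) + a * ennreal (1 / 2) = a"
proof -
  have "ennreal (1 / 2) + ennreal (1 / 2) = ennreal (1 / 2 + 1 / 2)" by (rule ennreal_plus[symmetric]) auto
  then show ?thesis by (simp flip: distrib_left)
qed

lemma mandelbrot_prob_mix: "mandelbrot_prob (mix \<mu> \<nu>)"
proof -
  have sp: "space (mix \<mu> \<nu>) = UNIV" using sets_eq_imp_space_eq[OF sets_mix] by simp
  have em: "emeasure (mix \<mu> \<nu>) A = 1"
    if A: "A \<in> sets borel" "emeasure \<mu> A = 1" "emeasure \<nu> A = 1" for A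
  proof -
    have "emeasure (mix \<mu> \<nu>) A = (\<integral>\<^sup>+z. indicator A z \<partial>mix \<mu> \<nu>)" using A(1) sets_mix by simp
    also have "\<dots> = emeasure \<mu> A * ennreal (1 / 2) + emeasure \<nu> A * ennreal (1 / 2)"
      using A(1) mu.sets_eq nu.sets_eq by (subst nn_integral_mix) auto
    also have "\<dots> = 1" unfolding A(2,3) by (rule half)
    finally show ?thesis .
  qed
  have "emeasure \<mu> UNIV = 1" "emeasure \<nu> UNIV = 1"
    using mu.emeasure_space_1 nu.emeasure_space_1 sets_eq_imp_space_eq[OF mu.sets_eq] sets_eq_imp_space_eq[OF nu.sets_eq] by simp_all
  then have "emeasure (mix \<mu> \<nu>) UNIV = 1" by (intro em) auto
  then have prob: "prob_space (mix \<mu> \<nu>)" by (intro prob_spaceI) (simp add: sp)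
  have "\<mu> \<in> prob_measures_on mandelbrot" "\<nu> \<in> prob_measures_on mandelbrot"
    unfolding prob_measures_on_mandelbrot by unfold_locales
  then have "emeasure (mix \<mu> \<nu>) mandelbrot = 1"
    using closed_mandelbrot by (intro em) (auto simp: prob_measures_on_def)
  then have "mix \<mu> \<nu> \<in> prob_measures_on mandelbrot"
    using prob sets_mix by (simp add: prob_measures_on_def)
  then show ?thesis by (simp add: prob_measures_on_mandelbrot)
qed

sublocale mixed: mandelbrot_prob "mix \<mu> \<nu>" by (rule mandelbrot_prob_mix)

lemma mean_weight_mix: "mixed.mean_weight = (mu.mean_weight + nu.mean_weight) / 2"
proof -
  have "ennreal mixed.mean_weight = ennreal mu.mean_weight * ennreal (1 / 2) + ennreal nu.mean_weight * ennreal (1 / 2)"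
    unfolding mixed.nn_integral_weight[symmetric] mu.nn_integral_weight[symmetric] nu.nn_integral_weight[symmetric]
    by (rule nn_integral_mix) measurable
  also have "\<dots> = ennreal ((mu.mean_weight + nu.mean_weight) / 2)"
    by (rule ennreal_half[OF mu.mean_weight_nonneg nu.mean_weight_nonneg])
  finally show ?thesis
    using mixed.mean_weight_nonneg mu.mean_weight_nonneg nu.mean_weight_nonneg by (subst (asm) ennreal_inj) auto
qed

text \<open>Adding 1 makes \<open>f\<close> nonnegative, so the formula for nonnegative integrals
  applies.\<close>

lemma integral_mix:
  fixes f :: "complex \<Rightarrow> real"
  assumes f: "continuous_on UNIV f" "\<And>z. \<bar>f z\<bar> \<le> 1"
  shows "(\<integral>z. f z \<partial>mix \<mu> \<nu>) = ((\<integral>z. f z \<partial>\<mu>) + (\<integral>z. f z \<partial>\<nu>)) / 2"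
proof -
  have nn: "0 \<le> f z + 1" for z using f(2)[of z] by linarith
  have shift: "(\<integral>\<^sup>+z. ennreal (f z + 1) \<partial>\<rho>) = ennreal ((\<integral>z. f z \<partial>\<rho>) + 1) \<and> 0 \<le> (\<integral>z. f z \<partial>\<rho>) + 1"
    if "plane_prob \<rho>" for \<rho>
  proof -
    interpret plane_prob \<rho> by (rule that)
    have int: "integrable \<rho> f" by (rule integrable_bounded_continuous[OF f])
    have eq: "(\<integral>z. f z + 1 \<partial>\<rho>) = (\<integral>z. f z \<partial>\<rho>) + 1" using int by (simp add: prob_space)
    have "(\<integral>\<^sup>+z. ennreal (f z + 1) \<partial>\<rho>) = ennreal (\<integral>z. f z + 1 \<partial>\<rho>)"
      using int nn by (intro nn_integral_eq_integral) auto
    moreover have "0 \<le> (\<integral>z. f z + 1 \<partial>\<rho>)" by (rule Bochner_Integration.integral_nonneg) (rule nn)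
    ultimately show ?thesis using eq by simp
  qed
  note m = shift[OF mu.plane_prob_axioms] and n = shift[OF nu.plane_prob_axioms] and s = shift[OF mixed.plane_prob_axioms]
  have fm: "(\<lambda>z. ennreal (f z + 1)) \<in> borel_measurable borel"
    using borel_measurable_continuous_onI[OF f(1)] by measurable
  have "ennreal ((\<integral>z. f z \<partial>mix \<mu> \<nu>) + 1)
      = ennreal ((\<integral>z. f z \<partial>\<mu>) + 1) * ennreal (1 / 2) + ennreal ((\<integral>z. f z \<partial>\<nu>) + 1) * ennreal (1 / 2)"
    unfolding conjunct1[OF m, symmetric] conjunct1[OF n, symmetric] conjunct1[OF s, symmetric]
    by (rule nn_integral_mix[OF fm])
  also have "\<dots> = ennreal (((\<integral>z. f z \<partial>\<mu>) + 1 + ((\<integral>z. f z \<partial>\<nu>) + 1)) / 2)"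
    by (rule ennreal_half[OF conjunct2[OF m] conjunct2[OF n]])
  finally have "(\<integral>z. f z \<partial>mix \<mu> \<nu>) + 1 = ((\<integral>z. f z \<partial>\<mu>) + 1 + ((\<integral>z. f z \<partial>\<nu>) + 1)) / 2"
    using m n s by (subst (asm) ennreal_inj) auto
  then show ?thesis by (simp add: field_simps)
qed

definition moment_dist :: "nat \<Rightarrow> real" where
  "moment_dist k = (\<Sum>f\<leftarrow>monomials k. ((\<integral>z. f z \<partial>\<mu>) - (\<integral>z. f z \<partial>\<nu>))\<^sup>2)"

lemma parallelogram:
  "moment (mix \<mu> \<nu>) k + moment_dist k / 4 = (moment \<mu> k + moment \<nu> k) / 2"
proof -
  have "(\<Sum>f\<leftarrow>fs. (\<integral>z. f z \<partial>mix \<mu> \<nu>)\<^sup>2) + (\<Sum>f\<leftarrow>fs. ((\<integral>z. f z \<partial>\<mu>) - (\<integral>z. f z \<partial>\<nu>))\<^sup>2) / 4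
      = ((\<Sum>f\<leftarrow>fs. (\<integral>z. f z \<partial>\<mu>)\<^sup>2) + (\<Sum>f\<leftarrow>fs. (\<integral>z. f z \<partial>\<nu>)\<^sup>2)) / 2"
    if "set fs \<subseteq> set (monomials k)" for fs :: "(complex \<Rightarrow> real) list"
    using that
  proof (induction fs)
    case (Cons f fs)
    have mix: "(\<integral>z. f z \<partial>mix \<mu> \<nu>) = ((\<integral>z. f z \<partial>\<mu>) + (\<integral>z. f z \<partial>\<nu>)) / 2"
      using Cons.prems by (intro integral_mix monomials_continuous monomials_bound) auto
    have sq: "((a + b) / 2)\<^sup>2 + (a - b)\<^sup>2 / 4 = (a\<^sup>2 + b\<^sup>2) / 2" for a b :: real
      by (simp add: power2_eq_square field_simps)
    have "(\<integral>z. f z \<partial>mix \<mu> \<nu>)\<^sup>2 + ((\<integral>z. f z \<partial>\<mu>) - (\<integral>z. f z \<partial>\<nu>))\<^sup>2 / 4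
        = ((\<integral>z. f z \<partial>\<mu>)\<^sup>2 + (\<integral>z. f z \<partial>\<nu>)\<^sup>2) / 2"
      unfolding mix by (rule sq)
    then show ?case using Cons by (simp add: add_divide_distrib)
  qed simp
  then show ?thesis by (simp add: moment_def moment_dist_def)
qed

lemma moment_dist_nonneg: "0 \<le> moment_dist k"
  unfolding moment_dist_def by (rule sum_list_nonneg) auto

text \<open>The parallelogram law summed with weights 1/k. The defect of convexity is a weighted
  squared distance between the integrals of all monomials; it is added on the left so that infinite
  energies cause no trouble.\<close>

lemma sphere_energy_mix:
  "sphere_energy (mix \<mu> \<nu>) + (\<Sum>k. ennreal (moment_dist k / 4 / real k))
    = sphere_energy \<mu> * ennreal (1 / 2) + sphere_energy \<nu> * ennreal (1 / 2)"
proof -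
  have "sphere_energy (mix \<mu> \<nu>) + (\<Sum>k. ennreal (moment_dist k / 4 / real k))
      = (\<Sum>k. ennreal (moment (mix \<mu> \<nu>) k / real k) + ennreal (moment_dist k / 4 / real k))"
    unfolding mixed.sphere_energy_eq by (rule suminf_add) (simp_all add: summableI)
  also have "\<dots> = (\<Sum>k. ennreal (moment \<mu> k / real k) * ennreal (1 / 2) + ennreal (moment \<nu> k / real k) * ennreal (1 / 2))"
  proof (rule suminf_cong)
    fix k
    have "ennreal (moment (mix \<mu> \<nu>) k / real k) + ennreal (moment_dist k / 4 / real k)
        = ennreal (moment (mix \<mu> \<nu>) k / real k + moment_dist k / 4 / real k)"
      by (intro ennreal_plus[symmetric] divide_nonneg_nonneg moment_nonneg moment_dist_nonneg) auto
    also have "moment (mix \<mu> \<nu>) k / real k + moment_dist k / 4 / real k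
        = (moment (mix \<mu> \<nu>) k + moment_dist k / 4) / real k"
      by (rule add_divide_distrib[symmetric])
    also have "\<dots> = (moment \<mu> k / real k + moment \<nu> k / real k) / 2"
      unfolding parallelogram by (simp add: add_divide_distrib)
    also have "ennreal \<dots> = ennreal (moment \<mu> k / real k) * ennreal (1 / 2) + ennreal (moment \<nu> k / real k) * ennreal (1 / 2)"
      by (intro ennreal_half[symmetric] divide_nonneg_nonneg moment_nonneg) auto
    finally show "ennreal (moment (mix \<mu> \<nu>) k / real k) + ennreal (moment_dist k / 4 / real k)
        = ennreal (moment \<mu> k / real k) * ennreal (1 / 2) + ennreal (moment \<nu> k / real k) * ennreal (1 / 2)" .
  qed
  also have "\<dots> = sphere_energy \<mu> * ennreal (1 / 2) + sphere_energy \<nu> * ennreal (1 / 2)"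
    unfolding mu.sphere_energy_eq nu.sphere_energy_eq
    by (simp add: suminf_add[symmetric] ennreal_suminf_multc summableI)
  finally show ?thesis .
qed

text \<open>The midpoint has energy at least 0 by \<open>sphere_energy_ge\<close>, which leaves no
  room for a positive convexity defect. The degree k = 0 is separate, since its weight 1/0 is 0;
  there both integrals are the total mass.\<close>

lemma integral_monomials_eq:
  assumes "sphere_energy \<mu> \<le> ennreal (2 * mu.mean_weight)" "sphere_energy \<nu> \<le> ennreal (2 * nu.mean_weight)"
    and f: "f \<in> set (monomials k)"
  shows "(\<integral>z. f z \<partial>\<mu>) = (\<integral>z. f z \<partial>\<nu>)"
proof (cases "k = 0")
  case True
  then show ?thesis using f by (simp add: mu.prob_space nu.prob_space)
next
  case False
  let ?D = "\<Sum>k. ennreal (moment_dist k / 4 / real k)"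
  have "sphere_energy (mix \<mu> \<nu>) + ?D \<le> ennreal (2 * mu.mean_weight) * ennreal (1 / 2) + ennreal (2 * nu.mean_weight) * ennreal (1 / 2)"
    unfolding sphere_energy_mix by (intro add_mono mult_right_mono assms) auto
  also have "\<dots> = ennreal ((2 * mu.mean_weight + 2 * nu.mean_weight) / 2)"
    using mu.mean_weight_nonneg nu.mean_weight_nonneg by (intro ennreal_half) auto
  also have "(2 * mu.mean_weight + 2 * nu.mean_weight) / 2 = 2 * mixed.mean_weight"
    by (simp add: mean_weight_mix)
  finally have le: "sphere_energy (mix \<mu> \<nu>) + ?D \<le> ennreal (2 * mixed.mean_weight)" .
  have "ennreal (2 * mixed.mean_weight) + ?D \<le> sphere_energy (mix \<mu> \<nu>) + ?D"
    by (intro add_right_mono mixed.sphere_energy_ge)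
  from order_trans[OF this le]
  have "ennreal (2 * mixed.mean_weight) + ?D \<le> ennreal (2 * mixed.mean_weight) + 0" by (simp only: add_0_right)
  then have "?D \<le> 0" by (subst (asm) ennreal_add_left_cancel_le) simp
  then have "?D = 0" by simp
  then have "ennreal (moment_dist k / 4 / real k) = 0"
    using suminf_eq_zero_iff[OF summableI, of "\<lambda>k. ennreal (moment_dist k / 4 / real k)"] by simp
  then have "moment_dist k = 0"
    using False moment_dist_nonneg[of k] by (simp add: ennreal_eq_0_iff divide_le_0_iff)
  then have "\<forall>y\<in>set (map (\<lambda>f. ((\<integral>z. f z \<partial>\<mu>) - (\<integral>z. f z \<partial>\<nu>))\<^sup>2) (monomials k)). y = 0"
    unfolding moment_dist_def by (subst (asm) sum_list_nonneg_eq_0_iff) auto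
  then show ?thesis using f by auto
qed

text \<open>The linear span of the monomials. It is closed under products because products of
  monomials are again monomials, which is what the Stone-Weierstrass theorem requires.\<close>

inductive_set algebra :: "(complex \<Rightarrow> real) set" where
  base: "f \<in> set (monomials k) \<Longrightarrow> f \<in> algebra"
| sum: "f \<in> algebra \<Longrightarrow> g \<in> algebra \<Longrightarrow> (\<lambda>z. f z + g z) \<in> algebra"
| scale: "f \<in> algebra \<Longrightarrow> (\<lambda>z. c * f z) \<in> algebra"

lemma algebra_mult:
  assumes "f \<in> algebra" "g \<in> algebra"
  shows "(\<lambda>z. f z * g z) \<in> algebra"
  using assms
proof (induction f)
  case (base f k)
  show ?case using base(2)
  proof (induction g)
    case (base g m)
    then show ?case using monomials_mult[OF \<open>f \<in> set (monomials k)\<close>] algebra.base by blast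
  next
    case (sum g h)
    then show ?case using algebra.sum by (simp add: distrib_left)
  next
    case (scale g c)
    then show ?case using algebra.scale[of "\<lambda>z. f z * g z" c] by (simp add: mult.left_commute)
  qed
next
  case (sum f h)
  then show ?case using algebra.sum by (simp add: distrib_right)
next
  case (scale f c)
  then show ?case using algebra.scale[of "\<lambda>z. f z * g z" c] by (simp add: mult.assoc)
qed

lemma algebra_continuous: "f \<in> algebra \<Longrightarrow> continuous_on UNIV f"
proof (induction rule: algebra.induct)
  case (base f k)
  then show ?case by (rule monomials_continuous)
qed (intro continuous_intros; assumption)+

lemma algebra_integral:
  assumes eq: "\<And>k f. f \<in> set (monomials k) \<Longrightarrow> (\<integral>z. f z \<partial>\<mu>) = (\<integral>z. f z \<partial>\<nu>)" and "f \<in> algebra"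
  shows "integrable \<mu> f \<and> integrable \<nu> f \<and> (\<integral>z. f z \<partial>\<mu>) = (\<integral>z. f z \<partial>\<nu>)"
  using assms(2)
  by (induction rule: algebra.induct) (simp_all add: mu.integrable_monomials nu.integrable_monomials eq)

lemma equal_if_energy_le:
  assumes "sphere_energy \<mu> \<le> ennreal (2 * mu.mean_weight)" "sphere_energy \<nu> \<le> ennreal (2 * nu.mean_weight)"
  shows "\<mu> = \<nu>"
proof (rule measure_eqI_bounded_continuous)
  show "prob_space \<mu>" "sets \<mu> = sets borel" "prob_space \<nu>" "sets \<nu> = sets borel"
    by (simp_all add: mu.prob_space_axioms nu.prob_space_axioms mu.sets_eq nu.sets_eq)
  \<comment> \<open>The ball of radius 2 contains the Mandelbrot set and so carries both measures;
    approximation outside it is irrelevant.\<close>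
  interpret function_ring_on algebra "cball (0 :: complex) 2"
  proof
    show "(\<lambda>_. c) \<in> algebra" for c using scale[OF base[of "\<lambda>_. 1" 0], of c] by simp
    show "\<exists>f\<in>algebra. f x \<noteq> f y" if "x \<noteq> y" for x y
    proof -
      have "\<exists>f\<in>set features. f x \<noteq> f y"
      proof (rule ccontr)
        assume "\<not> ?thesis"
        then have "x = y" by (intro features_separate) blast
        then show False using \<open>x \<noteq> y\<close> by blast
      qed
      then obtain f where f: "f \<in> set features" "f x \<noteq> f y" by blast
      have "monomials (Suc 0) = features" by (simp add: features_def)
      then have "f \<in> algebra" using f(1) by (intro base[of f "Suc 0"]) simp
      then show ?thesis using f(2) by (intro bexI[of _ f])
    qed
  next
    show "continuous_on (cball 0 2) f" if "f \<in> algebra" for f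
      using algebra_continuous[OF that] by (rule continuous_on_subset) simp
  qed (simp_all add: algebra_mult sum)
  fix g :: "complex \<Rightarrow> real" assume g: "continuous_on UNIV g" "bounded (range g)"
  obtain B where B: "\<And>z. \<bar>g z\<bar> \<le> B" using g(2) by (auto simp: bounded_iff)
  have "\<bar>(\<integral>z. g z \<partial>\<mu>) - (\<integral>z. g z \<partial>\<nu>)\<bar> \<le> 2 * e" if e: "0 < e" for e
  proof -
    obtain f where f: "f \<in> algebra" "\<forall>x\<in>cball 0 2. \<bar>g x - f x\<bar> < e"
      using Stone_Weierstrass_basic[OF continuous_on_subset[OF g(1)] e] by blast
    have int: "integrable \<mu> f" "integrable \<nu> f" "(\<integral>z. f z \<partial>\<mu>) = (\<integral>z. f z \<partial>\<nu>)"
    proof -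
      have "(\<integral>z. u z \<partial>\<mu>) = (\<integral>z. u z \<partial>\<nu>)" if "u \<in> set (monomials k)" for u k
        using assms that by (rule integral_monomials_eq)
      from algebra_integral[OF this f(1)]
      show "integrable \<mu> f" "integrable \<nu> f" "(\<integral>z. f z \<partial>\<mu>) = (\<integral>z. f z \<partial>\<nu>)" by simp_all
    qed
    have approx: "\<bar>(\<integral>z. g z \<partial>\<rho>) - (\<integral>z. f z \<partial>\<rho>)\<bar> \<le> e" if "mandelbrot_prob \<rho>" "integrable \<rho> f" for \<rho>
    proof -
      interpret mandelbrot_prob \<rho> by (rule that(1))
      have gi: "integrable \<rho> g" by (rule integrable_bounded_continuous[OF g(1) B])
      have ae: "AE z in \<rho>. \<bar>g z - f z\<bar> \<le> e"
        using AE_mandelbrot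
      proof eventually_elim
        case (elim z)
        then have "z \<in> cball 0 2" using norm_mandelbrot by simp
        then show ?case using f(2) by (simp add: less_imp_le)
      qed
      have "\<bar>(\<integral>z. g z \<partial>\<rho>) - (\<integral>z. f z \<partial>\<rho>)\<bar> = \<bar>\<integral>z. g z - f z \<partial>\<rho>\<bar>" using gi that(2) by simp
      also have "\<dots> \<le> (\<integral>z. \<bar>g z - f z\<bar> \<partial>\<rho>)" by (rule integral_abs_bound)
      also have "\<dots> \<le> (\<integral>z. e \<partial>\<rho>)" using gi that(2) ae by (intro integral_mono_AE) auto
      also have "\<dots> = e" by (simp add: prob_space)
      finally show ?thesis .
    qed
    show ?thesis
      using approx[OF mu.mandelbrot_prob_axioms int(1)] approx[OF nu.mandelbrot_prob_axioms int(2)] int(3) by linarith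
  qed
  then have "\<bar>(\<integral>z. g z \<partial>\<mu>) - (\<integral>z. g z \<partial>\<nu>)\<bar> \<le> 0 + e" if "0 < e" for e
    using that by (metis add_0 field_sum_of_halves half_gt_zero_iff mult_2)
  then have "\<bar>(\<integral>z. g z \<partial>\<mu>) - (\<integral>z. g z \<partial>\<nu>)\<bar> \<le> 0" by (rule field_le_epsilon)
  then show "(\<integral>z. g z \<partial>\<mu>) = (\<integral>z. g z \<partial>\<nu>)" by simp
qed

end

text \<open>All energies are at least 0, so a measure of energy at most 0 is a minimizer, and any
  other minimizer also has energy at most 0. \<open>equal_if_energy_le\<close> then identifies the
  two, as the definite description demands.\<close>

lemma equilibrium_measure_eq:
  assumes \<mu>: "mandelbrot_prob \<mu>" "sphere_energy \<mu> \<le> ennreal (2 * mandelbrot_prob.mean_weight \<mu>)"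
  shows "equilibrium_measure mandelbrot = \<mu>"
  unfolding equilibrium_measure_def
proof (rule the_equality)
  have sign: "0 \<le> log_energy \<nu>" if "mandelbrot_prob \<nu>" for \<nu>
    using mandelbrot_prob.log_energy_sign(1)[OF that] mandelbrot_prob.sphere_energy_ge[OF that] by simp
  have zero: "log_energy \<mu> \<le> 0" using mandelbrot_prob.log_energy_sign(2)[OF \<mu>(1)] \<mu>(2) by simp
  show "\<mu> \<in> prob_measures_on mandelbrot \<and> (\<forall>\<nu>\<in>prob_measures_on mandelbrot. log_energy \<mu> \<le> log_energy \<nu>)"
    using \<mu>(1) sign zero by (auto simp: prob_measures_on_mandelbrot intro: order_trans)
  fix \<nu> assume \<nu>: "\<nu> \<in> prob_measures_on mandelbrot \<and> (\<forall>\<rho>\<in>prob_measures_on mandelbrot. log_energy \<nu> \<le> log_energy \<rho>)"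
  then have mn: "mandelbrot_prob \<nu>" by (simp add: prob_measures_on_mandelbrot)
  have "log_energy \<nu> \<le> log_energy \<mu>" using \<nu> \<mu>(1) by (simp add: prob_measures_on_mandelbrot)
  then have "log_energy \<nu> \<le> 0" using zero by (rule order_trans)
  then have "sphere_energy \<nu> \<le> ennreal (2 * mandelbrot_prob.mean_weight \<nu>)"
    using mandelbrot_prob.log_energy_sign(2)[OF mn] by simp
  moreover have "two_mandelbrot \<nu> \<mu>" using mn \<mu>(1) by (simp add: two_mandelbrot_def)
  ultimately show "\<nu> = \<mu>" using two_mandelbrot.equal_if_energy_le \<mu>(2) by blast
qed

section \<open>Limits of sets of small height\<close>

lemma average_sum_list:
  fixes fs :: "('a \<Rightarrow> real) list"
  shows "average T (\<lambda>y. \<Sum>f\<leftarrow>fs. c f * f y) = (\<Sum>f\<leftarrow>fs. c f * average T f)"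
proof (induction fs)
  case Nil
  then show ?case by (simp add: average_def)
next
  case (Cons f fs)
  then show ?case by (simp add: average_add average_cmult)
qed

lemma average_sum: "average T (\<lambda>z. \<Sum>k\<in>A. f k z) = (\<Sum>k\<in>A. average T (f k))"
  unfolding average_def by (subst sum.swap) (simp add: sum_distrib_left)

lemma average_divide: "average T (\<lambda>z. f z / c) = average T f / c"
  using average_cmult[of T "1 / c" f] by simp

text \<open>The discrete counterpart of \<open>moment\<close>, with the diagonal pairs
  included.\<close>

lemma average_kernel_power:
  "average T (\<lambda>x. average T (\<lambda>y. sphere_kernel x y ^ k)) = (\<Sum>f\<leftarrow>monomials k. (average T f)\<^sup>2)"
proof -
  have "average T (\<lambda>y. sphere_kernel x y ^ k) = (\<Sum>f\<leftarrow>monomials k. average T f * f x)" for x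
    unfolding sphere_kernel_power average_sum_list by (simp only: mult.commute)
  then show ?thesis by (simp add: average_sum_list power2_eq_square)
qed

lemma tendsto_sum_list:
  fixes fs :: "'a list" and a :: "nat \<Rightarrow> 'a \<Rightarrow> real"
  shows "(\<And>f. f \<in> set fs \<Longrightarrow> (\<lambda>n. a n f) \<longlonglongrightarrow> b f) \<Longrightarrow> (\<lambda>n. \<Sum>f\<leftarrow>fs. a n f) \<longlonglongrightarrow> (\<Sum>f\<leftarrow>fs. b f)"
  by (induction fs) (auto intro!: tendsto_add)

text \<open>A continuous minorant of the Green function, up to the factor \<open>2 ^ n\<close>.\<close>

definition escape :: "nat \<Rightarrow> complex \<Rightarrow> real" where
  "escape n z = min 1 (ln (max (cmod (psi (Suc n) z)) (max 2 (cmod z)) / max 2 (cmod z)))"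

lemma escape_quotient: "1 \<le> max (cmod (psi (Suc n) z)) (max 2 (cmod z)) / max 2 (cmod z)"
  by (subst le_divide_eq_1_pos) auto

lemma escape_nonneg: "0 \<le> escape n z"
  unfolding escape_def using ln_ge_zero[OF escape_quotient[of n z]] by simp

lemma escape_continuous: "continuous_on UNIV (escape n)"
proof -
  have "max 2 (cmod z) \<noteq> 0" "max (cmod (psi (Suc n) z)) (max 2 (cmod z)) / max 2 (cmod z) \<noteq> 0" for z
    using escape_quotient[of n z] by auto
  then show ?thesis
    unfolding escape_def by (intro continuous_intros continuous_psi) auto
qed

lemma escape_le: "escape n z \<le> 2 ^ n * lambda_inf z"
proof (cases "cmod (psi (Suc n) z) \<le> max 2 (cmod z)")
  case True
  then have "escape n z = 0" by (simp add: escape_def max_absorb2)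
  then show ?thesis using lambda_inf_nonneg[of z] by simp
next
  case False
  then have gt: "max 2 (cmod z) < cmod (psi (Suc n) z)" by (simp only: not_le)
  have "escape n z \<le> ln (cmod (psi (Suc n) z) / max 2 (cmod z))"
    using gt by (simp add: escape_def max_absorb1)
  also have "\<dots> \<le> ln (cmod (psi (Suc n) z) / 2)"
  proof -
    have q: "cmod (psi (Suc n) z) / max 2 (cmod z) \<le> cmod (psi (Suc n) z) / 2"
      by (rule divide_left_mono) (auto simp: max_def)
    have pos: "0 < cmod (psi (Suc n) z) / max 2 (cmod z)"
      using gt by (intro divide_pos_pos) auto
    show ?thesis by (subst ln_le_cancel_iff[OF pos less_le_trans[OF pos q]]) (rule q)
  qed
  also have "\<dots> \<le> 2 ^ n * lambda_inf z" using gt by (intro lambda_inf_escaped) auto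
  finally show ?thesis .
qed

lemma escape_eq_0:
  assumes "escape n z = 0"
  shows "cmod (psi (Suc n) z) \<le> max 2 (cmod z)"
proof (rule ccontr)
  assume "\<not> ?thesis"
  then have "max 2 (cmod z) < cmod (psi (Suc n) z)" by (simp only: not_le)
  then have "1 < max (cmod (psi (Suc n) z)) (max 2 (cmod z)) / max 2 (cmod z)"
    by (subst less_divide_eq_1_pos) auto
  from ln_gt_zero[OF this] show False using assms by (simp add: escape_def min_def split: if_splits)
qed

text \<open>The threshold ln 17 is the weight at radius 4. Beyond it, |z| <= 2 * exp(lambda) gives
  lambda > ln 2, and the weight is at most ln 2 + 2 ln |z|, hence at most 3 ln 2 + 2 lambda and so
  at most 5 lambda.\<close>

lemma height_weight_le: "height_weight z \<le> min (height_weight z) (ln 17) + 5 * lambda_inf z"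
proof (cases "cmod z \<le> 4")
  case True
  then have "(cmod z)\<^sup>2 \<le> 4\<^sup>2" by (intro power_mono) auto
  then have "height_weight z \<le> ln 17"
    unfolding height_weight_def by (subst ln_le_cancel_iff) (auto simp: one_plus_sq_pos)
  then show ?thesis using lambda_inf_nonneg[of z] by simp
next
  case False
  have "ln 2 < ln (cmod z / 2)" using False by (subst ln_less_cancel_iff) auto
  moreover have "ln (cmod z / 2) \<le> ln (exp (lambda_inf z))"
    using False norm_le_lambda_inf[of z] by (subst ln_le_cancel_iff) auto
  moreover have "ln (cmod z / 2) = ln (cmod z) - ln 2" using False by (subst ln_div) auto
  ultimately have l: "ln 2 < lambda_inf z" "ln (cmod z) \<le> lambda_inf z + ln 2" by simp_all
  have "1 \<le> (cmod z)\<^sup>2" using False by (intro one_le_power) simp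
  then have "height_weight z \<le> ln (2 * (cmod z)\<^sup>2)"
    unfolding height_weight_def using False by (subst ln_le_cancel_iff) (auto simp: one_plus_sq_pos)
  also have "\<dots> = ln 2 + 2 * ln (cmod z)"
  proof -
    have "0 < cmod z" using False by linarith
    then show ?thesis by (simp add: ln_mult ln_realpow)
  qed
  also have "\<dots> \<le> 5 * lambda_inf z" using l by linarith
  also have "\<dots> \<le> min (height_weight z) (ln 17) + 5 * lambda_inf z"
    using height_weight_nonneg[of z] by simp
  finally show ?thesis .
qed

lemma outside_le: "(if 4 < cmod z then 1 else 0) \<le> 1 / ln 2 * lambda_inf z"
proof (cases "4 < cmod z")
  case True
  then have "2 \<le> exp (lambda_inf z)" using norm_le_lambda_inf[of z] by linarith
  then have "ln 2 \<le> ln (exp (lambda_inf z))" by (subst ln_le_cancel_iff) auto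
  then have "ln 2 \<le> lambda_inf z" by simp
  then show ?thesis using True by (simp add: field_simps)
next
  case False
  then show ?thesis using lambda_inf_nonneg[of z] by simp
qed

text \<open>A truncated series is finite on the diagonal, where it costs a harmonic sum divided by
  the number of points, and off the diagonal it lies below the full series. This replaces the
  infinite self-energy of a discrete measure.\<close>

lemma partial_energy_le:
  assumes T: "finite T" "T \<noteq> {}"
  shows "(\<Sum>k<m. (\<Sum>f\<leftarrow>monomials k. (average T f)\<^sup>2) / real k)
    \<le> (\<Sum>k<m. 1 / real k) / real (card T) - 2 * (ln (disc (\<lambda>x y. cmod (x - y)) T) / (real (card T))\<^sup>2)
      + 2 * average T height_weight"
proof -
  let ?N = "real (card T)" and ?H = "\<Sum>k<m. 1 / real k" and ?d = "ln (disc (\<lambda>x y. cmod (x - y)) T)"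
  have N: "0 < ?N" using T by (simp add: card_gt_0_iff)
  define S where "S x y = (\<Sum>k<m. sphere_kernel x y ^ k / real k)" for x y
  have diag: "S x x = ?H" for x by (simp add: S_def sphere_kernel_def chord_def)
  have off: "S x y \<le> - ln (chord x y)" if "x \<noteq> y" for x y
    unfolding S_def sums_unique[OF sphere_kernel_sums[OF that]]
    by (rule sum_le_suminf[OF sums_summable[OF sphere_kernel_sums[OF that]]]) (auto simp: sphere_kernel_bounds)
  have "(\<Sum>k<m. (\<Sum>f\<leftarrow>monomials k. (average T f)\<^sup>2) / real k) = average T (\<lambda>x. average T (S x))"
    unfolding S_def[abs_def] average_sum average_divide average_kernel_power[symmetric] ..
  also have "\<dots> = (\<Sum>x\<in>T. \<Sum>y\<in>T. S x y) / ?N\<^sup>2"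
    by (simp add: average_def sum_distrib_left sum_divide_distrib power2_eq_square)
  also have "\<dots> \<le> (?N * ?H + (- 2 * ?d + 2 * (?N - 1) * (\<Sum>x\<in>T. height_weight x))) / ?N\<^sup>2"
  proof (rule divide_right_mono)
    have "(\<Sum>x\<in>T. \<Sum>y\<in>T. S x y) \<le> (\<Sum>x\<in>T. ?H + (\<Sum>y\<in>T - {x}. - ln (chord x y)))"
    proof (rule sum_mono)
      fix x assume x: "x \<in> T"
      have "(\<Sum>y\<in>T. S x y) = S x x + (\<Sum>y\<in>T - {x}. S x y)" using T(1) x by (rule sum.remove)
      also have "\<dots> \<le> ?H + (\<Sum>y\<in>T - {x}. - ln (chord x y))"
        unfolding diag by (intro add_left_mono sum_mono off) auto
      finally show "(\<Sum>y\<in>T. S x y) \<le> ?H + (\<Sum>y\<in>T - {x}. - ln (chord x y))" .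
    qed
    then show "(\<Sum>x\<in>T. \<Sum>y\<in>T. S x y) \<le> ?N * ?H + (- 2 * ?d + 2 * (?N - 1) * (\<Sum>x\<in>T. height_weight x))"
      unfolding sum.distrib sum_minus_ln_chord[OF T(1)] by simp
  qed simp
  also have "\<dots> = ?H / ?N - 2 * (?d / ?N\<^sup>2) + 2 * ((?N - 1) / ?N * average T height_weight)"
    using N by (simp add: average_def field_simps power2_eq_square)
  also have "\<dots> \<le> ?H / ?N - 2 * (?d / ?N\<^sup>2) + 2 * (1 * average T height_weight)"
    using N by (intro add_left_mono mult_left_mono mult_right_mono average_nonneg height_weight_nonneg) auto
  finally show ?thesis by simp
qed

section \<open>Equidistribution of complex sets of small height\<close>

locale small_sets =
  fixes T :: "nat \<Rightarrow> complex set"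
  assumes fin: "finite (T n)" and ne: "T n \<noteq> {}"
    and card_top: "filterlim (\<lambda>n. card (T n)) at_top sequentially"
    and lambda_0: "(\<lambda>n. average (T n) lambda_inf) \<longlonglongrightarrow> 0"
    and disc_0: "(\<lambda>n. ln (disc (\<lambda>x y. cmod (x - y)) (T n)) / (real (card (T n)))\<^sup>2) \<longlonglongrightarrow> 0"
begin

lemma subsequence:
  assumes "strict_mono (r :: nat \<Rightarrow> nat)"
  shows "small_sets (\<lambda>n. T (r n))"
proof
  have r: "filterlim r at_top sequentially" using assms by (rule filterlim_subseq)
  show "filterlim (\<lambda>n. card (T (r n))) at_top sequentially" by (rule filterlim_compose[OF card_top r])
  show "(\<lambda>n. average (T (r n)) lambda_inf) \<longlonglongrightarrow> 0" by (rule filterlim_compose[OF lambda_0 r])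
  show "(\<lambda>n. ln (disc (\<lambda>x y. cmod (x - y)) (T (r n))) / (real (card (T (r n))))\<^sup>2) \<longlonglongrightarrow> 0"
    by (rule filterlim_compose[OF disc_0 r])
qed (rule fin ne)+

text \<open>The vanishing averages of \<open>lambda_inf\<close> put the limit on the Mandelbrot set;
  the vanishing normalized discriminants give it energy at most 0.\<close>

lemma weak_limit:
  assumes \<nu>: "prob_space \<nu>" "sets \<nu> = sets borel"
    and lim: "\<And>f :: complex \<Rightarrow> real. continuous_on UNIV f \<Longrightarrow> bounded (range f) \<Longrightarrow>
      (\<lambda>n. average (T n) f) \<longlonglongrightarrow> (\<integral>z. f z \<partial>\<nu>)"
  shows "mandelbrot_prob \<nu> \<and> sphere_energy \<nu> \<le> ennreal (2 * mandelbrot_prob.mean_weight \<nu>)"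
proof -
  interpret plane_prob \<nu> using \<nu> by (simp add: plane_prob_def plane_prob_axioms_def)
  have "AE z in \<nu>. escape n z = 0" for n
  proof -
    have bdd: "\<bar>escape n z\<bar> \<le> 1" for z using escape_nonneg[of n z] by (simp add: escape_def)
    then have b: "bounded (range (escape n))" by (auto simp: bounded_iff)
    have int: "integrable \<nu> (escape n)" by (rule integrable_bounded_continuous[OF escape_continuous bdd])
    \<comment> \<open>For fixed \<open>n\<close> the function \<open>escape n\<close> lies below a
      constant multiple of \<open>lambda_inf\<close>, so its nonnegative integral against the limit
      is 0.\<close>
    have "(\<lambda>n'. average (T n') (\<lambda>z. 2 ^ n * lambda_inf z)) \<longlonglongrightarrow> 0"
      unfolding average_cmult by (rule tendsto_mult_right_zero[OF lambda_0])
    then have "(\<integral>z. escape n z \<partial>\<nu>) \<le> 0"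
      by (rule LIMSEQ_le[OF lim[OF escape_continuous b]]) (auto intro!: average_mono escape_le)
    moreover have "0 \<le> (\<integral>z. escape n z \<partial>\<nu>)"
      by (rule Bochner_Integration.integral_nonneg) (rule escape_nonneg)
    ultimately have "(\<integral>z. escape n z \<partial>\<nu>) = 0" by simp
    then show ?thesis
      using integral_nonneg_eq_0_iff_AE[OF int] escape_nonneg by simp
  qed
  then have "AE z in \<nu>. \<forall>n. escape n z = 0" by (simp add: AE_all_countable)
  then have "AE z in \<nu>. z \<in> mandelbrot"
  proof eventually_elim
    case (elim z)
    have "cmod (psi n z) \<le> max 2 (cmod z)" for n
      using escape_eq_0[of "n - 1" z] elim by (cases n) auto
    then show ?case by (auto simp: mandelbrot_def bounded_iff)
  qed
  then interpret mandelbrot_prob \<nu> by unfold_locales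
  \<comment> \<open>\<open>height_weight\<close> is unbounded, so weak convergence is applied to
    this truncation. It does not change the weight on the Mandelbrot set, and along the sequence its
    error is absorbed by \<open>5 * lambda_inf\<close>.\<close>
  define W where "W z = min (height_weight z) (ln 17)" for z
  have Wc: "continuous_on UNIV W"
  proof -
    have "1 + (cmod z)\<^sup>2 \<noteq> 0" for z using one_plus_sq_pos[of z] by linarith
    then show ?thesis unfolding W_def height_weight_def by (intro continuous_intros) auto
  qed
  have Wb: "bounded (range W)"
    by (auto simp: bounded_iff W_def height_weight_nonneg intro!: exI[of _ "ln 17"])
  have W_eq: "(\<integral>z. W z \<partial>\<nu>) = mean_weight"
    unfolding mean_weight_def
  proof (rule integral_cong_AE)
    show "AE z in \<nu>. W z = height_weight z"
      using AE_weight
    proof eventually_elim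
      case (elim z)
      have "ln 5 \<le> ln (17 :: real)" by (subst ln_le_cancel_iff) auto
      with elim have "height_weight z \<le> ln 17" by (rule order_trans)
      then show ?case by (simp add: W_def)
    qed
  qed (use borel_measurable_continuous_onI[OF Wc] in measurable)
  have card: "(\<lambda>n. c / real (card (T n))) \<longlonglongrightarrow> 0" for c
    using filterlim_compose[OF filterlim_real_sequentially card_top] by (rule real_tendsto_divide_at_top[OF tendsto_const])
  \<comment> \<open>For fixed \<open>m\<close> only finitely many bounded continuous monomials
    occur, so \<open>n\<close> may go to infinity first. The diagonal cost disappears in this limit,
    and \<open>m\<close> is released afterwards.\<close>
  have bound: "(\<Sum>k<m. moment \<nu> k / real k) \<le> 2 * mean_weight" for m
  proof (rule LIMSEQ_le)
    show "(\<lambda>n. \<Sum>k<m. (\<Sum>f\<leftarrow>monomials k. (average (T n) f)\<^sup>2) / real k) \<longlonglongrightarrow> (\<Sum>k<m. moment \<nu> k / real k)"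
      unfolding moment_def
    proof (intro tendsto_sum)
      fix k
      have "(\<lambda>n. (average (T n) f)\<^sup>2) \<longlonglongrightarrow> (\<integral>z. f z \<partial>\<nu>)\<^sup>2" if f: "f \<in> set (monomials k)" for f
      proof (intro tendsto_power lim)
        show "continuous_on UNIV f" using f by (rule monomials_continuous)
        show "bounded (range f)" using monomials_bound[OF f] by (auto simp: bounded_iff)
      qed
      from tendsto_sum_list[OF this]
      have "(\<lambda>n. \<Sum>f\<leftarrow>monomials k. (average (T n) f)\<^sup>2) \<longlonglongrightarrow> (\<Sum>f\<leftarrow>monomials k. (\<integral>z. f z \<partial>\<nu>)\<^sup>2)" .
      then show "(\<lambda>n. (\<Sum>f\<leftarrow>monomials k. (average (T n) f)\<^sup>2) / real k)
          \<longlonglongrightarrow> (\<Sum>f\<leftarrow>monomials k. (\<integral>z. f z \<partial>\<nu>)\<^sup>2) / real k"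
        unfolding divide_inverse by (rule tendsto_mult_right)
    qed
    have "(\<lambda>n. (\<Sum>k<m. 1 / real k) / real (card (T n))
        - 2 * (ln (disc (\<lambda>x y. cmod (x - y)) (T n)) / (real (card (T n)))\<^sup>2)
        + 2 * (average (T n) W + 5 * average (T n) lambda_inf))
      \<longlonglongrightarrow> 0 - 2 * 0 + 2 * ((\<integral>z. W z \<partial>\<nu>) + 5 * 0)"
      by (intro tendsto_add tendsto_diff tendsto_mult tendsto_const card disc_0 lambda_0 lim Wc Wb)
    then show "(\<lambda>n. (\<Sum>k<m. 1 / real k) / real (card (T n))
        - 2 * (ln (disc (\<lambda>x y. cmod (x - y)) (T n)) / (real (card (T n)))\<^sup>2)
        + 2 * (average (T n) W + 5 * average (T n) lambda_inf)) \<longlonglongrightarrow> 2 * mean_weight"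
      by (simp add: W_eq)
    have "(\<Sum>k<m. (\<Sum>f\<leftarrow>monomials k. (average (T n) f)\<^sup>2) / real k)
        \<le> (\<Sum>k<m. 1 / real k) / real (card (T n))
        - 2 * (ln (disc (\<lambda>x y. cmod (x - y)) (T n)) / (real (card (T n)))\<^sup>2)
        + 2 * (average (T n) W + 5 * average (T n) lambda_inf)" for n
    proof -
      have "average (T n) height_weight \<le> average (T n) (\<lambda>z. W z + 5 * lambda_inf z)"
        unfolding W_def by (intro average_mono height_weight_le)
      then have "average (T n) height_weight \<le> average (T n) W + 5 * average (T n) lambda_inf"
        by (simp only: average_add average_cmult)
      then show ?thesis
        by (intro order_trans[OF partial_energy_le[OF fin ne]] add_left_mono mult_left_mono) auto
    qed
    then show "\<exists>N. \<forall>n\<ge>N. (\<Sum>k<m. (\<Sum>f\<leftarrow>monomials k. (average (T n) f)\<^sup>2) / real k)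
        \<le> (\<Sum>k<m. 1 / real k) / real (card (T n))
        - 2 * (ln (disc (\<lambda>x y. cmod (x - y)) (T n)) / (real (card (T n)))\<^sup>2)
        + 2 * (average (T n) W + 5 * average (T n) lambda_inf)" by blast
  qed
  have "(\<Sum>k. ennreal (moment \<nu> k / real k)) \<le> ennreal (2 * mean_weight)"
  proof (rule suminf_le_const)
    show "summable (\<lambda>k. ennreal (moment \<nu> k / real k))" by (rule summableI)
    fix m
    have "(\<Sum>k<m. ennreal (moment \<nu> k / real k)) = ennreal (\<Sum>k<m. moment \<nu> k / real k)"
      by (intro sum_ennreal divide_nonneg_nonneg moment_nonneg) simp
    also have "\<dots> \<le> ennreal (2 * mean_weight)" by (rule ennreal_leI[OF bound])
    finally show "(\<Sum>k<m. ennreal (moment \<nu> k / real k)) \<le> ennreal (2 * mean_weight)" .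
  qed
  then show ?thesis
    unfolding sphere_energy_eq using mandelbrot_prob_axioms by simp
qed

lemma convergent_subsequence:
  "\<exists>r. strict_mono (r :: nat \<Rightarrow> nat) \<and> (\<forall>f :: complex \<Rightarrow> real. continuous_on UNIV f \<longrightarrow> bounded (range f) \<longrightarrow>
     (\<lambda>n. average (T (r n)) f) \<longlonglongrightarrow> (\<integral>z. f z \<partial>equilibrium_measure mandelbrot))"
proof -
  have outside: "(\<lambda>n. average (T n) (\<lambda>z. if 4 < cmod z then 1 else 0)) \<longlonglongrightarrow> 0"
  proof (rule tendsto_sandwich[OF _ _ tendsto_const])
    show "(\<lambda>n. average (T n) (\<lambda>z. 1 / ln 2 * lambda_inf z)) \<longlonglongrightarrow> 0"
      unfolding average_cmult by (rule tendsto_mult_right_zero[OF lambda_0])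
    show "\<forall>\<^sub>F n in sequentially. 0 \<le> average (T n) (\<lambda>z. if 4 < cmod z then 1 else 0)"
      by (intro always_eventually allI average_nonneg) auto
    show "\<forall>\<^sub>F n in sequentially. average (T n) (\<lambda>z. if 4 < cmod z then 1 else 0)
        \<le> average (T n) (\<lambda>z. 1 / ln 2 * lambda_inf z)"
      by (intro always_eventually allI average_mono outside_le)
  qed
  have "(0 :: real) < 4" by simp
  from weak_limit_exists[OF fin ne this outside]
  obtain r \<nu> where r: "strict_mono (r :: nat \<Rightarrow> nat)" "prob_space \<nu>" "sets \<nu> = sets borel"
    and lim: "\<And>f :: complex \<Rightarrow> real. continuous_on UNIV f \<Longrightarrow> bounded (range f) \<Longrightarrow>
      (\<lambda>n. average (T (r n)) f) \<longlonglongrightarrow> (\<integral>z. f z \<partial>\<nu>)" by blast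
  interpret sub: small_sets "\<lambda>n. T (r n)" using r(1) by (rule subsequence)
  have "mandelbrot_prob \<nu> \<and> sphere_energy \<nu> \<le> ennreal (2 * mandelbrot_prob.mean_weight \<nu>)"
    by (rule sub.weak_limit[OF r(2,3) lim])
  then have "equilibrium_measure mandelbrot = \<nu>" using equilibrium_measure_eq by blast
  then show ?thesis using r(1) lim by blast
qed

text \<open>Every subsequence has a further subsequence with this same limit, so the whole sequence
  converges.\<close>

lemma average_tendsto:
  fixes f :: "complex \<Rightarrow> real"
  assumes f: "continuous_on UNIV f" "bounded (range f)"
  shows "(\<lambda>n. average (T n) f) \<longlonglongrightarrow> (\<integral>z. f z \<partial>equilibrium_measure mandelbrot)"
proof (rule ccontr)
  let ?l = "\<integral>z. f z \<partial>equilibrium_measure mandelbrot"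
  assume "\<not> (\<lambda>n. average (T n) f) \<longlonglongrightarrow> ?l"
  then obtain e where e: "0 < e" "\<not> (\<forall>\<^sub>F n in sequentially. dist (average (T n) f) ?l < e)"
    by (auto simp: tendsto_iff)
  then have inf: "infinite {n. \<not> dist (average (T n) f) ?l < e}"
    by (simp add: eventually_sequentially infinite_nat_iff_unbounded_le)
  obtain r :: "nat \<Rightarrow> nat" where r: "strict_mono r" "\<And>n. r n \<in> {n. \<not> dist (average (T n) f) ?l < e}"
    using infinite_enumerate[OF inf] by blast
  interpret sub: small_sets "\<lambda>n. T (r n)" using r(1) by (rule subsequence)
  obtain s where "(\<lambda>n. average (T (r (s n))) f) \<longlonglongrightarrow> ?l"
    using sub.convergent_subsequence f by blast
  from tendstoD[OF this e(1)] obtain n where "dist (average (T (r (s n))) f) ?l < e"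
    by (auto simp: eventually_sequentially)
  then show False using r(2)[of "s n"] by simp
qed

end

section \<open>The p-adic complex fields\<close>

lemma type_algebra_simps [simp]:
  "carrier (ring_of_type_algebra :: 'a :: ring_1 ring) = UNIV"
  "mult (ring_of_type_algebra :: 'a :: ring_1 ring) = (*)"
  "add (ring_of_type_algebra :: 'a :: ring_1 ring) = (+)"
  "one (ring_of_type_algebra :: 'a :: ring_1 ring) = 1"
  "zero (ring_of_type_algebra :: 'a :: ring_1 ring) = 0"
  by (simp_all add: ring_of_type_algebra_def)

locale valued_field = field K for K :: "'k ring" (structure) +
  fixes v :: "'k \<Rightarrow> real"
  assumes abs_value: "is_absolute_value K v"
begin

lemma v_nonneg: "x \<in> carrier K \<Longrightarrow> 0 \<le> v x"
  and v_eq_0: "x \<in> carrier K \<Longrightarrow> v x = 0 \<longleftrightarrow> x = \<zero>"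
  and v_mult: "x \<in> carrier K \<Longrightarrow> y \<in> carrier K \<Longrightarrow> v (x \<otimes> y) = v x * v y"
  and v_add: "x \<in> carrier K \<Longrightarrow> y \<in> carrier K \<Longrightarrow> v (x \<oplus> y) \<le> v x + v y"
  using abs_value by (auto simp: is_absolute_value_def)

lemma v_zero: "v \<zero> = 0" and v_one: "v \<one> = 1"
proof -
  show "v \<zero> = 0" using v_eq_0[of \<zero>] by simp
  have "v \<one> * v \<one> = v \<one>" using v_mult[of \<one> \<one>] by simp
  moreover have "v \<one> \<noteq> 0" using v_eq_0[of \<one>] by simp
  ultimately show "v \<one> = 1" by simp
qed

lemma v_a_inv:
  assumes "x \<in> carrier K"
  shows "v (\<ominus> x) = v x"
proof -
  have "(v (\<ominus> \<one>))\<^sup>2 = v (\<ominus> \<one> \<otimes> \<ominus> \<one>)" by (simp add: v_mult power2_eq_square)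
  also have "\<dots> = 1" by (simp add: l_minus r_minus v_one)
  finally have "v (\<ominus> \<one>) = 1" using v_nonneg[of "\<ominus> \<one>"] by (simp add: power2_eq_1_iff)
  moreover have "\<ominus> x = \<ominus> \<one> \<otimes> x" using assms by (simp add: l_minus)
  ultimately show ?thesis using assms by (simp add: v_mult)
qed

end

text \<open>The only property tied to p is that natural numbers have absolute value at most 1; this
  already forces the ultrametric inequality.\<close>

locale qbar_valued_field = valued_field K v for K :: "'k ring" (structure) and v +
  fixes h :: "qbar \<Rightarrow> 'k"
  assumes hom: "h \<in> ring_hom Qbar K" and nat_le_1: "v (h (of_nat m)) \<le> 1"
begin

lemma h_closed [simp]: "h x \<in> carrier K"
  using ring_hom_closed[OF hom] by simp

lemma h_mult: "h (x * y) = h x \<otimes> h y" and h_add: "h (x + y) = h x \<oplus> h y" and h_one: "h 1 = \<one>"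
  using ring_hom_mult[OF hom, of x y] ring_hom_add[OF hom, of x y] ring_hom_one[OF hom] by simp_all

lemma h_zero: "h 0 = \<zero>"
proof -
  have "h 0 \<oplus> h 0 = h 0" using h_add[of 0 0] by simp
  then show ?thesis by (simp add: add.l_cancel_one)
qed

lemma h_eq_zero: "h x = \<zero> \<longleftrightarrow> x = 0"
proof
  assume 0: "h x = \<zero>"
  show "x = 0"
  proof (rule ccontr)
    assume "x \<noteq> 0"
    then have "\<one> = h x \<otimes> h (inverse x)" by (simp flip: h_mult h_one)
    then show False using 0 by simp
  qed
qed (simp add: h_zero)

lemma h_diff: "h (x - y) = h x \<ominus> h y"
proof -
  have "h (- y) \<oplus> h y = \<zero>" using h_add[of "- y" y] by (simp add: h_zero)
  then have "\<ominus> h y = h (- y)" by (intro minus_equality) auto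
  then show ?thesis using h_add[of x "- y"] by (simp add: a_minus_def)
qed

lemma h_inj: "inj_on h A"
proof (rule inj_onI)
  fix x y assume "h x = h y"
  then have "h (x - y) = \<zero>" by (simp add: h_diff a_minus_def r_neg)
  then show "x = y" by (simp add: h_eq_zero)
qed

text \<open>The powers of \<open>1 + x\<close> are polynomials in \<open>x\<close> with natural coefficients and at most \<open>n + 1\<close>
  terms. This replaces the binomial theorem in the proof of the ultrametric inequality.\<close>

fun eval_nats :: "'k \<Rightarrow> nat list \<Rightarrow> 'k" where
  "eval_nats x [] = \<zero>"
| "eval_nats x (m # ms) = h (of_nat m) \<oplus> x \<otimes> eval_nats x ms"

lemma eval_nats_closed [simp]: "x \<in> carrier K \<Longrightarrow> eval_nats x ms \<in> carrier K"
  by (induction ms) auto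

lemma v_eval_nats:
  assumes x: "x \<in> carrier K" "v x \<le> 1"
  shows "v (eval_nats x ms) \<le> real (length ms)"
proof (induction ms)
  case Nil
  then show ?case by (simp add: v_zero)
next
  case (Cons m ms)
  have "v (x \<otimes> eval_nats x ms) = v x * v (eval_nats x ms)" using x by (simp add: v_mult)
  also have "\<dots> \<le> 1 * real (length ms)" using x Cons by (intro mult_mono v_nonneg) auto
  finally have "v (x \<otimes> eval_nats x ms) \<le> real (length ms)" by simp
  then show ?case
    using v_add[of "h (of_nat m)" "x \<otimes> eval_nats x ms"] nat_le_1[of m] x(1) by simp
qed

text \<open>Multiplying by 1 + x adds each coefficient to its neighbour. The summand
  \<open>m\<close> is the coefficient carried over from the previous position, which the induction
  needs in general form.\<close>

lemma eval_nats_one_plus: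
  assumes x: "x \<in> carrier K"
  shows "\<exists>ms'. length ms' = Suc (length ms) \<and>
    h (of_nat m) \<oplus> (\<one> \<oplus> x) \<otimes> eval_nats x ms = eval_nats x ms'"
proof (induction ms arbitrary: m)
  case Nil
  show ?case by (rule exI[of _ "[m]"]) (simp add: x)
next
  case (Cons k ms)
  obtain ms' where ms': "length ms' = Suc (length ms)"
    "h (of_nat k) \<oplus> (\<one> \<oplus> x) \<otimes> eval_nats x ms = eval_nats x ms'" using Cons.IH by blast
  let ?e = "eval_nats x ms" and ?m = "h (of_nat m)" and ?k = "h (of_nat k)"
  have c: "?e \<in> carrier K" "?m \<in> carrier K" "?k \<in> carrier K" using x by simp_all
  have "?m \<oplus> (\<one> \<oplus> x) \<otimes> (?k \<oplus> x \<otimes> ?e) = (?m \<oplus> ?k) \<oplus> x \<otimes> (?k \<oplus> (\<one> \<oplus> x) \<otimes> ?e)"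
    using x c by algebra
  then have "?m \<oplus> (\<one> \<oplus> x) \<otimes> eval_nats x (k # ms) = eval_nats x ((m + k) # ms')"
    by (simp add: ms'(2) h_add)
  then show ?case using ms'(1) by (intro exI[of _ "(m + k) # ms'"]) simp
qed

text \<open>The argument of \<open>w_ultrametric\<close> carried out in \<open>K\<close> itself,
  because the p-adic disc is not confined to the image of \<open>qbar\<close>.\<close>

lemma v_one_plus:
  assumes x: "x \<in> carrier K" "v x \<le> 1"
  shows "v (\<one> \<oplus> x) \<le> 1"
proof (rule power_le_linear)
  fix n
  have "\<exists>ms. length ms = Suc n \<and> (\<one> \<oplus> x) [^] n = eval_nats x ms"
  proof (induction n)
    case 0
    show ?case by (rule exI[of _ "[1]"]) (simp add: h_one x)
  next
    case (Suc n)
    then obtain ms where ms: "length ms = Suc n" "(\<one> \<oplus> x) [^] n = eval_nats x ms" by blast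
    have "(\<one> \<oplus> x) [^] Suc n = h (of_nat 0) \<oplus> (\<one> \<oplus> x) \<otimes> eval_nats x ms"
      using x by (simp add: ms(2) h_zero m_comm)
    then show ?case using eval_nats_one_plus[OF x(1), of ms 0] ms(1) by auto
  qed
  then have "v ((\<one> \<oplus> x) [^] n) \<le> real n + 1"
    using v_eval_nats[OF x] by (metis of_nat_Suc add.commute)
  moreover have "v ((\<one> \<oplus> x) [^] n) = v (\<one> \<oplus> x) ^ n"
    using x by (induction n) (simp_all add: v_one v_mult)
  ultimately show "v (\<one> \<oplus> x) ^ n \<le> real n + 1" by simp
qed

text \<open>Factor out the larger summand: x + y = x * (1 + y/x).\<close>

lemma v_add_le_1:
  assumes "x \<in> carrier K" "y \<in> carrier K" "v x \<le> 1" "v y \<le> v x"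
  shows "v (x \<oplus> y) \<le> 1"
proof (cases "x = \<zero>")
  case True
  then show ?thesis using assms by simp
next
  case False
  then have u: "x \<in> Units K" using assms(1) by (simp add: field_Units)
  define z where "z = inv x \<otimes> y"
  have z: "z \<in> carrier K" using u assms by (simp add: z_def)
  have xz: "x \<otimes> z = y" using u assms by (simp add: z_def m_assoc[symmetric])
  have pos: "0 < v x" using v_nonneg[OF assms(1)] v_eq_0[OF assms(1)] False by simp
  have "v x * v z \<le> v x * 1" using assms(4) v_mult[OF assms(1) z] xz by simp
  then have "v z \<le> 1" using pos by (simp only: mult_le_cancel_left_pos)
  then have "v (\<one> \<oplus> z) \<le> 1" by (rule v_one_plus[OF z])
  moreover have "x \<oplus> y = x \<otimes> (\<one> \<oplus> z)" using assms z xz by (simp add: r_distr)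
  ultimately show ?thesis
    using assms(1,3) z v_nonneg by (simp add: v_mult mult_le_one)
qed

lemma v_diff_le_1:
  assumes "x \<in> carrier K" "y \<in> carrier K" "v x \<le> 1" "v y \<le> 1"
  shows "v (x \<ominus> y) \<le> 1"
proof (cases "v y \<le> v x")
  case True
  then show ?thesis using v_add_le_1[of x "\<ominus> y"] assms by (simp add: a_minus_def v_a_inv)
next
  case False
  then have "v (\<ominus> y \<oplus> x) \<le> 1" using v_add_le_1[of "\<ominus> y" x] assms by (simp add: v_a_inv)
  then show ?thesis using assms by (simp add: a_minus_def a_comm)
qed

end

section \<open>Pulling the p-adic absolute value back to \<open>qbar\<close>\<close>

lemma multiplicative_minus_one:
  fixes g :: "'r :: ring_1 \<Rightarrow> real"
  assumes "\<And>x y. g (x * y) = g x * g y" "g 1 = 1" "0 \<le> g (- 1)"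
  shows "g (- 1) = 1"
proof -
  have "(g (- 1))\<^sup>2 = 1" using assms(1)[of "- 1" "- 1"] assms(2) by (simp add: power2_eq_square)
  then show ?thesis using assms(3) by (simp add: power2_eq_1_iff)
qed

text \<open>The tower in the definition embeds the rationals by \<open>i\<close>, while
  \<open>h\<close> is an unrelated embedding of \<open>qbar\<close>. Both agree on natural numbers,
  and multiplicativity carries the absolute value on to quotients and signs.\<close>

lemma padic_complex_field_hom:
  assumes K: "is_padic_complex_field p K v" and p: "prime p" and h: "h \<in> ring_hom Qbar K"
  shows "qbar_valued_field K v h" "padic_extension p (\<lambda>x. v (h x))"
proof -
  obtain Qp L i where c1: "is_completion (ring_of_type_algebra :: rat ring) (padic_abs p) (K\<lparr>carrier := Qp\<rparr>) v i"
    and alg: "algebraic_closure (K\<lparr>carrier := L\<rparr>) Qp"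
    and c2: "is_completion (K\<lparr>carrier := L\<rparr>) v K v id"
    using K unfolding is_padic_complex_field_def by blast
  have fK: "field K" and aK: "is_absolute_value K v" using c2 by (auto simp: is_completion_def)
  interpret valued_field K v by (simp add: valued_field_def valued_field_axioms_def fK aK)
  have "L \<subseteq> carrier K" using c2 ring_hom_closed[of id "K\<lparr>carrier := L\<rparr>" K] by (auto simp: is_completion_def)
  moreover have "Qp \<subseteq> L"
  proof -
    have "subfield Qp (K\<lparr>carrier := L\<rparr>)" using alg by (simp add: algebraic_closure_def)
    then have "Qp \<subseteq> carrier (K\<lparr>carrier := L\<rparr>)" by (rule subfieldE(3))
    then show ?thesis by simp
  qed
  ultimately have Qp: "Qp \<subseteq> carrier K" by blast
  have i: "i \<in> ring_hom (ring_of_type_algebra :: rat ring) (K\<lparr>carrier := Qp\<rparr>)"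
    and vi: "v (i x) = padic_abs p x" for x
    using c1 by (auto simp: is_completion_def)
  have aQ: "is_absolute_value (ring_of_type_algebra :: rat ring) (padic_abs p)"
    using c1 by (simp add: is_completion_def)
  have i_closed: "i x \<in> carrier K" for x using ring_hom_closed[OF i, of x] Qp by auto
  have i_add: "i (x + y) = i x \<oplus>\<^bsub>K\<^esub> i y" and i_one: "i 1 = \<one>\<^bsub>K\<^esub>" for x y
    using ring_hom_add[OF i, of x y] ring_hom_one[OF i] by simp_all
  have hc: "h x \<in> carrier K" for x using ring_hom_closed[OF h] by simp
  have hm: "h (x * y) = h x \<otimes>\<^bsub>K\<^esub> h y" and ha: "h (x + y) = h x \<oplus>\<^bsub>K\<^esub> h y" and h1: "h 1 = \<one>\<^bsub>K\<^esub>" for x y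
    using ring_hom_mult[OF h, of x y] ring_hom_add[OF h, of x y] ring_hom_one[OF h] by simp_all
  have i0: "i 0 = \<zero>\<^bsub>K\<^esub>"
  proof -
    have "i 0 \<oplus>\<^bsub>K\<^esub> i 0 = i 0" using i_add[of 0 0] by simp
    then show ?thesis using i_closed[of 0] by (simp add: add.l_cancel_one)
  qed
  have h0: "h 0 = \<zero>\<^bsub>K\<^esub>"
  proof -
    have "h 0 \<oplus>\<^bsub>K\<^esub> h 0 = h 0" using ha[of 0 0] by simp
    then show ?thesis using hc[of 0] by (simp add: add.l_cancel_one)
  qed
  have "h (of_nat m) = i (of_nat m)" for m
    by (induction m) (simp_all add: h0 i0 h1 i_one ha i_add)
  then have nat: "v (h (of_nat m)) = padic_abs p (of_nat m)" for m by (simp add: vi)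
  have "v (h (of_nat m)) \<le> 1" for m
    using padic_abs_of_int_le_1[OF p, of "int m"] by (simp add: nat)
  then show q: "qbar_valued_field K v h" by unfold_locales (rule h)
  interpret qbar_valued_field K v h by (rule q)
  have pm: "padic_abs p (x * y) = padic_abs p x * padic_abs p y" for x y
    using aQ by (simp add: is_absolute_value_def)
  have vm: "v (h (x * y)) = v (h x) * v (h y)" for x y by (simp add: h_mult v_mult)
  have hminus: "v (h (- 1)) = 1"
    by (rule multiplicative_minus_one[of "\<lambda>x. v (h x)"]) (simp_all add: vm h_one v_one v_nonneg)
  have pminus: "padic_abs p (- 1) = 1"
  proof (rule multiplicative_minus_one)
    show "padic_abs p 1 = 1" using vi[of 1] by (simp add: i_one v_one)
    show "0 \<le> padic_abs p (- 1)" using vi[of "- 1"] v_nonneg[OF i_closed[of "- 1"]] by simp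
  qed (rule pm)
  have pos: "v (h (of_rat r)) = padic_abs p r" if r: "0 \<le> r" for r
  proof -
    obtain a b where ab: "quotient_of r = (a, b)" by fastforce
    have b: "b > 0" using quotient_of_denom_pos[OF ab] .
    have eq: "r = of_int a / of_int b" using quotient_of_div[OF ab] .
    have "0 \<le> a" using r b by (simp add: eq zero_le_divide_iff)
    then obtain m n where mn: "a = int m" "b = int n" using b by (metis nonneg_int_cases less_imp_le)
    then have "n \<noteq> 0" using b by simp
    have "r * of_nat n = of_nat m" using \<open>n \<noteq> 0\<close> by (simp add: eq mn)
    then have "padic_abs p r * padic_abs p (of_nat n) = padic_abs p (of_nat m)" by (simp flip: pm)
    moreover have "of_rat r * of_nat n = (of_nat m :: qbar)"
      using \<open>n \<noteq> 0\<close> by (simp add: eq mn of_rat_divide)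
    then have "v (h (of_rat r)) * padic_abs p (of_nat n) = padic_abs p (of_nat m)" by (simp flip: vm nat)
    moreover have "padic_abs p (of_nat n) \<noteq> 0"
      using aQ \<open>n \<noteq> 0\<close> by (simp add: is_absolute_value_def)
    ultimately show ?thesis by (metis mult_right_cancel)
  qed
  show "padic_extension p (\<lambda>x. v (h x))"
  proof
    show "prime p" by (rule p)
    show "0 \<le> v (h x)" for x by (simp add: v_nonneg)
    show "v (h x) = 0 \<longleftrightarrow> x = 0" for x by (simp add: v_eq_0 h_eq_zero)
    show "v (h (x * y)) = v (h x) * v (h y)" for x y by (rule vm)
    show "v (h (x + y)) \<le> v (h x) + v (h y)" for x y by (simp add: h_add v_add)
    show "v (h (of_rat r)) = padic_abs p r" for r
    proof (cases "0 \<le> r")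
      case False
      then have "v (h (of_rat (- 1 * r))) = padic_abs p (- 1 * r)" by (intro pos) simp
      then show ?thesis
        unfolding of_rat_mult vm pm by (simp add: pminus hminus of_rat_minus)
    qed (rule pos)
  qed
qed

text \<open>In the unit disc no distance exceeds 1, and the unit points of
  \<open>ex_unit_points\<close> attain 1 for every pair.\<close>

lemma transfinite_diameter_padic_mandelbrot:
  assumes "qbar_valued_field K v h" "padic_extension p (\<lambda>x. v (h x))"
  shows "transfinite_diameter (av_dist K v) (padic_mandelbrot K v) = 1"
proof -
  interpret qbar_valued_field K v h by (rule assms(1))
  interpret w: padic_extension p "\<lambda>x. v (h x)" by (rule assms(2))
  have d: "av_dist K v x y \<le> 1 \<and> 0 \<le> av_dist K v x y"
    if "x \<in> padic_mandelbrot K v" "y \<in> padic_mandelbrot K v" for x y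
    using that v_diff_le_1[of x y] v_nonneg[of "x \<ominus>\<^bsub>K\<^esub> y"]
    by (simp add: padic_mandelbrot_def av_dist_def)
  show ?thesis
  proof (rule transfinite_diameter_eq_1)
    show "0 \<le> av_dist K v x y" if "x \<in> padic_mandelbrot K v" "y \<in> padic_mandelbrot K v" for x y
      using d[OF that] by blast
    show "av_dist K v x x = 0" if "x \<in> padic_mandelbrot K v" for x
      using that by (simp add: padic_mandelbrot_def av_dist_def a_minus_def r_neg v_zero)
    show "(\<lambda>n. 1 :: real) \<longlonglongrightarrow> 1" by simp
    fix T assume T: "T \<subseteq> padic_mandelbrot K v" "finite T" "2 \<le> card T"
    show "finite_diameter (av_dist K v) T \<le> 1"
      unfolding finite_diameter_def case_prod_unfold
      using T(1,3) d by (intro prod_le_1) (auto intro!: powr_le1 simp: subset_iff)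
  next
    fix n :: nat assume "2 \<le> n"
    from w.ex_unit_points[of n] obtain T where T: "finite T" "card T = n" "\<forall>x\<in>T. v (h x) = 1"
      "\<forall>x\<in>T. \<forall>y\<in>T. x \<noteq> y \<longrightarrow> v (h (x - y)) = 1" by (elim exE conjE)
    have "h x \<in> padic_mandelbrot K v" if "x \<in> T" for x
      using T(3) that by (simp add: padic_mandelbrot_def)
    then have "h ` T \<subseteq> padic_mandelbrot K v" by (rule image_subsetI)
    moreover have "finite_diameter (av_dist K v) (h ` T) = 1"
      unfolding finite_diameter_def
    proof (intro prod.neutral ballI)
      fix z assume "z \<in> {(x, y). x \<in> h ` T \<and> y \<in> h ` T \<and> x \<noteq> y}"
      then obtain x y where z: "z = (h x, h y)" "x \<in> T" "y \<in> T" "x \<noteq> y" by blast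
      then have "av_dist K v (h x) (h y) = 1" using T(4) by (simp add: av_dist_def flip: h_diff)
      then show "(case z of (x, y) \<Rightarrow> av_dist K v x y powr (1 / (real (card (h ` T)) * (real (card (h ` T)) - 1)))) = 1"
        by (simp add: z(1))
    qed
    ultimately show "\<exists>T\<subseteq>padic_mandelbrot K v. finite T \<and> card T = n \<and> 1 \<le> finite_diameter (av_dist K v) T"
      using T(1,2) h_inj by (intro exI[of _ "h ` T"]) (simp add: card_image)
  qed
qed

theorem theorem8p15:
  fixes C :: "nat \<Rightarrow> 'k ring" and av :: "nat \<Rightarrow> 'k \<Rightarrow> real"
    and \<iota> :: "nat \<Rightarrow> qbar \<Rightarrow> 'k" and \<iota>inf :: "qbar \<Rightarrow> complex"
    and S :: "nat \<Rightarrow> qbar set"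
  assumes C: "\<And>p. prime p \<Longrightarrow> is_padic_complex_field p (C p) (av p)"
    and \<iota>: "\<And>p. prime p \<Longrightarrow> \<iota> p \<in> ring_hom Qbar (C p)"
    and \<iota>inf: "\<iota>inf \<in> ring_hom Qbar (ring_of_type_algebra :: complex ring)"
    and S_distinct: "inj S"
    and S_finite: "\<And>n. finite (S n)"
    and S_galois: "\<And>n. galois_stable (S n)"
    and height: "(\<lambda>n. mandelbrot_height \<iota>inf av \<iota> (S n)) \<longlonglongrightarrow> 0"
  shows "pseudo_equidistributed (\<lambda>x y. cmod (x - y)) mandelbrot lambda_inf (\<lambda>n. \<iota>inf ` S n)
    \<and> (\<forall>p. prime p \<longrightarrow>
          pseudo_equidistributed (av_dist (C p) (av p)) (padic_mandelbrot (C p) (av p))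
            (lambda_padic (av p)) (\<lambda>n. \<iota> p ` S n))
    \<and> equidistributed (\<lambda>n. \<iota>inf ` S n) (equilibrium_measure mandelbrot)"
proof -
  define w where "w p x = av p (\<iota> p x)" for p x
  have field_p: "qbar_valued_field (C p) (av p) (\<iota> p)" if "prime p" for p
    using padic_complex_field_hom(1)[OF C[OF that] that \<iota>[OF that]] .
  have ext_p: "padic_extension p (w p)" if "prime p" for p
    using padic_complex_field_hom(2)[OF C[OF that] that \<iota>[OF that]] by (simp add: w_def[abs_def])
  have emb: "ring_embedding \<iota>inf"
    using ring_hom_add[OF \<iota>inf] ring_hom_mult[OF \<iota>inf] ring_hom_one[OF \<iota>inf] by unfold_locales simp_all
  interpret adelic \<iota>inf w using emb ext_p by (simp add: adelic_def adelic_axioms_def)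
  have ht: "mandelbrot_height \<iota>inf av \<iota> T = 1 / real (card T) * total_height T" for T
    by (simp add: mandelbrot_height_def total_height_def lambda_padic_def w_def)
  have h0: "(\<lambda>n. 1 / real (card (S n)) * total_height (S n)) \<longlonglongrightarrow> 0"
    using height by (simp only: ht)
  have top: "filterlim (\<lambda>n. card (S n)) at_top sequentially"
    by (rule card_at_top[OF S_distinct S_finite S_galois h0])
  have local_0: "(\<lambda>n. 1 / real (card (S n)) * f n) \<longlonglongrightarrow> 0"
    if "\<And>n. 0 \<le> f n" "\<And>n. f n \<le> total_height (S n)" for f :: "nat \<Rightarrow> real"
  proof (rule tendsto_sandwich[OF _ _ tendsto_const h0])
    show "\<forall>\<^sub>F n in sequentially. 0 \<le> 1 / real (card (S n)) * f n" using that(1) by simp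
    show "\<forall>\<^sub>F n in sequentially. 1 / real (card (S n)) * f n \<le> 1 / real (card (S n)) * total_height (S n)"
      using that(2) by (intro always_eventually allI mult_left_mono) auto
  qed
  have inf_0: "(\<lambda>n. 1 / real (card (S n)) * inf_height (S n)) \<longlonglongrightarrow> 0"
    by (rule local_0) (auto intro: inf_height_nonneg local_heights_le_total S_finite S_galois)
  have sum_inf: "(\<Sum>z\<in>\<iota>inf ` S n. lambda_inf z) = inf_height (S n)" for n
    by (simp add: inf_height_def sum.reindex iota.inj)
  have card_inf: "card (\<iota>inf ` S n) = card (S n)" for n by (rule card_image[OF iota.inj])
  note est = disc_estimates[OF S_finite S_galois]
  have pseudo_inf: "pseudo_equidistributed (\<lambda>x y. cmod (x - y)) mandelbrot lambda_inf (\<lambda>n. \<iota>inf ` S n)"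
    unfolding pseudo_equidistributed_def card_inf sum_inf transfinite_diameter_mandelbrot_eq_1
  proof (intro conjI inf_0 top)
    have "finite_diameter (\<lambda>x y. cmod (x - y)) (\<iota>inf ` S n)
        = disc_inf (S n) powr (1 / (real (card (S n)) * (real (card (S n)) - 1)))" for n
      using S_finite by (subst finite_diameter_eq_disc) (simp_all add: card_inf disc_inf_image)
    moreover have "(\<lambda>n. disc_inf (S n) powr (1 / (real (card (S n)) * (real (card (S n)) - 1)))) \<longlonglongrightarrow> 1"
      by (rule finite_diameter_tendsto_1[OF top h0]) (rule est(1,2), assumption)+
    ultimately show "(\<lambda>n. finite_diameter (\<lambda>x y. cmod (x - y)) (\<iota>inf ` S n)) \<longlonglongrightarrow> 1" by simp
  qed
  have pseudo_p: "pseudo_equidistributed (av_dist (C p) (av p)) (padic_mandelbrot (C p) (av p))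
      (lambda_padic (av p)) (\<lambda>n. \<iota> p ` S n)" if p: "prime p" for p
  proof -
    interpret K: qbar_valued_field "C p" "av p" "\<iota> p" using p by (rule field_p)
    have card_p: "card (\<iota> p ` S n) = card (S n)" for n by (rule card_image[OF K.h_inj])
    have sum_p: "(\<Sum>z\<in>\<iota> p ` S n. lambda_padic (av p) z) = local_height p (S n)" for n
      by (simp add: local_height_def lambda_padic_def w_def sum.reindex K.h_inj)
    have tfd: "transfinite_diameter (av_dist (C p) (av p)) (padic_mandelbrot (C p) (av p)) = 1"
      using transfinite_diameter_padic_mandelbrot[OF field_p[OF p]] ext_p[OF p] by (simp add: w_def[abs_def])
    have dist: "av_dist (C p) (av p) (\<iota> p x) (\<iota> p y) = w p (x - y)" for x y
      by (simp add: av_dist_def w_def K.h_diff)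
    show ?thesis
      unfolding pseudo_equidistributed_def card_p sum_p tfd
    proof (intro conjI top)
      show "(\<lambda>n. 1 / real (card (S n)) * local_height p (S n)) \<longlonglongrightarrow> 0"
        by (rule local_0) (auto intro: local_height_nonneg local_heights_le_total S_finite S_galois p)
      have "finite_diameter (av_dist (C p) (av p)) (\<iota> p ` S n)
          = disc_p p (S n) powr (1 / (real (card (S n)) * (real (card (S n)) - 1)))" for n
      proof -
        have "disc (av_dist (C p) (av p)) (\<iota> p ` S n) = disc_p p (S n)"
          unfolding disc_image[OF K.h_inj] dist ..
        moreover have "0 \<le> av_dist (C p) (av p) x y" if "x \<in> \<iota> p ` S n" "y \<in> \<iota> p ` S n" for x y
          using that K.v_nonneg by (auto simp: av_dist_def)
        ultimately show ?thesis using S_finite by (subst finite_diameter_eq_disc) (simp_all add: card_p)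
      qed
      moreover have "(\<lambda>n. disc_p p (S n) powr (1 / (real (card (S n)) * (real (card (S n)) - 1)))) \<longlonglongrightarrow> 1"
        by (rule finite_diameter_tendsto_1[OF top h0]) (rule est(3,4), assumption, rule p)+
      ultimately show "(\<lambda>n. finite_diameter (av_dist (C p) (av p)) (\<iota> p ` S n)) \<longlonglongrightarrow> 1" by simp
    qed
  qed
  \<comment> \<open>One of the sets may be empty, whereas \<open>small_sets\<close> asks for
    nonempty ones; the sequence is therefore shifted by \<open>n0\<close>, which does not affect the
    limit.\<close>
  obtain n0 where n0: "\<And>n. n0 \<le> n \<Longrightarrow> 1 \<le> card (S n)"
    using top unfolding filterlim_at_top eventually_sequentially by blast
  define U where "U n = \<iota>inf ` S (n + n0)" for n
  have cardU: "card (U n) = card (S (n + n0))" for n by (simp add: U_def card_inf)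
  interpret small_sets U
  proof
    show "finite (U n)" for n by (simp add: U_def S_finite)
    show "U n \<noteq> {}" for n using n0[of "n + n0"] by (auto simp: U_def)
    show "filterlim (\<lambda>n. card (U n)) at_top sequentially"
      unfolding cardU by (rule filterlim_compose[OF top filterlim_add_const_nat_at_top])
    have "average (U n) lambda_inf = 1 / real (card (S (n + n0))) * inf_height (S (n + n0))" for n
      unfolding average_def cardU by (simp add: U_def sum_inf)
    then show "(\<lambda>n. average (U n) lambda_inf) \<longlonglongrightarrow> 0"
      using LIMSEQ_ignore_initial_segment[OF inf_0, of n0] by simp
    have bound: "norm (ln (disc_inf (S n)) / (real (card (S n)))\<^sup>2)
        \<le> 4 * ln (real (card (S n))) / real (card (S n)) + 2 * (1 / real (card (S n)) * total_height (S n))"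
      if "n0 \<le> n" for n
    proof -
      let ?N = "real (card (S n))"
      have N: "0 < ?N" using n0[OF that] by simp
      have "norm (ln (disc_inf (S n)) / ?N\<^sup>2) = \<bar>ln (disc_inf (S n))\<bar> / ?N\<^sup>2" by (simp add: abs_divide)
      also have "\<dots> \<le> ?N * (4 * ln ?N + 2 * total_height (S n)) / ?N\<^sup>2"
        using N by (intro divide_right_mono est(2)) auto
      also have "\<dots> = 4 * ln ?N / ?N + 2 * (1 / ?N * total_height (S n))"
        using N by (simp add: power2_eq_square add_divide_distrib)
      finally show ?thesis .
    qed
    have lim: "(\<lambda>n. 4 * ln (real (card (S n))) / real (card (S n)) + 2 * (1 / real (card (S n)) * total_height (S n))) \<longlonglongrightarrow> 0 + 2 * 0"
    proof (intro tendsto_add tendsto_mult tendsto_const h0)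
      show "(\<lambda>n. 4 * ln (real (card (S n))) / real (card (S n))) \<longlonglongrightarrow> 0"
        by (rule filterlim_compose[OF _ top, of "\<lambda>k. 4 * ln (real k) / real k"]) real_asymp
    qed
    have "(\<lambda>n. ln (disc_inf (S n)) / (real (card (S n)))\<^sup>2) \<longlonglongrightarrow> 0"
    proof (rule Lim_null_comparison)
      show "\<forall>\<^sub>F n in sequentially. norm (ln (disc_inf (S n)) / (real (card (S n)))\<^sup>2)
        \<le> 4 * ln (real (card (S n))) / real (card (S n)) + 2 * (1 / real (card (S n)) * total_height (S n))"
        unfolding eventually_sequentially using bound by blast
    qed (use lim in simp)
    from LIMSEQ_ignore_initial_segment[OF this, of n0]
    show "(\<lambda>n. ln (disc (\<lambda>x y. cmod (x - y)) (U n)) / (real (card (U n)))\<^sup>2) \<longlonglongrightarrow> 0"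
      unfolding cardU unfolding U_def disc_inf_image .
  qed
  have "equidistributed (\<lambda>n. \<iota>inf ` S n) (equilibrium_measure mandelbrot)"
    unfolding equidistributed_def weakly_converges_def
  proof (intro allI impI)
    fix f :: "complex \<Rightarrow> real" assume f: "continuous_on UNIV f" "bounded (range f)"
    have "f \<in> borel_measurable borel" using f(1) by (rule borel_measurable_continuous_onI)
    then have eq: "(\<integral>z. f z \<partial>empirical_measure (\<iota>inf ` S n)) = average (\<iota>inf ` S n) f" for n
      unfolding empirical_measure_def using S_finite by (subst integral_uniform_distr) auto
    have "(\<lambda>n. average (\<iota>inf ` S (n + n0)) f) \<longlonglongrightarrow> (\<integral>z. f z \<partial>equilibrium_measure mandelbrot)"
      using average_tendsto[OF f] by (simp only: U_def)
    then have "(\<lambda>n. average (\<iota>inf ` S n) f) \<longlonglongrightarrow> (\<integral>z. f z \<partial>equilibrium_measure mandelbrot)"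
      by (rule LIMSEQ_offset)
    then show "(\<lambda>n. \<integral>z. f z \<partial>empirical_measure (\<iota>inf ` S n)) \<longlonglongrightarrow> (\<integral>z. f z \<partial>equilibrium_measure mandelbrot)"
      by (simp only: eq)
  qed
  then show ?thesis using pseudo_inf pseudo_p by blast
qed

end
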